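(* If $G$ is a MMIK graph, then no vertex of degree 3 in $G$ lies in a 3-cycle of $G$.
   Context: Graphs are finite and simple; spatial embeddings are (tame) embeddings in $\mathbb{R}^3$. A graph is intrinsically knotted (IK) if every spatial embedding of it contains a non-trivially knotted cycle; otherwise it is nIK (it has a knotless embedding). A graph $G$ is minor minimal intrinsically knotted (MMIK) if $G$ is IK and no proper minor of $G$ is IK, where a proper minor is a graph obtained from $G$ by one or more edge deletions, vertex deletions or edge contractions. *)

theory Defs
  imports "HOL-Analysis.Analysis"
begin

record 'a sgraph =
  verts :: "'a set"
  edges :: "'a set set"

definition simple_graph :: "'a sgraph \<Rightarrow> bool" where
  "simple_graph G \<longleftrightarrow>
     finite (verts G) \<and> (\<forall>e\<in>edges G. e \<subseteq> verts G \<and> card e = 2)"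

definition vdegree :: "'a sgraph \<Rightarrow> 'a \<Rightarrow> nat" where
  "vdegree G v = card {e \<in> edges G. v \<in> e}"

definition cycle_edges :: "'a list \<Rightarrow> 'a set set" where
  "cycle_edges vs = {{vs ! i, vs ! (Suc i mod length vs)} | i. i < length vs}"

definition graph_cycle :: "'a sgraph \<Rightarrow> 'a list \<Rightarrow> bool" where
  "graph_cycle G vs \<longleftrightarrow>
     length vs \<ge> 3 \<and> distinct vs \<and> set vs \<subseteq> verts G \<and> cycle_edges vs \<subseteq> edges G"

definition delete_edge :: "'a sgraph \<Rightarrow> 'a set \<Rightarrow> 'a sgraph" where
  "delete_edge G e = \<lparr>verts = verts G, edges = edges G - {e}\<rparr>"

definition delete_vertex :: "'a sgraph \<Rightarrow> 'a \<Rightarrow> 'a sgraph" where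
  "delete_vertex G v = \<lparr>verts = verts G - {v}, edges = {e \<in> edges G. v \<notin> e}\<rparr>"

text \<open>The vertex \<open>v\<close> is merged into \<open>u\<close>. Parallel edges collapse because edges are sets, and the
  condition on the cardinality removes the loop arising from the contracted edge, so the result
  is again a simple graph.\<close>

definition contract_edge :: "'a sgraph \<Rightarrow> 'a \<Rightarrow> 'a \<Rightarrow> 'a sgraph" where
  "contract_edge G u v =
     \<lparr>verts = verts G - {v}, edges = {id(v := u) ` e | e. e \<in> edges G \<and> card (id(v := u) ` e) = 2}\<rparr>"

inductive minor_step :: "'a sgraph \<Rightarrow> 'a sgraph \<Rightarrow> bool" where
  "e \<in> edges G \<Longrightarrow> minor_step G (delete_edge G e)"
| "v \<in> verts G \<Longrightarrow> minor_step G (delete_vertex G v)"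
| "{u, v} \<in> edges G \<Longrightarrow> minor_step G (contract_edge G u v)"

definition proper_minor :: "'a sgraph \<Rightarrow> 'a sgraph \<Rightarrow> bool" where
  "proper_minor H G \<longleftrightarrow> minor_step\<^sup>+\<^sup>+ G H"

text \<open>An embedding of the geometric realization of \<open>G\<close> is given by the positions \<open>p\<close> of the
  vertices and a parametrized arc \<open>\<gamma> e\<close> for every edge \<open>e\<close>, which may run in either direction.\<close>

definition graph_embedding ::
  "'a sgraph \<Rightarrow> ('a \<Rightarrow> real^3) \<Rightarrow> ('a set \<Rightarrow> real \<Rightarrow> real^3) \<Rightarrow> bool" where
  "graph_embedding G p \<gamma> \<longleftrightarrow>
     inj_on p (verts G) \<and>
     (\<forall>e\<in>edges G. arc (\<gamma> e) \<and> {pathstart (\<gamma> e), pathfinish (\<gamma> e)} = p ` e) \<and>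
     (\<forall>e\<in>edges G. \<forall>v\<in>verts G. v \<notin> e \<longrightarrow> p v \<notin> path_image (\<gamma> e)) \<and>
     (\<forall>e\<in>edges G. \<forall>e'\<in>edges G. e \<noteq> e' \<longrightarrow>
        path_image (\<gamma> e) \<inter> path_image (\<gamma> e') \<subseteq> p ` (e \<inter> e'))"

definition self_homeomorphism :: "(real^3 \<Rightarrow> real^3) \<Rightarrow> bool" where
  "self_homeomorphism h \<longleftrightarrow> (\<exists>g. homeomorphism UNIV UNIV h g)"

definition polygonal :: "(real^3) set \<Rightarrow> bool" where
  "polygonal S \<longleftrightarrow> (\<exists>F. finite F \<and> S = (\<Union>(a, b)\<in>F. closed_segment a b))"

definition tame_embedding ::
  "'a sgraph \<Rightarrow> ('a \<Rightarrow> real^3) \<Rightarrow> ('a set \<Rightarrow> real \<Rightarrow> real^3) \<Rightarrow> bool" where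
  "tame_embedding G p \<gamma> \<longleftrightarrow>
     graph_embedding G p \<gamma> \<and>
     (\<exists>h. self_homeomorphism h \<and> (\<forall>e\<in>edges G. polygonal (h ` path_image (\<gamma> e))))"

text \<open>The homotopy from the identity to \<open>h\<close> runs through self-homeomorphisms of the whole space,
  that is, it is an ambient isotopy.\<close>

definition ambient_isotopic :: "(real^3) set \<Rightarrow> (real^3) set \<Rightarrow> bool" where
  "ambient_isotopic K L \<longleftrightarrow>
     (\<exists>h. homotopic_with_canon self_homeomorphism UNIV UNIV id h \<and> h ` K = L)"

definition trivial_knot :: "(real^3) set \<Rightarrow> bool" where
  "trivial_knot K \<longleftrightarrow> ambient_isotopic K {x. norm x = 1 \<and> x $ 3 = 0}"

definition cycle_image :: "('a set \<Rightarrow> real \<Rightarrow> real^3) \<Rightarrow> 'a list \<Rightarrow> (real^3) set" where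
  "cycle_image \<gamma> vs = (\<Union>e\<in>cycle_edges vs. path_image (\<gamma> e))"

definition intrinsically_knotted :: "'a sgraph \<Rightarrow> bool" where
  "intrinsically_knotted G \<longleftrightarrow>
     (\<forall>p \<gamma>. tame_embedding G p \<gamma> \<longrightarrow>
        (\<exists>vs. graph_cycle G vs \<and> \<not> trivial_knot (cycle_image \<gamma> vs)))"

definition MMIK :: "'a sgraph \<Rightarrow> bool" where
  "MMIK G \<longleftrightarrow>
     simple_graph G \<and> intrinsically_knotted G \<and>
     (\<forall>H. proper_minor H G \<longrightarrow> \<not> intrinsically_knotted H)"

end

theory Submission
  imports Defs
begin

text \<open>
  Let \<open>v\<close> have degree 3 and lie on a triangle with further vertices \<open>a\<close> and \<open>b\<close>. By minimality,
  \<open>G\<close> without the edge \<open>ab\<close> has a knotless embedding. Put the edge \<open>ab\<close> back as a close parallel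
  copy of the path \<open>a v b\<close>. A cycle through the new edge either avoids \<open>v\<close>, and then it slides onto a
  cycle through \<open>a v b\<close>; or it is the triangle, which bounds a disc; or, as \<open>v\<close> has degree 3, it
  continues from \<open>ab\<close> to \<open>v\<close> along \<open>av\<close> or \<open>bv\<close>, and then it slides across the disc onto a cycle
  that takes the other edge to \<open>v\<close>. So \<open>G\<close> is not intrinsically knotted.

  The embedding is polygonal only after a homeomorphism \<open>h\<close> of space about which nothing is
  known, and it has to be shown that a trivial knot with polygonal image under \<open>h\<close> has a trivial
  image. An Eilenberg--Mazur swindle does this: at a point where the image is straight, \<open>h\<close> can be
  replaced by a homeomorphism that is tangent to the identity there, and such a homeomorphism is
  isotopic to the identity by Alexander's trick.

  The parallel copy is a translate of the path in a direction \<open>w\<close> so generic and short that no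
  segment from \<open>x\<close> to \<open>x + w\<close> with \<open>x\<close> in the graph meets the graph again. The disc between the
  path and its copy is then triangulated, and all slides are sequences of moves across triangles.
\<close>

section \<open>Ambient isotopies\<close>

text \<open>The obstacle is that the straightening homeomorphism comes with no isotopy to the
  identity and may reverse orientation. What rescues the argument is that only the image of the
  circle matters: the homeomorphism may be exchanged for any other with the same image. In the
  swindle it enters only through conjugates of radial maps, so a reversal of orientation cancels.

  The triangle moves are made of one explicit shear: a tent function pushes one side of a standard
  triangle over the other two, and an affine map transports it to any triangle.

  Translation in a generic direction is chosen for the parallel copy because base point and height
  then become coordinates on the swept strip; the disjointness conditions of the moves reduce to
  comparing coordinates. All slides are one sweep over the cells of the strip: crossing a cell
  toggles whether its base segment belongs to the curve, and the slides differ only in the node up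
  to which the base is present at the start.\<close>

lemma self_homeomorphismI:
  assumes "continuous_on UNIV h" "inj h" "surj h"
  shows "self_homeomorphism h"
proof -
  \<comment> \<open>Invariance of domain makes the inverse continuous.\<close>
  obtain g where "homeomorphism UNIV (range h) h g"
    using invariance_of_domain_homeomorphism[of UNIV h] assms by auto
  then show ?thesis using assms(3) by (auto simp: self_homeomorphism_def)
qed

lemma self_homeomorphismD:
  assumes "self_homeomorphism h"
  shows "continuous_on UNIV h" "inj h" "surj h" "bij h"
proof -
  obtain g where g: "homeomorphism UNIV UNIV h g"
    using assms by (auto simp: self_homeomorphism_def)
  show "continuous_on UNIV h" using g by (auto simp: homeomorphism_def)
  show 1: "inj h" using g by (metis homeomorphism_apply1 inj_on_def iso_tuple_UNIV_I)
  show 2: "surj h" using g by (auto simp: homeomorphism_def)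
  show "bij h" using 1 2 by (simp add: bij_def)
qed

lemma self_homeomorphism_inv:
  assumes "self_homeomorphism h"
  shows "self_homeomorphism (inv h)"
proof -
  obtain g where g: "homeomorphism UNIV UNIV h g"
    using assms by (auto simp: self_homeomorphism_def)
  have "inv h = g"
    using g by (intro inv_equality) (auto simp: homeomorphism_def)
  moreover have "homeomorphism UNIV UNIV g h" using g by (rule homeomorphism_symD)
  ultimately show ?thesis by (auto simp: self_homeomorphism_def)
qed

lemma self_homeomorphism_comp:
  assumes "self_homeomorphism h" "self_homeomorphism k"
  shows "self_homeomorphism (h \<circ> k)"
  using assms homeomorphism_compose unfolding self_homeomorphism_def by blast

lemma self_homeomorphism_id: "self_homeomorphism id" "self_homeomorphism (\<lambda>x. x)"
  by (auto simp: id_def intro!: self_homeomorphismI)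

lemma self_homeomorphism_inv_simps:
  assumes "self_homeomorphism h"
  shows "h (inv h x) = x" "inv h (h x) = x"
  using self_homeomorphismD[OF assms] by (auto simp: surj_f_inv_f)

definition isotopic_id :: "(real^3 \<Rightarrow> real^3) \<Rightarrow> bool" where
  "isotopic_id h \<longleftrightarrow> homotopic_with_canon self_homeomorphism UNIV UNIV id h"

lemma isotopic_idI:
  fixes H :: "real \<Rightarrow> real^3 \<Rightarrow> real^3"
  assumes "continuous_on ({0..1} \<times> UNIV) (\<lambda>(t, x). H t x)"
    and "\<And>t. t \<in> {0..1} \<Longrightarrow> self_homeomorphism (H t)"
    and "\<And>x. H 0 x = x" and "\<And>x. H 1 x = h x"
  shows "isotopic_id h"
  unfolding isotopic_id_def homotopic_with_def prod_topology_subtopology_eu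
proof (rule exI[of _ "\<lambda>(t, x). H t x"], intro conjI allI ballI)
  show "continuous_map (top_of_set ({0..1} \<times> UNIV)) (top_of_set UNIV) (\<lambda>(t, x). H t x)"
    using assms(1) by simp
qed (use assms in auto)

lemma isotopic_idE:
  assumes "isotopic_id h"
  obtains H :: "real \<Rightarrow> real^3 \<Rightarrow> real^3"
  where "continuous_on ({0..1} \<times> UNIV) (\<lambda>y. H (fst y) (snd y))"
    and "\<And>t. t \<in> {0..1} \<Longrightarrow> self_homeomorphism (H t)"
    and "\<And>x. H 0 x = x" and "\<And>x. H 1 x = h x"
proof -
  obtain K where K: "continuous_map (top_of_set ({0..1::real} \<times> UNIV)) (top_of_set UNIV) K"
    "\<forall>x. K (0, x) = id x" "\<forall>x. K (1, x) = h x" "\<forall>t\<in>{0..1}. self_homeomorphism (\<lambda>x. K (t, x))"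
    using assms unfolding isotopic_id_def homotopic_with_def prod_topology_subtopology_eu by blast
  show ?thesis
    by (rule that[of "\<lambda>t x. K (t, x)"]) (use K in auto)
qed

lemma isotopic_id_self_homeomorphism:
  assumes "isotopic_id h"
  shows "self_homeomorphism h"
proof -
  obtain H :: "real \<Rightarrow> real^3 \<Rightarrow> real^3" where "self_homeomorphism (H 1)" "\<And>x. H 1 x = h x"
    using isotopic_idE[OF assms] by (metis atLeastAtMost_iff order_refl zero_le_one)
  moreover have "H 1 = h" using calculation(2) by auto
  ultimately show ?thesis by simp
qed

lemma isotopic_id_id: "isotopic_id (\<lambda>x. x)"
  by (rule isotopic_idI[where H = "\<lambda>t x. x"])
     (auto simp: case_prod_unfold self_homeomorphism_id intro!: continuous_intros)

lemma isotopic_id_comp: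
  assumes "isotopic_id h" "isotopic_id k"
  shows "isotopic_id (h \<circ> k)"
proof -
  obtain H :: "real \<Rightarrow> real^3 \<Rightarrow> real^3" where H: "continuous_on ({0..1} \<times> UNIV) (\<lambda>y. H (fst y) (snd y))"
    "\<And>t. t \<in> {0..1} \<Longrightarrow> self_homeomorphism (H t)"
    "\<And>x. H 0 x = x" "\<And>x. H 1 x = h x"
    by (rule isotopic_idE[OF assms(1)]) (rule that)
  obtain K :: "real \<Rightarrow> real^3 \<Rightarrow> real^3" where K: "continuous_on ({0..1} \<times> UNIV) (\<lambda>y. K (fst y) (snd y))"
    "\<And>t. t \<in> {0..1} \<Longrightarrow> self_homeomorphism (K t)"
    "\<And>x. K 0 x = x" "\<And>x. K 1 x = k x"
    by (rule isotopic_idE[OF assms(2)]) (rule that)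
  show ?thesis
  proof (rule isotopic_idI[where H = "\<lambda>t. H t \<circ> K t"])
    have "continuous_on ({0..1} \<times> UNIV) ((\<lambda>y. H (fst y) (snd y)) \<circ> (\<lambda>y. (fst y, K (fst y) (snd y))))"
      by (intro continuous_on_compose continuous_intros continuous_on_subset[OF H(1)] K(1))
         auto
    then show "continuous_on ({0..1} \<times> UNIV) (\<lambda>(t, x). (H t \<circ> K t) x)"
      by (simp add: case_prod_unfold o_def)
    show "self_homeomorphism (H t \<circ> K t)" if "t \<in> {0..1}" for t
      using that H K self_homeomorphism_comp by auto
  qed (use H K in auto)
qed

lemma isotopic_id_inv:
  assumes "isotopic_id h"
  shows "isotopic_id (inv h)"
proof -
  obtain H :: "real \<Rightarrow> real^3 \<Rightarrow> real^3" where H: "continuous_on ({0..1} \<times> UNIV) (\<lambda>y. H (fst y) (snd y))"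
    "\<And>t. t \<in> {0..1} \<Longrightarrow> self_homeomorphism (H t)"
    "\<And>x. H 0 x = x" "\<And>x. H 1 x = h x"
    by (rule isotopic_idE[OF assms(1)]) (rule that)
  have h: "self_homeomorphism h" using assms isotopic_id_self_homeomorphism by blast
  have hi: "self_homeomorphism (inv h)" using h self_homeomorphism_inv by blast
  note c = self_homeomorphismD(1)[OF hi]
  show ?thesis
  proof (rule isotopic_idI[where H = "\<lambda>t. H (1 - t) \<circ> inv h"])
    have "continuous_on ({0..1} \<times> UNIV) ((\<lambda>y. H (fst y) (snd y)) \<circ> (\<lambda>y. (1 - fst y, inv h (snd y))))"
      by (intro continuous_on_compose continuous_intros continuous_on_subset[OF H(1)]
             continuous_on_compose2[OF c])
         auto
    then show "continuous_on ({0..1} \<times> UNIV) (\<lambda>(t, x). (H (1 - t) \<circ> inv h) x)"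
      by (simp add: case_prod_unfold o_def)
    show "self_homeomorphism (H (1 - t) \<circ> inv h)" if "t \<in> {0..1}" for t
      using that H hi self_homeomorphism_comp by auto
  qed (use H self_homeomorphism_inv_simps[OF h] in auto)
qed

text \<open>Conjugating every stage keeps the identity at time 0, so \<open>g\<close> itself may be
  any homeomorphism, even one that reverses orientation.\<close>

lemma isotopic_id_conj:
  assumes "isotopic_id h" and g: "self_homeomorphism g"
  shows "isotopic_id (inv g \<circ> h \<circ> g)"
proof -
  obtain H :: "real \<Rightarrow> real^3 \<Rightarrow> real^3" where H: "continuous_on ({0..1} \<times> UNIV) (\<lambda>y. H (fst y) (snd y))"
    "\<And>t. t \<in> {0..1} \<Longrightarrow> self_homeomorphism (H t)"
    "\<And>x. H 0 x = x" "\<And>x. H 1 x = h x"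
    by (rule isotopic_idE[OF assms(1)]) (rule that)
  have hi: "self_homeomorphism (inv g)" using g self_homeomorphism_inv by blast
  note c = self_homeomorphismD(1)[OF hi] and c' = self_homeomorphismD(1)[OF g]
  show ?thesis
  proof (rule isotopic_idI[where H = "\<lambda>t. inv g \<circ> H t \<circ> g"])
    have "continuous_on ({0..1} \<times> UNIV) (inv g \<circ> ((\<lambda>y. H (fst y) (snd y)) \<circ> (\<lambda>y. (fst y, g (snd y)))))"
      by (intro continuous_on_compose continuous_intros continuous_on_subset[OF H(1)]
             continuous_on_compose2[OF c'] continuous_on_subset[OF c])
         auto
    then show "continuous_on ({0..1} \<times> UNIV) (\<lambda>(t, x). (inv g \<circ> H t \<circ> g) x)"
      by (simp add: case_prod_unfold o_def)
    show "self_homeomorphism (inv g \<circ> H t \<circ> g)" if "t \<in> {0..1}" for t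
      using that H hi g self_homeomorphism_comp by auto
  qed (use H self_homeomorphism_inv_simps[OF g] in auto)
qed

lemma ambient_isotopicI: "isotopic_id h \<Longrightarrow> h ` K = L \<Longrightarrow> ambient_isotopic K L"
  by (auto simp: ambient_isotopic_def isotopic_id_def)

lemma ambient_isotopicE:
  assumes "ambient_isotopic K L"
  obtains h where "isotopic_id h" "h ` K = L"
  using assms by (auto simp: ambient_isotopic_def isotopic_id_def)

lemma ambient_isotopic_refl: "ambient_isotopic K K"
  using isotopic_id_id by (rule ambient_isotopicI) auto

lemma ambient_isotopic_sym:
  assumes "ambient_isotopic K L" shows "ambient_isotopic L K"
proof -
  obtain h where h: "isotopic_id h" "h ` K = L" using assms by (rule ambient_isotopicE)
  have "inv h ` L = K"
    using h self_homeomorphism_inv_simps(2)[OF isotopic_id_self_homeomorphism[OF h(1)]]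
    by (auto simp: image_iff)
  then show ?thesis using isotopic_id_inv[OF h(1)] ambient_isotopicI by blast
qed

lemma ambient_isotopic_trans [trans]:
  assumes "ambient_isotopic K L" "ambient_isotopic L M" shows "ambient_isotopic K M"
  using assms isotopic_id_comp unfolding ambient_isotopic_def isotopic_id_def[symmetric]
  by (metis image_comp)

text \<open>Only the variation of \<open>u\<close> along the lines parallel to \<open>d\<close> matters, and only in the sense
  that two points on such a line must not be swapped.\<close>

lemma isotopic_id_shear:
  fixes u :: "real^3 \<Rightarrow> real"
  assumes cont: "continuous_on UNIV u"
    and bounds: "\<And>x. 0 \<le> u x" "\<And>x. u x \<le> B"
    and mono: "\<And>x s. 0 < s \<Longrightarrow> u x - u (x + s *\<^sub>R d) < s"
  shows "isotopic_id (\<lambda>x. x + u x *\<^sub>R d)"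
proof (rule isotopic_idI[where H = "\<lambda>t x. x + (t * u x) *\<^sub>R d"])
  show "continuous_on ({0..1} \<times> UNIV) (\<lambda>(t, x). x + (t * u x) *\<^sub>R d)"
    unfolding case_prod_unfold
    by (intro continuous_intros continuous_on_compose2[OF cont]) auto
next
  fix t :: real assume t: "t \<in> {0..1}"
  \<comment> \<open>The hypothesis bounds a difference from above by a positive number, so it
    survives scaling by \<open>t \<le> 1\<close> whatever the sign of the difference.\<close>
  have mono': "t * (u x - u (x + s *\<^sub>R d)) < s" if "0 < s" for x s
  proof (cases "u x - u (x + s *\<^sub>R d) \<le> 0")
    case True
    then have "t * (u x - u (x + s *\<^sub>R d)) \<le> 0" using t by (simp add: mult_nonneg_nonpos)
    then show ?thesis using that by linarith
  next
    case False
    have "t * (u x - u (x + s *\<^sub>R d)) \<le> 1 * (u x - u (x + s *\<^sub>R d))"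
      using t False by (intro mult_right_mono) auto
    also have "\<dots> < s" using mono[OF that, of x] by simp
    finally show ?thesis .
  qed
  show "self_homeomorphism (\<lambda>x. x + (t * u x) *\<^sub>R d)"
  proof (rule self_homeomorphismI)
    show "continuous_on UNIV (\<lambda>x. x + (t * u x) *\<^sub>R d)"
      using cont by (intro continuous_intros)
  next
    have aux: "False" if "y = x + \<sigma> *\<^sub>R d" "\<sigma> = t * (u x - u y)" "\<sigma> > 0" for x y \<sigma>
      using mono'[OF that(3), of x, folded that(1)] that(2) by linarith
    show "inj (\<lambda>x. x + (t * u x) *\<^sub>R d)"
    proof (rule injI)
      fix x y assume eq: "x + (t * u x) *\<^sub>R d = y + (t * u y) *\<^sub>R d"
      define \<sigma> where "\<sigma> = t * (u x - u y)"
      have y: "y = x + \<sigma> *\<^sub>R d" using eq by (simp add: \<sigma>_def algebra_simps)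
      have x: "x = y + (- \<sigma>) *\<^sub>R d" using y by simp
      have "- \<sigma> = t * (u y - u x)" by (simp add: \<sigma>_def algebra_simps)
      then have "\<sigma> = 0"
        using aux[OF y \<sigma>_def] aux[OF x] by (meson linorder_cases neg_0_less_iff_less)
      then show "x = y" using y by simp
    qed
  next
    have "\<exists>x. y = x + (t * u x) *\<^sub>R d" for y
    proof -
      \<comment> \<open>A preimage of \<open>y\<close> is sought on the line through
        \<open>y\<close> in direction \<open>d\<close>; displacements lie between 0 and
        \<open>B\<close>, so the parameter lies between \<open>- B\<close> and 0.\<close>
      have "\<exists>s. - B \<le> s \<and> s \<le> 0 \<and> (\<lambda>s. s + t * u (y + s *\<^sub>R d)) s = 0"
      proof (rule IVT')
        have "t * u (y + - B *\<^sub>R d) \<le> 1 * B"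
          using bounds t by (intro mult_mono) auto
        then show "- B + t * u (y + - B *\<^sub>R d) \<le> 0" by simp
        show "0 \<le> 0 + t * u (y + 0 *\<^sub>R d)" using bounds t by auto
        show "- B \<le> 0" using bounds order_trans by (metis neg_le_0_iff_le)
        show "continuous_on {- B..0} (\<lambda>s. s + t * u (y + s *\<^sub>R d))"
          by (intro continuous_intros continuous_on_compose2[OF cont]) auto
      qed
      then obtain s where s: "s + t * u (y + s *\<^sub>R d) = 0" by blast
      have "y = (y + s *\<^sub>R d) + (t * u (y + s *\<^sub>R d)) *\<^sub>R d"
        using s by (simp add: add.assoc flip: scaleR_add_left)
      then show ?thesis by blast
    qed
    then show "surj (\<lambda>x. x + (t * u x) *\<^sub>R d)" by (auto simp: surj_def)
  qed
qed auto

text \<open>The stages are conjugates of \<open>F\<close> by dilations. Zooming in at 0 turns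
  tangency to the identity into uniform convergence to the identity on bounded sets. In the
  classical form \<open>F\<close> is the identity outside a ball and the dilations go the other
  way.\<close>

lemma Alexander_trick:
  assumes F: "self_homeomorphism F" and F0: "F 0 = 0"
    and deriv: "\<And>\<epsilon>. \<epsilon> > 0 \<Longrightarrow> \<exists>\<delta>>0. \<forall>x. norm x < \<delta> \<longrightarrow> norm (F x - x) \<le> \<epsilon> * norm x"
  shows "isotopic_id F"
proof (rule isotopic_idI[where H = "\<lambda>t x. if t = 0 then x else (1 / t) *\<^sub>R F (t *\<^sub>R x)"])
  let ?H = "\<lambda>t x. if t = 0 then x else (1 / t) *\<^sub>R F (t *\<^sub>R x)"
  note cF = self_homeomorphismD(1)[OF F]
  show "continuous_on ({0..1} \<times> UNIV) (\<lambda>(t, x). ?H t x)"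
  proof (rule continuous_on_eq_continuous_within[THEN iffD2], safe)
    fix t :: real and x :: "real^3" assume t: "t \<in> {0..1}"
    show "continuous (at (t, x) within {0..1} \<times> UNIV) (\<lambda>(t, x). ?H t x)"
    proof (cases "t = 0")
      case False
      have o: "open ({0<..} \<times> UNIV :: (real \<times> (real^3)) set)" by (intro open_Times) auto
      have "continuous_on ({0<..} \<times> UNIV) (\<lambda>y. (1 / fst y) *\<^sub>R F (fst y *\<^sub>R snd y))"
        by (intro continuous_intros continuous_on_compose2[OF cF]) auto
      then have "continuous_on ({0<..} \<times> UNIV) (\<lambda>(t, x). ?H t x)"
        by (rule continuous_on_eq) auto
      then have "\<forall>y\<in>{0<..} \<times> UNIV. isCont (\<lambda>(t, x). ?H t x) y"
        unfolding continuous_on_eq_continuous_at[OF o] .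
      then have "isCont (\<lambda>(t, x). ?H t x) (t, x)"
        by (rule bspec) (use t False in auto)
      then show ?thesis by (rule continuous_at_imp_continuous_at_within)
    next
      case True
      have *: "\<exists>d>0. \<forall>y\<in>{0..1} \<times> UNIV. dist y (0, x) < d \<longrightarrow> dist (case y of (t, x) \<Rightarrow> ?H t x) x < e"
        if e: "e > 0" for e
      proof -
        \<comment> \<open>\<open>N\<close> bounds the norm of all points within distance 1 of
          \<open>x\<close>. One half of \<open>e\<close> pays for the deviation of the rescaled
          \<open>F\<close> from the identity, the other half for the distance from \<open>y\<close>
          to \<open>x\<close>.\<close>
        define N where "N = norm x + 1"
        have N: "N > 0" by (simp add: N_def add_nonneg_pos)
        obtain \<delta> where \<delta>: "\<delta> > 0" "\<And>x. norm x < \<delta> \<Longrightarrow> norm (F x - x) \<le> e / (2 * N) * norm x"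
          using deriv[of "e / (2 * N)"] e N by auto
        define d where "d = min 1 (min (\<delta> / N) (e / 2))"
        have d: "d > 0" "d \<le> 1" "d \<le> \<delta> / N" "d \<le> e / 2" using \<delta>(1) N e divide_pos_pos[OF \<delta>(1) N] unfolding d_def by linarith+
        have "dist (?H t y) x < e" if t: "0 \<le> t" "t \<le> 1" and D: "dist (t, y) (0, x) < d" for t y
        proof -
          have D1: "norm t < d" "norm (y - x) < d"
            using le_less_trans[OF norm_fst_le[of "t" "y - x"]] le_less_trans[OF norm_snd_le[of "y - x" "t"]] D
            by (simp_all add: dist_norm)
          have yN: "norm y < N"
            using D1(2) d(2) norm_triangle_sub[of y x] by (simp add: N_def)
          show ?thesis
          proof (cases "t = 0")
            case True then show ?thesis using D1 d e by (simp add: dist_norm)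
          next
            case False
            then have t0: "t > 0" using t by simp
            have "norm (t *\<^sub>R y) < \<delta>"
            proof -
              have "norm (t *\<^sub>R y) \<le> t * N" using t yN mult_left_mono[of "norm y" N t] by simp
              also have "\<dots> < d * N" using D1 N t by simp
              also have "\<dots> \<le> \<delta>" using d(3) N by (simp add: field_simps)
              finally show ?thesis .
            qed
            then have "norm (F (t *\<^sub>R y) - t *\<^sub>R y) \<le> e / (2 * N) * norm (t *\<^sub>R y)"
              by (rule \<delta>)
            also have "\<dots> \<le> e / (2 * N) * (t * N)"
              using e N t mult_left_mono[of "norm y" N t] yN by (intro mult_left_mono) auto
            also have "\<dots> = t * (e / 2)" using N by simp
            finally have "norm (F (t *\<^sub>R y) - t *\<^sub>R y) \<le> t * (e / 2)" .
            moreover have "(1 / t) *\<^sub>R F (t *\<^sub>R y) - y = (1 / t) *\<^sub>R (F (t *\<^sub>R y) - t *\<^sub>R y)"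
              using t0 by (simp add: algebra_simps)
            ultimately have "norm ((1 / t) *\<^sub>R F (t *\<^sub>R y) - y) = norm (F (t *\<^sub>R y) - t *\<^sub>R y) / t"
              "norm (F (t *\<^sub>R y) - t *\<^sub>R y) / t \<le> e / 2"
              using t0 by (simp_all only: norm_scaleR) (simp_all add: field_simps)
            then have "norm ((1 / t) *\<^sub>R F (t *\<^sub>R y) - x) < e"
              using D1(2) d(4) norm_triangle_ineq[of "(1 / t) *\<^sub>R F (t *\<^sub>R y) - y" "y - x"]
              unfolding diff_add_cancel add_diff_eq by linarith
            then show ?thesis using False by (simp add: dist_norm)
          qed
        qed
        then have "\<forall>y\<in>{0..1} \<times> UNIV. dist y (0, x) < d \<longrightarrow> dist (case y of (t, x) \<Rightarrow> ?H t x) x < e"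
          unfolding case_prod_unfold by (metis atLeastAtMost_iff mem_Times_iff prod.collapse)
        then show ?thesis using d(1) by blast
      qed
      show ?thesis
        unfolding True continuous_within_eps_delta
        using * by simp
    qed
  qed
next
  fix t :: real assume t: "t \<in> {0..1}"
  show "self_homeomorphism (\<lambda>x. if t = 0 then x else (1 / t) *\<^sub>R F (t *\<^sub>R x))"
  proof (cases "t = 0")
    case True then show ?thesis by (simp add: self_homeomorphism_id)
  next
    case False
    have "self_homeomorphism (\<lambda>x. (1 / t) *\<^sub>R F (t *\<^sub>R x))"
    proof (rule self_homeomorphismI)
      show "continuous_on UNIV (\<lambda>x. (1 / t) *\<^sub>R F (t *\<^sub>R x))"
        by (intro continuous_intros continuous_on_compose2[OF self_homeomorphismD(1)[OF F]]) auto
      show "inj (\<lambda>x. (1 / t) *\<^sub>R F (t *\<^sub>R x))"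
      proof (rule injI)
        fix x y assume "(1 / t) *\<^sub>R F (t *\<^sub>R x) = (1 / t) *\<^sub>R F (t *\<^sub>R y)"
        then have "F (t *\<^sub>R x) = F (t *\<^sub>R y)" using False by simp
        then have "t *\<^sub>R x = t *\<^sub>R y" using self_homeomorphismD(2)[OF F] by (simp add: inj_eq)
        then show "x = y" using False by simp
      qed
      have "y = (1 / t) *\<^sub>R F (t *\<^sub>R ((1 / t) *\<^sub>R inv F (t *\<^sub>R y)))" for y
        using False self_homeomorphism_inv_simps[OF F] by simp
      then show "surj (\<lambda>x. (1 / t) *\<^sub>R F (t *\<^sub>R x))" unfolding surj_def by blast
    qed
    then show ?thesis using False by simp
  qed
qed auto

section \<open>Isotopies from linear maps, translations and scalings\<close>

lemma self_homeomorphism_linear: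
  assumes "linear f" "\<And>x. f x = 0 \<Longrightarrow> x = 0"
  shows "self_homeomorphism f"
proof (rule self_homeomorphismI)
  show "continuous_on UNIV f" using assms linear_continuous_on linear_conv_bounded_linear by blast
  show "inj f" using assms by (simp add: linear_injective_0)
  then show "surj f" using assms(1) linear_injective_imp_surjective by blast
qed

text \<open>Positivity keeps the whole segment from the identity to \<open>f\<close> invertible:
  pairing a kernel equation with \<open>x\<close> forces
  \<open>(1 - t) * (x \<bullet> x) = 0\<close>.\<close>

lemma isotopic_id_linear:
  assumes lin: "linear f" and inj: "\<And>x. f x = 0 \<Longrightarrow> x = 0"
    and pos: "\<And>x. 0 \<le> x \<bullet> f x"
  shows "isotopic_id f"
proof (rule isotopic_idI[where H = "\<lambda>t x. (1 - t) *\<^sub>R x + t *\<^sub>R f x"])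
  have c: "continuous_on UNIV f"
    using lin linear_continuous_on linear_conv_bounded_linear by blast
  show "continuous_on ({0..1} \<times> UNIV) (\<lambda>(t, x). (1 - t) *\<^sub>R x + t *\<^sub>R f x)"
    unfolding case_prod_unfold
    by (intro continuous_intros continuous_on_compose2[OF c]) auto
  fix t :: real assume t: "t \<in> {0..1}"
  show "self_homeomorphism (\<lambda>x. (1 - t) *\<^sub>R x + t *\<^sub>R f x)"
  proof (rule self_homeomorphism_linear)
    show "linear (\<lambda>x. (1 - t) *\<^sub>R x + t *\<^sub>R f x)"
      using lin by (intro linear_compose_add linear_compose_scale_right linear_id) (auto simp: linear_ident)
    fix x assume eq: "(1 - t) *\<^sub>R x + t *\<^sub>R f x = 0"
    have "(1 - t) * (x \<bullet> x) + t * (x \<bullet> f x) = x \<bullet> ((1 - t) *\<^sub>R x + t *\<^sub>R f x)"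
      by (simp add: inner_add_right)
    also have "\<dots> = 0" by (simp add: eq)
    finally have *: "(1 - t) * (x \<bullet> x) + t * (x \<bullet> f x) = 0" .
    have "(1 - t) * (x \<bullet> x) \<ge> 0" "t * (x \<bullet> f x) \<ge> 0" using t pos by auto
    with * have "(1 - t) * (x \<bullet> x) = 0" by linarith
    then consider "x = 0" | "t = 1" by auto
    then show "x = 0" using eq inj by cases auto
  qed
qed auto

lemma isotopic_id_translation: "isotopic_id (\<lambda>x. x + c)"
proof (rule isotopic_idI[where H = "\<lambda>t x. x + t *\<^sub>R c"])
  show "continuous_on ({0..1} \<times> UNIV) (\<lambda>(t, x). x + t *\<^sub>R c)"
    unfolding case_prod_unfold by (intro continuous_intros)
  fix t :: real
  have "surj (\<lambda>x. x + t *\<^sub>R c)"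
    by (rule surjI[of _ "\<lambda>y. y - t *\<^sub>R c"]) simp
  then show "self_homeomorphism (\<lambda>x. x + t *\<^sub>R c)"
    by (intro self_homeomorphismI continuous_intros) (auto simp: inj_def)
qed auto

lemma isotopic_id_scaling:
  assumes "c > 0" shows "isotopic_id (\<lambda>x. c *\<^sub>R x)"
proof (rule isotopic_id_linear)
  show "linear (\<lambda>x :: real^3. c *\<^sub>R x)" by (rule linear_scale_self)
qed (use assms in auto)

section \<open>The swindle\<close>

text \<open>Radii change by \<open>t * g t\<close>. Strict growth gives injectivity; the bound
  \<open>c\<close> makes the new radii unbounded, so the intermediate value theorem gives
  surjectivity.\<close>

lemma self_homeomorphism_radial:
  fixes g :: "real \<Rightarrow> real"
  assumes cont: "continuous_on {0..} g" and c: "c > 0" "\<And>t. t \<ge> 0 \<Longrightarrow> g t \<ge> c"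
    and mono: "\<And>s t. 0 \<le> s \<Longrightarrow> s < t \<Longrightarrow> s * g s < t * g t"
  shows "self_homeomorphism (\<lambda>x. g (norm x) *\<^sub>R x)"
proof (rule self_homeomorphismI)
  have pos: "g (norm x) > 0" for x :: "real^3" using c(2)[of "norm x"] c(1) by simp
  show "continuous_on UNIV (\<lambda>x :: real^3. g (norm x) *\<^sub>R x)"
    by (intro continuous_intros continuous_on_compose2[OF cont]) auto
  show "inj (\<lambda>x :: real^3. g (norm x) *\<^sub>R x)"
  proof (rule injI)
    fix x y :: "real^3" assume eq: "g (norm x) *\<^sub>R x = g (norm y) *\<^sub>R y"
    have "norm x * g (norm x) = norm y * g (norm y)"
      using arg_cong[OF eq, of norm] pos[of x] pos[of y] by (simp add: mult.commute)
    then have "norm x = norm y"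
      using mono[of "norm x" "norm y"] mono[of "norm y" "norm x"] by (metis less_irrefl linorder_neqE norm_ge_zero)
    then show "x = y" using eq pos[of y] by simp
  qed
  have "\<exists>x. y = g (norm x) *\<^sub>R x" for y :: "real^3"
  proof (cases "y = 0")
    case True then show ?thesis by (intro exI[of _ 0]) simp
  next
    case False
    have "norm y \<le> norm y / c * g (norm y / c)"
      using c(2)[of "norm y / c"] c(1) mult_left_mono[of c "g (norm y / c)" "norm y / c"] by simp
    moreover have "continuous_on {0..norm y / c} (\<lambda>t. t * g t)"
      by (intro continuous_intros continuous_on_subset[OF cont]) auto
    ultimately have "\<exists>t. 0 \<le> t \<and> t \<le> norm y / c \<and> t * g t = norm y"
      using IVT'[of "\<lambda>t. t * g t" 0 "norm y" "norm y / c"] c by simp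
    then obtain t where t: "t \<ge> 0" "t * g t = norm y" by blast
    have "norm ((t / norm y) *\<^sub>R y) = t" using t False by simp
    then have "g (norm ((t / norm y) *\<^sub>R y)) *\<^sub>R ((t / norm y) *\<^sub>R y) = y"
      using t False by (simp add: mult.commute)
    then show ?thesis by metis
  qed
  then show "surj (\<lambda>x :: real^3. g (norm x) *\<^sub>R x)" by (auto simp: surj_def)
qed

text \<open>The range is open by invariance of domain, and closed as the union of a compact image
  and the fixed exterior; connectedness of space does the rest.\<close>

lemma self_homeomorphism_id_outside:
  assumes cont: "continuous_on UNIV h" and inj: "inj h"
    and out: "\<And>x. norm x \<ge> R \<Longrightarrow> h x = x"
  shows "self_homeomorphism h"
proof (rule self_homeomorphismI)
  have "open (range h)" using invariance_of_domain[OF cont] inj by simp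
  moreover have "range h = h ` cball 0 R \<union> {x. norm x \<ge> R}"
  proof
    show "range h \<subseteq> h ` cball 0 R \<union> {x. norm x \<ge> R}"
    proof clarify
      fix x assume *: "h x \<notin> h ` cball 0 R"
      then have "\<not> norm x \<le> R" by auto
      then show "R \<le> norm (h x)" using out[of x] by simp
    qed
    show "h ` cball 0 R \<union> {x. norm x \<ge> R} \<subseteq> range h"
      using out by (auto simp: image_iff) metis
  qed
  moreover have "closed (h ` cball 0 R \<union> {x. norm x \<ge> R})"
    by (intro closed_Un compact_imp_closed compact_continuous_image 
          continuous_on_subset[OF cont] closed_Collect_le continuous_intros) auto
  ultimately have "range h = {} \<or> range h = UNIV" using clopen[of "range h"] by simp
  then show "surj h" by auto
qed (use assms in auto)

lemma cball_image_bounded: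
  assumes "self_homeomorphism h"
  obtains R where "R > 0" "\<And>x. norm x \<le> r \<Longrightarrow> norm (h x) < R"
proof -
  have "bounded (h ` cball 0 r)"
    by (intro compact_imp_bounded compact_continuous_image
          continuous_on_subset[OF self_homeomorphismD(1)[OF assms]]) auto
  then obtain B where "\<forall>y\<in>h ` cball 0 r. norm y \<le> B"
    unfolding bounded_iff by blast
  then have B: "\<And>x. norm x \<le> r \<Longrightarrow> norm (h x) \<le> B" by simp
  show ?thesis
  proof (rule that[of "\<bar>B\<bar> + 1"])
    show "norm (h x) < \<bar>B\<bar> + 1" if "norm x \<le> r" for x using B[OF that] by linarith
  qed simp
qed

text \<open>An Eilenberg--Mazur swindle. The infinite product
  \<open>M \<circ> (s \<circ> M \<circ> s\<inverse>) \<circ> (s\<^sup>2 \<circ> M \<circ> s\<^sup>-\<^sup>2) \<circ> \<dots>\<close>, with \<open>s\<close> the contraction by \<open>1 / l\<close>, replaces \<open>\<psi>\<close>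
  by a homeomorphism that is the identity far away. Here \<open>M = T \<circ> b \<circ> a\<close>, where \<open>T\<close> is the
  conjugate by \<open>\<psi>\<close> of the contraction by \<open>1 / l'\<close>, the map \<open>a\<close> is the conjugate by \<open>\<psi>\<close> of a radial
  map that expands by \<open>l'\<close> far away, and \<open>b\<close> is a radial map that expands by \<open>l\<close> near the origin.
  Thus \<open>M\<close> is the identity far away and \<open>T \<circ> s\<inverse>\<close> near the origin.\<close>

lemma swindle_map:
  fixes \<psi> :: "real^3 \<Rightarrow> real^3"
  assumes cone: "\<And>x c. c > 0 \<Longrightarrow> c *\<^sub>R x \<in> L \<longleftrightarrow> x \<in> L"
    and psi: "self_homeomorphism \<psi>" and im: "\<And>x. \<psi> x \<in> P \<longleftrightarrow> x \<in> L"
    and \<beta>: "\<beta> > 0" "\<And>x. norm x \<ge> \<beta> \<Longrightarrow> x \<in> P \<longleftrightarrow> x \<in> L"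
  obtains M T l l' r where "self_homeomorphism M" "self_homeomorphism T" "l > 1" "l' > 1" "r > 0"
    "\<And>x. norm x \<ge> l * \<beta> \<Longrightarrow> M x = x"
    "\<And>x. norm x \<le> \<beta> \<Longrightarrow> M x = T (l *\<^sub>R x)"
    "\<And>x. norm x \<ge> \<beta> \<Longrightarrow> M x \<in> P \<longleftrightarrow> x \<in> L"
    "\<And>x. T x = \<psi> ((1 / l') *\<^sub>R inv \<psi> x)"
    "\<And>x. norm x \<le> l * \<beta> \<Longrightarrow> norm (inv \<psi> x) \<le> l' * r"
    "\<And>x. norm x \<le> r \<Longrightarrow> norm (\<psi> x) < l * \<beta>"
proof -
  note psi_inv = self_homeomorphism_inv[OF psi] and psi_simps [simp] = self_homeomorphism_inv_simps[OF psi]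
  \<comment> \<open>A chain of radii: \<open>r0\<close> covers the ball of radius
    \<open>\<beta>\<close> seen through \<open>inv \<psi>\<close>, \<open>l * \<beta>\<close> covers
    the image under \<open>\<psi>\<close> of the ball of radius \<open>2 * r0\<close>, and
    \<open>l' * (2 * r0)\<close> covers the ball of radius \<open>2 * l * \<beta>\<close> seen
    through \<open>inv \<psi>\<close>. The factors 2 leave room for the two radial maps to change
    their rate.\<close>
  obtain r0 where r0: "r0 > 0" "\<And>x. norm x \<le> \<beta> \<Longrightarrow> norm (inv \<psi> x) < r0"
    using cball_image_bounded[OF psi_inv] by metis
  obtain R1 where R1: "R1 > 0" "\<And>x. norm x \<le> 2 * r0 \<Longrightarrow> norm (\<psi> x) < R1"
    using cball_image_bounded[OF psi] by metis
  define l where "l = 2 + R1 / \<beta>"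
  have "l * \<beta> = 2 * \<beta> + R1" using \<beta> by (simp add: l_def field_simps)
  then have l: "l > 1" "\<And>x. norm x \<le> 2 * r0 \<Longrightarrow> norm (\<psi> x) < l * \<beta>"
    using R1 \<beta>(1) less_trans[OF R1(2), of _ "l * \<beta>"]
    by (auto simp: l_def intro: add_pos_pos less_le_trans[of 1 2])
  obtain R2 where R2: "R2 > 0" "\<And>x. norm x \<le> 2 * l * \<beta> \<Longrightarrow> norm (inv \<psi> x) < R2"
    using cball_image_bounded[OF psi_inv] by metis
  define l' where "l' = 2 + R2 / (2 * r0)"
  have "l' * (2 * r0) = 4 * r0 + R2" using r0 by (simp add: l'_def field_simps)
  then have l': "l' > 1" "\<And>x. norm x \<le> 2 * l * \<beta> \<Longrightarrow> norm (inv \<psi> x) < l' * (2 * r0)"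
    using R2 r0(1) less_trans[OF R2(2), of _ "l' * (2 * r0)"]
    by (auto simp: l'_def intro: add_pos_pos less_le_trans[of 1 2])

  define ga where "ga t = 1 + (l' - 1) * min 1 (max 0 ((t - r0) / r0))" for t
  have ga_mono: "ga s \<le> ga t" if "s \<le> t" for s t
    unfolding ga_def using that r0(1) l'(1)
    by (intro add_left_mono mult_left_mono min.mono max.mono divide_right_mono) auto
  have ga1: "ga t \<ge> 1" for t unfolding ga_def using l'(1) by simp
  have ga_in: "ga t = 1" if "t \<le> r0" for t
    using that r0(1) divide_nonpos_pos[of "t - r0" r0] by (simp add: ga_def max_absorb1)
  have ga_out: "ga t = l'" if "t \<ge> 2 * r0" for t
  proof -
    have "(t - r0) / r0 \<ge> 1" using that r0(1) by (simp add: field_simps)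
    then show ?thesis by (simp add: ga_def)
  qed
  define a0 where "a0 x = ga (norm x) *\<^sub>R x" for x :: "real^3"
  have a0: "self_homeomorphism a0"
    unfolding a0_def
  proof (rule self_homeomorphism_radial)
    show "continuous_on {0..} ga" unfolding ga_def using r0 by (intro continuous_intros) auto
    show "s * ga s < t * ga t" if "0 \<le> s" "s < t" for s t
    proof -
      have "s * ga s < t * ga s" using that ga1[of s] by (intro mult_strict_right_mono) auto
      also have "\<dots> \<le> t * ga t" using that ga_mono[of s t] by (intro mult_left_mono) auto
      finally show ?thesis .
    qed
  qed (use ga1 in auto)

  \<comment> \<open>On radii, \<open>b\<close> is to be multiplication by \<open>l\<close> up to
    \<open>\<beta>\<close>, then the straight line from \<open>(\<beta>, l * \<beta>)\<close> to
    \<open>(2 * l * \<beta>, 2 * l * \<beta>)\<close>, then the identity. \<open>\<kappa>\<close> is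
    the slope of that line, and the maximum with 1 in \<open>gb\<close> switches to the
    identity.\<close>
  define \<kappa> where "\<kappa> = l / (2 * l - 1)"
  have \<kappa>: "0 < \<kappa>" "\<kappa> < 1" using l(1) by (auto simp: \<kappa>_def field_simps)
  define gb where "gb t = max 1 (\<kappa> + (l - \<kappa>) * \<beta> / max t \<beta>)" for t
  have gb_in: "gb t = l" if "t \<le> \<beta>" for t
    using that \<beta>(1) l(1) by (simp add: gb_def)
  have gb_out: "gb t = 1" if "t \<ge> 2 * l * \<beta>" for t
  proof -
    have t: "t \<ge> \<beta>" "t > 0"
      using that \<beta>(1) l(1) mult_right_mono[of 1 "2 * l" \<beta>] by linarith+
    have "(l - \<kappa>) * \<beta> = (1 - \<kappa>) * (2 * l * \<beta>)"
      using l(1) by (simp add: \<kappa>_def field_simps)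
    also have "\<dots> \<le> (1 - \<kappa>) * t" using that \<kappa> by (intro mult_left_mono) auto
    finally have "(l - \<kappa>) * \<beta> / t \<le> 1 - \<kappa>" using t by (simp add: field_simps)
    then show ?thesis using t by (simp add: gb_def)
  qed
  have gb1: "gb t \<ge> 1" for t by (simp add: gb_def)
  define b where "b x = gb (norm x) *\<^sub>R x" for x :: "real^3"
  have b: "self_homeomorphism b"
    unfolding b_def
  proof (rule self_homeomorphism_radial)
    show "continuous_on {0..} gb" unfolding gb_def using \<beta>(1) by (intro continuous_intros) auto
    show "s * gb s < t * gb t" if st: "0 \<le> s" "s < t" for s t
    proof -
      have e: "u * gb u = max u (\<kappa> * u + (l - \<kappa>) * \<beta> * (u / max u \<beta>))" if "u \<ge> 0" for u
        using that by (simp add: gb_def max_mult_distrib_left ring_distribs(1) mult.commute mult.left_commute)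
      have "s / max s \<beta> \<le> t / max t \<beta>"
        using st \<beta>(1) by (auto simp: max_def field_simps)
      then have "(l - \<kappa>) * \<beta> * (s / max s \<beta>) \<le> (l - \<kappa>) * \<beta> * (t / max t \<beta>)"
        using l(1) \<kappa> \<beta>(1) by (intro mult_left_mono) auto
      moreover have "\<kappa> * s < \<kappa> * t" using st \<kappa> by simp
      ultimately have "\<kappa> * s + (l - \<kappa>) * \<beta> * (s / max s \<beta>) < \<kappa> * t + (l - \<kappa>) * \<beta> * (t / max t \<beta>)"
        by linarith
      then show ?thesis unfolding e[OF st(1)] e[OF less_imp_le[OF le_less_trans[OF st]]]
        using st by linarith
    qed
  qed (use gb1 in auto)

  define a where "a = \<psi> \<circ> a0 \<circ> inv \<psi>"
  have a: "self_homeomorphism a"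
    unfolding a_def using psi psi_inv a0 self_homeomorphism_comp by blast
  define T where "T = \<psi> \<circ> (\<lambda>x. (1 / l') *\<^sub>R x) \<circ> inv \<psi>"
  have "self_homeomorphism (\<lambda>x. (1 / l') *\<^sub>R x)"
    using l'(1) isotopic_id_scaling[of "1 / l'"] isotopic_id_self_homeomorphism by simp
  then have T: "self_homeomorphism T"
    unfolding T_def using psi psi_inv self_homeomorphism_comp by blast
  define M where "M = T \<circ> b \<circ> a"
  have M: "self_homeomorphism M" unfolding M_def using T b a self_homeomorphism_comp by blast

  have im': "x \<in> P \<longleftrightarrow> inv \<psi> x \<in> L" for x using im[of "inv \<psi> x"] by simp
  have TP: "T x \<in> P \<longleftrightarrow> x \<in> P" for x
    using cone[of "1 / l'"] l'(1) by (simp add: im' T_def)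
  have aP: "a x \<in> P \<longleftrightarrow> x \<in> P" for x
  proof -
    have "ga (norm (inv \<psi> x)) > 0" using ga1[of "norm (inv \<psi> x)"] by linarith
    then show ?thesis using cone by (simp add: im' a_def a0_def)
  qed
  have bL: "b x \<in> L \<longleftrightarrow> x \<in> L" for x
  proof -
    have "gb (norm x) > 0" using gb1[of "norm x"] by linarith
    then show ?thesis using cone by (simp add: b_def)
  qed
  have norm_b: "norm (b x) \<ge> norm x" for x
    using gb1[of "norm x"] mult_right_mono[of 1 "gb (norm x)" "norm x"] by (simp add: b_def)
  have a_in: "a x = x" if "norm x \<le> \<beta>" for x
    using r0(2)[OF that] by (simp add: a_def a0_def ga_in)

  show ?thesis
  proof (rule that[of M T l l' "2 * r0"])
    \<comment> \<open>Here \<open>a\<close> expands by \<open>l'\<close> in the coordinates of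
      \<open>\<psi>\<close>, far enough out for \<open>b\<close> to do nothing, and \<open>T\<close>
      undoes the expansion.\<close>
    show "M x = x" if "norm x \<ge> l * \<beta>" for x
    proof -
      have "norm (inv \<psi> x) > 2 * r0"
        using l(2)[of "inv \<psi> x"] that by fastforce
      then have ax: "a x = \<psi> (l' *\<^sub>R inv \<psi> x)"
        by (simp add: a_def a0_def ga_out)
      have "norm (a x) \<ge> 2 * l * \<beta>"
      proof (rule ccontr)
        assume "\<not> ?thesis"
        then have "norm (l' *\<^sub>R inv \<psi> x) < l' * (2 * r0)"
          using l'(2)[of "a x"] ax by simp
        then show False using \<open>norm (inv \<psi> x) > 2 * r0\<close> l'(1) by simp
      qed
      then have "b (a x) = a x" by (simp add: b_def gb_out)
      then show ?thesis using ax l'(1) by (simp add: M_def T_def)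
    qed
    show "M x = T (l *\<^sub>R x)" if "norm x \<le> \<beta>" for x
      using that by (simp add: M_def a_in b_def gb_in)
    show "M x \<in> P \<longleftrightarrow> x \<in> L" if "norm x \<ge> \<beta>" for x
    proof -
      \<comment> \<open>\<open>a\<close> fixes the ball of radius \<open>\<beta>\<close> pointwise,
        so by injectivity no point from outside enters it. Hence \<open>P\<close> and
        \<open>L\<close> may be exchanged for each other both before and after \<open>a\<close>;
        \<open>b\<close> does not decrease norms, so also after \<open>b\<close>.\<close>
      have n: "norm (a x) \<ge> \<beta>"
      proof (rule ccontr)
        assume *: "\<not> ?thesis"
        then have "a (a x) = a x" using a_in by simp
        then have "a x = x" using self_homeomorphismD(2)[OF a] by (auto dest: injD)
        then show False using * that by simp
      qed
      have "M x \<in> P \<longleftrightarrow> b (a x) \<in> P" by (simp add: M_def TP)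
      also have "\<dots> \<longleftrightarrow> b (a x) \<in> L" using \<beta>(2) n norm_b order_trans by blast
      also have "\<dots> \<longleftrightarrow> a x \<in> L" by (rule bL)
      also have "\<dots> \<longleftrightarrow> a x \<in> P" using \<beta>(2) n by blast
      also have "\<dots> \<longleftrightarrow> x \<in> L" using aP \<beta>(2) that by blast
      finally show ?thesis .
    qed
    show "norm (inv \<psi> x) \<le> l' * (2 * r0)" if "norm x \<le> l * \<beta>" for x
      using l'(2)[of x] that l(1) \<beta>(1) mult_right_mono[of l "2 * l" \<beta>] by linarith
  qed (use M T l l' r0 in \<open>auto simp: T_def\<close>)
qed

text \<open>At a point with \<open>norm (l ^ k *\<^sub>R x)\<close> between \<open>\<beta>\<close>
  and \<open>l * \<beta>\<close>, all but \<open>k + 1\<close> factors of the infinite product are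
  trivial, and it collapses to \<open>T ^^ k\<close> applied to
  \<open>M (l ^ k *\<^sub>R x)\<close>. The resulting self-similarity
  \<open>\<Theta> x = T (\<Theta> (l *\<^sub>R x))\<close> carries injectivity and the relation
  between \<open>P\<close> and \<open>L\<close> inwards from the region outside the ball.\<close>

theorem swindle:
  fixes \<psi> :: "real^3 \<Rightarrow> real^3"
  assumes cone: "\<And>x c. c > 0 \<Longrightarrow> c *\<^sub>R x \<in> L \<longleftrightarrow> x \<in> L"
    and L0: "0 \<in> L"
    and psi: "self_homeomorphism \<psi>" and im: "\<And>x. \<psi> x \<in> P \<longleftrightarrow> x \<in> L"
    and \<beta>: "\<beta> > 0" "\<And>x. norm x \<ge> \<beta> \<Longrightarrow> x \<in> P \<longleftrightarrow> x \<in> L"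
  obtains \<Theta> R where "self_homeomorphism \<Theta>" "\<And>x. norm x \<ge> R \<Longrightarrow> \<Theta> x = x" "\<And>x. \<Theta> x \<in> P \<longleftrightarrow> x \<in> L"
proof -
  obtain M T l l' r where M: "self_homeomorphism M" and T: "self_homeomorphism T"
    and l: "l > 1" and l': "l' > 1" and r: "r > 0"
    and M_out: "\<And>x. norm x \<ge> l * \<beta> \<Longrightarrow> M x = x"
    and M_in: "\<And>x. norm x \<le> \<beta> \<Longrightarrow> M x = T (l *\<^sub>R x)"
    and MP: "\<And>x. norm x \<ge> \<beta> \<Longrightarrow> M x \<in> P \<longleftrightarrow> x \<in> L"
    and T_def: "\<And>x. T x = \<psi> ((1 / l') *\<^sub>R inv \<psi> x)"
    and psi_inv_in: "\<And>x. norm x \<le> l * \<beta> \<Longrightarrow> norm (inv \<psi> x) \<le> l' * r"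
    and psi_in: "\<And>x. norm x \<le> r \<Longrightarrow> norm (\<psi> x) < l * \<beta>"
    using swindle_map[OF cone psi im \<beta>] by blast
  note psi_simps [simp] = self_homeomorphism_inv_simps[OF psi]
  note cM = self_homeomorphismD(1)[OF M] and cT = self_homeomorphismD(1)[OF T]
  have l\<beta>: "l * \<beta> > \<beta>" using l \<beta>(1) by simp
  have M_inj: "M x = M y \<longleftrightarrow> x = y" and T_inj: "T x = T y \<longleftrightarrow> x = y" for x y
    using self_homeomorphismD(2)[OF M] self_homeomorphismD(2)[OF T] by (auto simp: inj_eq)
  have TP: "T x \<in> P \<longleftrightarrow> x \<in> P" for x
    using cone[of "1 / l'" "inv \<psi> x"] l' im[of "inv \<psi> x"] by (simp add: T_def im)

  \<comment> \<open>\<open>\<psi> 0\<close> is the fixed point of \<open>T\<close>, to which its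
    iterates contract; \<open>k\<close> counts the dilations that bring \<open>x\<close> out of the
    ball of radius \<open>\<beta>\<close>.\<close>
  define \<Theta> where "\<Theta> x = (if x = 0 then \<psi> 0
      else let k = LEAST k. norm (l ^ k *\<^sub>R x) \<ge> \<beta> in (T ^^ k) (M (l ^ k *\<^sub>R x)))" for x
  have \<Theta>_out: "\<Theta> x = M x" if "norm x \<ge> \<beta>" for x
  proof -
    have "(LEAST k. norm (l ^ k *\<^sub>R x) \<ge> \<beta>) = 0"
      using that by (intro Least_equality) auto
    moreover have "x \<noteq> 0" using that \<beta>(1) by auto
    ultimately show ?thesis by (simp add: \<Theta>_def)
  qed
  have large: "\<exists>k. norm (l ^ k *\<^sub>R x) \<ge> \<beta>" if "x \<noteq> 0" for x :: "real^3"
  proof -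
    obtain k where "\<beta> / norm x < l ^ k" using real_arch_pow[OF l] by blast
    then show ?thesis using that l by (intro exI[of _ k]) (simp add: field_simps)
  qed
  have \<Theta>_in': "\<Theta> x = T (\<Theta> (l *\<^sub>R x))" if "norm x < \<beta>" for x
  proof (cases "x = 0")
    case True
    then show ?thesis by (simp add: \<Theta>_def T_def)
  next
    case False
    obtain n where n: "norm (l ^ n *\<^sub>R x) \<ge> \<beta>" using large[OF False] by blast
    have "(LEAST k. norm (l ^ k *\<^sub>R x) \<ge> \<beta>) = Suc (LEAST k. norm (l ^ Suc k *\<^sub>R x) \<ge> \<beta>)"
      using that n by (intro Least_Suc) auto
    moreover have "l ^ Suc k *\<^sub>R x = l ^ k *\<^sub>R (l *\<^sub>R x)" for k by (simp add: mult.commute)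
    ultimately show ?thesis using False l by (simp add: \<Theta>_def Let_def del: power_Suc)
  qed
  have \<Theta>_id: "\<Theta> x = x" if "norm x \<ge> l * \<beta>" for x
    using that M_out l\<beta> \<Theta>_out by simp
  \<comment> \<open>On the sphere of radius \<open>\<beta>\<close> both descriptions of
    \<open>M\<close> apply, and the dilated point is already fixed by \<open>\<Theta>\<close>; so
    the equation extends from the open to the closed ball, as the gluing of continuous pieces
    requires.\<close>
  have \<Theta>_in: "\<Theta> x = T (\<Theta> (l *\<^sub>R x))" if "norm x \<le> \<beta>" for x
  proof (cases "norm x < \<beta>")
    case False
    then have "norm x = \<beta>" using that by simp
    then have "\<Theta> x = T (l *\<^sub>R x)" "\<Theta> (l *\<^sub>R x) = l *\<^sub>R x"
      using \<Theta>_out[of x] M_in[of x] l by (auto intro: \<Theta>_id)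
    then show ?thesis by simp
  qed (use \<Theta>_in' in blast)

  \<comment> \<open>Every nonzero point leaves the ball of radius \<open>\<beta>\<close> after
    finitely many dilations by \<open>l\<close>.\<close>
  have shell_induct: "Q x" if "x \<noteq> 0" and out: "\<And>x. norm x \<ge> \<beta> \<Longrightarrow> Q x"
    and step: "\<And>x :: real^3. norm x < \<beta> \<Longrightarrow> x \<noteq> 0 \<Longrightarrow> Q (l *\<^sub>R x) \<Longrightarrow> Q x" for Q and x :: "real^3"
  proof -
    have "\<forall>x :: real^3. norm (l ^ k *\<^sub>R x) \<ge> \<beta> \<longrightarrow> Q x" for k
    proof (induction k)
      case (Suc k)
      show ?case
      proof (intro allI impI)
        fix x :: "real^3" assume *: "norm (l ^ Suc k *\<^sub>R x) \<ge> \<beta>"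
        have "l ^ Suc k *\<^sub>R x = l ^ k *\<^sub>R (l *\<^sub>R x)" by (simp add: mult.commute)
        then have "Q (l *\<^sub>R x)" using Suc * by metis
        moreover have "x \<noteq> 0" using * \<beta>(1) by auto
        ultimately show "Q x" using out step by (meson not_le)
      qed
    qed (use out in simp)
    then show ?thesis using large that(1) by blast
  qed

  have T_ball: "norm (T x) < l * \<beta>" if "norm x \<le> l * \<beta>" for x
    unfolding T_def using psi_inv_in[OF that] l' by (intro psi_in) (simp add: field_simps)
  have M_ball: "norm (M x) < l * \<beta>" if "norm x < l * \<beta>" for x
    using M_out[of "M x"] M_inj[of "M x" x] that by force
  have \<Theta>_ball: "norm (\<Theta> x) < l * \<beta>" if "norm x < l * \<beta>" for x
  proof (cases "x = 0")
    case True
    then show ?thesis using psi_in[of 0] r by (simp add: \<Theta>_def)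
  next
    case False
    have "norm x < l * \<beta> \<longrightarrow> norm (\<Theta> x) < l * \<beta>"
      using False
    proof (rule shell_induct)
      fix x :: "real^3" assume x: "norm x < \<beta>" "norm (l *\<^sub>R x) < l * \<beta> \<longrightarrow> norm (\<Theta> (l *\<^sub>R x)) < l * \<beta>"
      then have "norm (\<Theta> (l *\<^sub>R x)) < l * \<beta>" using l by simp
      then show "norm x < l * \<beta> \<longrightarrow> norm (\<Theta> x) < l * \<beta>" using T_ball \<Theta>_in x(1) by simp
    qed (use \<Theta>_out M_ball in simp)
    then show ?thesis using that by simp
  qed

  have cont_shell: "continuous_on {x. norm x \<ge> \<beta> / l ^ k} \<Theta>" for k
  proof (induction k)
    case 0
    have "continuous_on {x. norm x \<ge> \<beta> / l ^ 0} M" using continuous_on_subset[OF cM] by blast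
    then show ?case by (rule continuous_on_eq) (simp add: \<Theta>_out)
  next
    case (Suc k)
    let ?A = "{x :: real^3. norm x \<ge> \<beta>}" and ?B = "{x :: real^3. \<beta> / l ^ Suc k \<le> norm x \<and> norm x \<le> \<beta>}"
    have "continuous_on ?A M" using continuous_on_subset[OF cM] by blast
    then have "continuous_on ?A \<Theta>" by (rule continuous_on_eq) (simp add: \<Theta>_out)
    moreover have "continuous_on ?B \<Theta>"
    proof -
      have "continuous_on ?B (\<lambda>x. T (\<Theta> (l *\<^sub>R x)))"
        using l by (intro continuous_on_compose2[OF cT] continuous_on_compose2[OF Suc] continuous_intros)
           (auto simp: field_simps)
      then show ?thesis by (rule continuous_on_eq) (simp add: \<Theta>_in)
    qed
    moreover have "closed ?A" "closed ?B"
      by (intro closed_Collect_le closed_Collect_conj continuous_intros)+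
    ultimately have "continuous_on (?A \<union> ?B) \<Theta>" by (intro continuous_on_closed_Un)
    moreover have "{x. \<beta> / l ^ Suc k \<le> norm x} \<subseteq> ?A \<union> ?B" by auto
    ultimately show ?case by (rule continuous_on_subset)
  qed
  \<comment> \<open>This gives continuity at 0: in the coordinates of \<open>\<psi>\<close>, each
    further shell inwards shrinks the value by the factor \<open>1 / l'\<close>.\<close>
  have \<Theta>_small: "\<exists>y. norm y \<le> r / l' ^ k \<and> \<Theta> x = \<psi> y" if "norm x < \<beta> / l ^ k" for k x
    using that
  proof (induction k arbitrary: x)
    case 0
    have "norm (l *\<^sub>R x) < l * \<beta>" using 0 l by simp
    then have "norm (inv \<psi> (\<Theta> (l *\<^sub>R x))) \<le> l' * r"
      using \<Theta>_ball psi_inv_in by (meson less_imp_le)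
    then show ?case using \<Theta>_in[of x] 0 l'
      by (intro exI[of _ "(1 / l') *\<^sub>R inv \<psi> (\<Theta> (l *\<^sub>R x))"]) (auto simp: T_def field_simps)
  next
    case (Suc k)
    have "norm x < \<beta> / l ^ Suc k" by fact
    also have "\<dots> \<le> \<beta> / 1"
      using l \<beta>(1) one_le_power[of l "Suc k"] by (intro divide_left_mono) auto
    finally have x: "norm x \<le> \<beta>" by simp
    have "norm (l *\<^sub>R x) < \<beta> / l ^ k" using Suc.prems l by (simp add: field_simps)
    then obtain y where "norm y \<le> r / l' ^ k" "\<Theta> (l *\<^sub>R x) = \<psi> y" using Suc.IH by blast
    then show ?case using \<Theta>_in[OF x] l'
      by (intro exI[of _ "(1 / l') *\<^sub>R y"]) (auto simp: T_def field_simps)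
  qed
  have cont: "continuous_on UNIV \<Theta>"
    unfolding continuous_on_eq_continuous_at[OF open_UNIV]
  proof
    fix x :: "real^3"
    show "isCont \<Theta> x"
    proof (cases "x = 0")
      case False
      obtain k where "\<beta> / norm x < l ^ k" using real_arch_pow[OF l] by blast
      then have k: "\<beta> / l ^ k < norm x" using False l by (simp add: field_simps)
      have "continuous_on {x. norm x > \<beta> / l ^ k} \<Theta>"
        by (rule continuous_on_subset[OF cont_shell[of k]]) auto
      moreover have "open {x :: real^3. norm x > \<beta> / l ^ k}"
        by (intro open_Collect_less continuous_intros)
      ultimately show ?thesis using k continuous_on_eq_continuous_at by blast
    next
      case True
      show ?thesis
        unfolding continuous_at_eps_delta True
      proof (intro allI impI)
        fix e :: real assume "e > 0"
        then obtain d where d: "d > 0" "\<And>y. norm y < d \<Longrightarrow> dist (\<psi> y) (\<psi> 0) < e"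
          using self_homeomorphismD(1)[OF psi] unfolding continuous_on_iff by (metis UNIV_I dist_0_norm dist_commute)
        obtain k where "r / d < l' ^ k" using real_arch_pow[OF l'] by blast
        then have k: "r / l' ^ k < d" using d l' by (simp add: field_simps)
        show "\<exists>d>0. \<forall>x'. dist x' 0 < d \<longrightarrow> dist (\<Theta> x') (\<Theta> 0) < e"
        proof (intro exI[of _ "\<beta> / l ^ k"] conjI allI impI)
          show "\<beta> / l ^ k > 0" using \<beta>(1) l by simp
          fix x' :: "real^3" assume "dist x' 0 < \<beta> / l ^ k"
          then obtain y where "norm y \<le> r / l' ^ k" "\<Theta> x' = \<psi> y" using \<Theta>_small by force
          then show "dist (\<Theta> x') (\<Theta> 0) < e" using d(2) k by (simp add: \<Theta>_def)
        qed
      qed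
    qed
  qed

  \<comment> \<open>Inside the ball, \<open>\<Theta> y\<close> is also the value of \<open>M\<close>
    at a point of norm below \<open>\<beta>\<close>, so injectivity of \<open>M\<close> separates it
    from the values outside.\<close>
  have sep: "\<Theta> x \<noteq> \<Theta> y" if "norm x \<ge> \<beta>" "norm y < \<beta>" for x y
  proof
    assume eq: "\<Theta> x = \<Theta> y"
    define z where "z = inv M (\<Theta> y)"
    have z: "M z = \<Theta> y" using self_homeomorphism_inv_simps[OF M] by (simp add: z_def)
    have n: "norm (\<Theta> (l *\<^sub>R y)) < l * \<beta>" using that l by (intro \<Theta>_ball) simp
    have "norm ((1 / l) *\<^sub>R \<Theta> (l *\<^sub>R y)) < \<beta>" using n l by (simp add: field_simps)
    moreover from this have "M ((1 / l) *\<^sub>R \<Theta> (l *\<^sub>R y)) = \<Theta> y"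
      using M_in l \<Theta>_in[of y] that by simp
    ultimately show False using eq \<Theta>_out[OF that(1)] M_inj that(1) by (metis not_le)
  qed
  have inj0: "\<forall>y. \<Theta> x = \<Theta> y \<longrightarrow> x = y" if "x \<noteq> 0" for x
    using that
  proof (rule shell_induct)
    fix x :: "real^3" assume "norm x \<ge> \<beta>"
    then show "\<forall>y. \<Theta> x = \<Theta> y \<longrightarrow> x = y" using sep M_inj \<Theta>_out by (metis not_le)
  next
    fix x :: "real^3" assume x: "norm x < \<beta>" and IH: "\<forall>y. \<Theta> (l *\<^sub>R x) = \<Theta> y \<longrightarrow> l *\<^sub>R x = y"
    show "\<forall>y. \<Theta> x = \<Theta> y \<longrightarrow> x = y"
    proof (intro allI impI)
      fix y assume eq: "\<Theta> x = \<Theta> y"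
      then have y: "norm y < \<beta>" using sep[of y x] x by fastforce
      then have "\<Theta> (l *\<^sub>R x) = \<Theta> (l *\<^sub>R y)"
        using eq \<Theta>_in[of x] \<Theta>_in[of y] x T_inj by simp
      then have "l *\<^sub>R x = l *\<^sub>R y" using IH by blast
      then show "x = y" using l by simp
    qed
  qed
  have "inj \<Theta>" using inj0 by (metis injI)
  then have hom: "self_homeomorphism \<Theta>"
    using self_homeomorphism_id_outside[OF cont _ \<Theta>_id] by blast
  have "\<Theta> x \<in> P \<longleftrightarrow> x \<in> L" for x
  proof (cases "x = 0")
    case True
    then show ?thesis using L0 im by (simp add: \<Theta>_def)
  next
    case False
    then show ?thesis
    proof (rule shell_induct)
      fix x :: "real^3" assume "norm x < \<beta>" and IH: "\<Theta> (l *\<^sub>R x) \<in> P \<longleftrightarrow> l *\<^sub>R x \<in> L"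
      then show "\<Theta> x \<in> P \<longleftrightarrow> x \<in> L" using \<Theta>_in TP cone l by simp
    qed (use \<Theta>_out MP in simp)
  qed
  then show ?thesis using that hom \<Theta>_id by blast
qed

section \<open>Round circles\<close>

definition std_circle :: "(real^3) set" where
  "std_circle = {x. norm x = 1 \<and> x $ 3 = 0}"

lemma trivial_knot_iff: "trivial_knot K \<longleftrightarrow> ambient_isotopic K std_circle"
  by (simp add: trivial_knot_def std_circle_def)

lemma trivial_knot_ambient_isotopic:
  "ambient_isotopic K L \<Longrightarrow> trivial_knot L \<Longrightarrow> trivial_knot K"
  unfolding trivial_knot_def by (rule ambient_isotopic_trans)

section \<open>Inversion in the unit sphere\<close>

definition inversion :: "real^3 \<Rightarrow> real^3" where
  "inversion x = (1 / (norm x)\<^sup>2) *\<^sub>R x"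

lemma inversion_0 [simp]: "inversion 0 = 0"
  by (simp add: inversion_def)

lemma norm_inversion: "norm (inversion x) = 1 / norm x"
  by (cases "x = 0") (auto simp: inversion_def power2_eq_square)

lemma inversion_inversion [simp]: "inversion (inversion x) = x"
proof (cases "x = 0")
  case False
  then show ?thesis
    unfolding inversion_def[of "inversion x"] norm_inversion
    by (simp add: inversion_def power_divide)
qed simp

lemma inversion_eq_0_iff [simp]: "inversion x = 0 \<longleftrightarrow> x = 0"
  using inversion_inversion[of x] by (metis inversion_0)

text \<open>A bounded displacement far out is divided by two large norms and becomes quadratically
  small near 0; this supplies the tangency that \<open>Alexander_trick\<close> asks for.\<close>

lemma norm_inversion_diff:
  assumes "u \<noteq> 0" "v \<noteq> 0"
  shows "norm (inversion u - inversion v) = norm (u - v) / (norm u * norm v)"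
proof -
  have "(norm (inversion u - inversion v))\<^sup>2
      = (norm (inversion u))\<^sup>2 - 2 * (inversion u \<bullet> inversion v) + (norm (inversion v))\<^sup>2"
    by (simp add: power2_norm_eq_inner inner_diff inner_commute)
  also have "\<dots> = ((norm v)\<^sup>2 - 2 * (u \<bullet> v) + (norm u)\<^sup>2) / (norm u * norm v)\<^sup>2"
    using assms unfolding norm_inversion
    by (simp add: inversion_def field_simps power2_eq_square)
  also have "\<dots> = (norm (u - v) / (norm u * norm v))\<^sup>2"
    by (simp add: power_divide power2_norm_eq_inner inner_diff inner_commute)
  finally show ?thesis
    by (rule power2_eq_imp_eq) auto
qed

lemma continuous_inversion: "x \<noteq> 0 \<Longrightarrow> isCont inversion x"
  unfolding inversion_def by (intro continuous_intros) auto

text \<open>Inversion exchanges neighbourhoods of 0 and of infinity and fixes 0 by convention.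
  Continuity of the conjugate at 0 is therefore properness of \<open>h\<close>: its inverse maps
  bounded sets to bounded sets.\<close>

lemma self_homeomorphism_inversion:
  assumes h: "self_homeomorphism h" and h0: "h 0 = 0"
  shows "self_homeomorphism (inversion \<circ> h \<circ> inversion)"
proof (rule self_homeomorphismI)
  have hinj: "h x = h y \<longleftrightarrow> x = y" for x y
    using self_homeomorphismD(2)[OF h] by (auto simp: inj_eq)
  show "inj (inversion \<circ> h \<circ> inversion)"
    by (rule injI) (metis comp_apply hinj inversion_inversion)
  show "surj (inversion \<circ> h \<circ> inversion)"
    by (rule surjI[of _ "inversion \<circ> inv h \<circ> inversion"])
       (simp add: self_homeomorphism_inv_simps[OF h])
  show "continuous_on UNIV (inversion \<circ> h \<circ> inversion)"
    unfolding continuous_on_eq_continuous_at[OF open_UNIV]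
  proof
    fix x :: "real^3"
    show "isCont (inversion \<circ> h \<circ> inversion) x"
    proof (cases "x = 0")
      case False
      have "isCont h y" for y
        using self_homeomorphismD(1)[OF h] by (simp add: continuous_on_eq_continuous_at)
      moreover have "h (inversion x) \<noteq> 0" using False hinj[of "inversion x" 0] h0 by simp
      ultimately show ?thesis
        using False by (intro continuous_at_compose continuous_inversion) auto
    next
      case True
      show ?thesis
        unfolding True continuous_at_eps_delta
      proof (intro allI impI)
        fix e :: real assume e: "e > 0"
        obtain R where R: "R > 0" "\<And>y. norm y \<le> 1 / e \<Longrightarrow> norm (inv h y) < R"
          using cball_image_bounded[OF self_homeomorphism_inv[OF h]] by metis
        have "norm (inversion (h (inversion x))) < e" if x: "norm x < 1 / R" for x
        proof (cases "x = 0")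
          case False
          have n: "norm (inversion x) > R"
            using x False R(1) by (simp add: norm_inversion field_simps)
          have "norm (h (inversion x)) > 1 / e"
            using R(2)[of "h (inversion x)"] n by (force simp: self_homeomorphism_inv_simps[OF h])
          then show ?thesis unfolding norm_inversion[of "h (inversion x)"] using e
            by (smt (verit) divide_pos_pos frac_less2 div_by_1 divide_divide_eq_right mult.commute mult_1 divide_less_eq less_divide_eq)
        qed (use e h0 in simp)
        then show "\<exists>d>0. \<forall>x'. dist x' 0 < d \<longrightarrow>
            dist ((inversion \<circ> h \<circ> inversion) x') ((inversion \<circ> h \<circ> inversion) 0) < e"
          using R(1) h0 by (intro exI[of _ "1 / R"]) auto
      qed
    qed
  qed
qed

section \<open>Rotations and round circles\<close>

lemma orthonormal_expansion:
  fixes e f v :: "real^3"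
  assumes "norm e = 1" "norm f = 1" "e \<bullet> f = 0"
  defines "n \<equiv> cross3 e f"
  shows "norm n = 1" "n \<bullet> e = 0" "n \<bullet> f = 0"
    and "v = (v \<bullet> e) *\<^sub>R e + (v \<bullet> f) *\<^sub>R f + (v \<bullet> n) *\<^sub>R n"
proof -
  have ee: "e \<bullet> e = 1" "f \<bullet> f = 1" using assms by (simp_all add: dot_square_norm)
  have "(norm n)\<^sup>2 = 1"
    using norm_cross[of e f] assms by simp
  then show n1: "norm n = 1" by (simp add: power2_eq_1_iff) (smt (verit) norm_ge_zero)
  show ne: "n \<bullet> e = 0" "n \<bullet> f = 0" by (simp_all add: n_def dot_cross_self)
  define t where "t = v - (v \<bullet> e) *\<^sub>R e - (v \<bullet> f) *\<^sub>R f - (v \<bullet> n) *\<^sub>R n"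
  have nn: "n \<bullet> n = 1" using n1 by (simp add: dot_square_norm)
  have te: "t \<bullet> e = 0" "t \<bullet> f = 0" "t \<bullet> n = 0"
    using ee ne nn assms(3) inner_commute[of e f] inner_commute[of e n] inner_commute[of f n]
    by (simp_all add: t_def inner_diff_left)
  \<comment> \<open>Lagrange's formula for a double cross product makes the remainder
    \<open>t\<close> parallel to \<open>n\<close>; it is also orthogonal to \<open>n\<close>, so it
    vanishes.\<close>
  have "cross3 t n = 0" unfolding n_def Lagrange using te by simp
  then have "(norm t)\<^sup>2 = 0"
    using norm_cross[of t n] n1 te by simp
  then show "v = (v \<bullet> e) *\<^sub>R e + (v \<bullet> f) *\<^sub>R f + (v \<bullet> n) *\<^sub>R n"
    by (simp add: t_def algebra_simps)
qed

text \<open>The linear map \<open>R\<close> below is the rotation that moves \<open>n\<close> to \<open>\<epsilon>\<close> through an angle of at most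
  a right angle.\<close>

lemma rotate_circle:
  fixes n \<epsilon> :: "real^3"
  assumes n: "norm n = 1" and eps: "norm \<epsilon> = 1" and c: "n \<bullet> \<epsilon> \<ge> 0"
  shows "ambient_isotopic {x. norm x = 1 \<and> x \<bullet> n = 0} {x. norm x = 1 \<and> x \<bullet> \<epsilon> = 0}"
proof -
  define \<gamma> where "\<gamma> = n \<bullet> \<epsilon>"
  \<comment> \<open>This is the reflection in the plane orthogonal to \<open>n\<close> followed by
    the one in the plane orthogonal to \<open>n + \<epsilon>\<close>, whose squared norm is
    \<open>2 * (1 + \<gamma>)\<close>.\<close>
  define R where "R x = x - ((x \<bullet> n + x \<bullet> \<epsilon>) / (1 + \<gamma>)) *\<^sub>R (n + \<epsilon>) + (2 * (x \<bullet> n)) *\<^sub>R \<epsilon>" for x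
  have nn: "n \<bullet> n = 1" "\<epsilon> \<bullet> \<epsilon> = 1" using n eps by (simp_all add: dot_square_norm)
  have g: "n \<bullet> \<epsilon> = \<gamma>" "\<epsilon> \<bullet> n = \<gamma>" by (simp_all add: \<gamma>_def inner_commute)
  have \<gamma>: "0 \<le> \<gamma>" "\<gamma> \<le> 1"
    using c norm_cauchy_schwarz[of n \<epsilon>] n eps by (auto simp: \<gamma>_def)
  have lin: "linear R"
    by (rule linearI) (simp_all add: R_def inner_add_left add_divide_distrib algebra_simps)
  have Re: "R x \<bullet> \<epsilon> = x \<bullet> n" for x
  proof -
    define k where "k = (x \<bullet> n + x \<bullet> \<epsilon>) / (1 + \<gamma>)"
    have "k * (1 + \<gamma>) = x \<bullet> n + x \<bullet> \<epsilon>" using \<gamma> by (simp add: k_def)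
    then show ?thesis
      unfolding R_def k_def[symmetric] by (simp add: inner_add_left inner_diff_left nn g) (simp add: algebra_simps)
  qed
  have Rn: "R x \<bullet> R x = x \<bullet> x" for x
  proof -
    define p s where "p = x \<bullet> n" and "s = x \<bullet> \<epsilon>"
    define k where "k = (p + s) / (1 + \<gamma>)"
    have k: "k * (1 + \<gamma>) = p + s" using \<gamma> by (simp add: k_def)
    have "R x \<bullet> R x = x \<bullet> x + k * k * (2 + 2 * \<gamma>) + 4 * p * p
        - 2 * k * (p + s) + 4 * p * s - 4 * p * k * (1 + \<gamma>)"
      unfolding R_def p_def[symmetric] s_def[symmetric] k_def[symmetric]
      by (simp add: inner_add_left inner_diff_left inner_add_right inner_diff_right nn g
            inner_commute[of n x] inner_commute[of \<epsilon> x] p_def[symmetric] s_def[symmetric])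
         (simp add: algebra_simps)
    also have "k * k * (2 + 2 * \<gamma>) = 2 * k * (p + s)" using k by (simp add: algebra_simps flip: k)
    also have "4 * p * k * (1 + \<gamma>) = 4 * p * (p + s)" using k by (simp add: algebra_simps flip: k)
    finally show ?thesis by (simp add: algebra_simps)
  qed
  then have norm_R: "norm (R x) = norm x" for x by (simp add: norm_eq_sqrt_inner)
  have pos: "0 \<le> x \<bullet> R x" for x
  proof -
    define p s where "p = x \<bullet> n" and "s = x \<bullet> \<epsilon>"
    \<comment> \<open>\<open>y\<close> is \<open>1 - \<gamma>\<^sup>2\<close> times the orthogonal
      projection of \<open>x\<close> to the plane of \<open>n\<close> and \<open>\<epsilon>\<close>.
      Keeping the factor avoids a division by 0 when the two vectors coincide.\<close>
    define y where "y = p *\<^sub>R (n - \<gamma> *\<^sub>R \<epsilon>) + s *\<^sub>R (\<epsilon> - \<gamma> *\<^sub>R n)"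
    have xy: "x \<bullet> y = p * p + s * s - 2 * \<gamma> * p * s"
      by (simp add: y_def inner_add_right inner_diff_right p_def s_def algebra_simps)
    have yy: "y \<bullet> y = (1 - \<gamma>\<^sup>2) * (x \<bullet> y)"
      unfolding xy unfolding y_def
      by (simp add: inner_add_right inner_diff_right inner_add_left inner_diff_left nn g
           power2_eq_square algebra_simps)
    have xR: "(1 + \<gamma>) * (x \<bullet> R x) = (1 + \<gamma>) * (x \<bullet> x) - x \<bullet> y"
    proof -
      define k where "k = (p + s) / (1 + \<gamma>)"
      have "k * (1 + \<gamma>) = p + s" using \<gamma> by (simp add: k_def)
      moreover have "(1 + \<gamma>) * (k * (p + s)) = (k * (1 + \<gamma>)) * (p + s)" by (simp only: mult_ac)
      ultimately have "(1 + \<gamma>) * (k * (p + s)) = (p + s) * (p + s)" by simp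
      moreover have xR: "x \<bullet> R x = x \<bullet> x - k * (p + s) + 2 * p * s"
        unfolding R_def p_def[symmetric] s_def[symmetric] k_def[symmetric]
        by (simp add: inner_add_right inner_diff_right p_def[symmetric] s_def[symmetric])
      moreover have "(1 + \<gamma>) * (x \<bullet> R x)
          = (1 + \<gamma>) * (x \<bullet> x) - (1 + \<gamma>) * (k * (p + s)) + (1 + \<gamma>) * (2 * p * s)"
        unfolding xR by (simp only: distrib_left right_diff_distrib)
      ultimately show ?thesis unfolding xy by (simp add: algebra_simps)
    qed
    have "(x \<bullet> y)\<^sup>2 \<le> (x \<bullet> x) * (y \<bullet> y)" by (rule Cauchy_Schwarz_ineq)
    then have "(x \<bullet> y) * (x \<bullet> y) \<le> ((1 - \<gamma>\<^sup>2) * (x \<bullet> x)) * (x \<bullet> y)"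
      unfolding yy by (simp add: power2_eq_square algebra_simps)
    moreover have "(1 - \<gamma>\<^sup>2) * (x \<bullet> x) \<ge> 0" using \<gamma> by (simp add: abs_square_le_1)
    ultimately have "x \<bullet> y \<le> (1 - \<gamma>\<^sup>2) * (x \<bullet> x)"
      using mult_strict_right_mono[of "(1 - \<gamma>\<^sup>2) * (x \<bullet> x)" "x \<bullet> y" "x \<bullet> y"] by linarith
    also have "\<dots> \<le> (1 + \<gamma>) * (x \<bullet> x)"
    proof (intro mult_right_mono)
      show "1 - \<gamma>\<^sup>2 \<le> 1 + \<gamma>" using \<gamma> zero_le_power2[of \<gamma>] by linarith
    qed simp
    finally have "0 \<le> (1 + \<gamma>) * (x \<bullet> R x)" unfolding xR by simp
    then show ?thesis using \<gamma> by (simp add: zero_le_mult_iff)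
  qed
  have iso: "isotopic_id R"
    by (rule isotopic_id_linear[OF lin _ pos]) (metis norm_R norm_eq_zero)
  have "R ` {x. norm x = 1 \<and> x \<bullet> n = 0} = {x. norm x = 1 \<and> x \<bullet> \<epsilon> = 0}"
  proof
    show "{x. norm x = 1 \<and> x \<bullet> \<epsilon> = 0} \<subseteq> R ` {x. norm x = 1 \<and> x \<bullet> n = 0}"
    proof clarify
      fix y assume y: "norm y = 1" "y \<bullet> \<epsilon> = 0"
      obtain x where "y = R x"
        using self_homeomorphismD(3)[OF isotopic_id_self_homeomorphism[OF iso]] by (meson surjD)
      then show "y \<in> R ` {x. norm x = 1 \<and> x \<bullet> n = 0}" using y norm_R Re by auto
    qed
  qed (use norm_R Re in auto)
  then show ?thesis using iso ambient_isotopicI by blast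
qed

lemma trivial_knot_round_circle:
  fixes n c :: "real^3"
  assumes n: "norm n = 1" and c: "c \<bullet> n = 0" and \<rho>: "\<rho> > 0"
  shows "trivial_knot {x. x \<bullet> n = 0 \<and> norm (x - c) = \<rho>}" (is "trivial_knot ?K")
proof -
  let ?\<epsilon> = "axis 3 1 :: real^3"
  have "ambient_isotopic ?K {x. norm x = \<rho> \<and> x \<bullet> n = 0}"
  proof (rule ambient_isotopicI[OF isotopic_id_translation[of "- c"]])
    show "(\<lambda>x. x + - c) ` ?K = {x. norm x = \<rho> \<and> x \<bullet> n = 0}"
      using c by (auto simp: inner_diff_left inner_add_left image_iff intro!: exI[of _ "_ + c"])
  qed
  also have "ambient_isotopic {x. norm x = \<rho> \<and> x \<bullet> n = 0} {x. norm x = 1 \<and> x \<bullet> n = 0}"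
  proof (rule ambient_isotopicI[OF isotopic_id_scaling[of "1 / \<rho>"]])
    show "(\<lambda>x. (1 / \<rho>) *\<^sub>R x) ` {x. norm x = \<rho> \<and> x \<bullet> n = 0} = {x. norm x = 1 \<and> x \<bullet> n = 0}"
      using \<rho> by (auto simp: image_iff intro!: exI[of _ "\<rho> *\<^sub>R _"])
  qed (use \<rho> in simp)
  also have "ambient_isotopic {x. norm x = 1 \<and> x \<bullet> n = 0} {x. norm x = 1 \<and> x \<bullet> ?\<epsilon> = 0}"
  \<comment> \<open>\<open>n\<close> and \<open>- n\<close> define the same circle, so the angle may
    be taken to be at most a right angle.\<close>
  proof (cases "n \<bullet> ?\<epsilon> \<ge> 0")
    case True
    then show ?thesis by (intro rotate_circle n) (auto simp: norm_axis_1)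
  next
    case False
    then have "ambient_isotopic {x. norm x = 1 \<and> x \<bullet> (- n) = 0} {x. norm x = 1 \<and> x \<bullet> ?\<epsilon> = 0}"
      by (intro rotate_circle) (auto simp: norm_axis_1 n)
    then show ?thesis by simp
  qed
  finally show ?thesis
    unfolding trivial_knot_def by (simp add: inner_axis)
qed

section \<open>Polygonal unknots\<close>

text \<open>Spheres through the centre of inversion become planes; here it is the unit sphere about
  \<open>- c\<close>.\<close>

lemma circle_0_inversion:
  fixes c y :: "real^3"
  assumes "norm c = 1" "y \<noteq> 0"
  shows "norm (inversion y + c) = 1 \<longleftrightarrow> c \<bullet> y = - 1 / 2"
proof -
  have n: "(norm y)\<^sup>2 \<noteq> 0" using assms by simp
  have "(norm (inversion y + c))\<^sup>2 = (norm (inversion y))\<^sup>2 + 2 * (inversion y \<bullet> c) + (norm c)\<^sup>2"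
    by (simp add: power2_norm_eq_inner inner_add_left inner_add_right inner_commute)
  also have "\<dots> = (1 + 2 * (c \<bullet> y)) / (norm y)\<^sup>2 + 1"
    using assms unfolding norm_inversion
    by (simp add: inversion_def inner_commute add_divide_distrib power_divide)
  finally have "norm (inversion y + c) = 1 \<longleftrightarrow> (1 + 2 * (c \<bullet> y)) / (norm y)\<^sup>2 = 0"
    by (smt (verit) norm_ge_zero power2_eq_1_iff power_one)
  then show ?thesis using n by auto
qed

text \<open>Seen from its point \<open>c\<close>, the circle inverts to the line through
  \<open>- (1 / 2) *\<^sub>R c\<close> in the tangent direction \<open>e'\<close> at
  \<open>c\<close>. \<open>A\<close> places the given line there by an orthogonal map and a
  translation.\<close>

lemma ex_circle_to_line:
  fixes e :: "real^3"
  assumes e: "norm e = 1" and c: "c \<in> std_circle"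
  obtains A where "self_homeomorphism A"
    "\<And>x. A x \<noteq> 0 \<and> inversion (A x) + c \<in> std_circle \<longleftrightarrow> x \<in> range (\<lambda>s. s *\<^sub>R e)"
proof -
  have c': "norm c = 1" "c $ 3 = 0" using c by (auto simp: std_circle_def)
  have c2: "(c $ 1)\<^sup>2 + (c $ 2)\<^sup>2 = 1"
    using c' by (simp add: norm_vec_def L2_set_def sum_3)
  define e' where "e' = (vector [- (c $ 2), c $ 1, 0] :: real^3)"
  have e': "e' $ 1 = - (c $ 2)" "e' $ 2 = c $ 1" "e' $ 3 = 0"
    by (simp_all add: e'_def)
  have "norm e' = 1" using c2 by (simp add: norm_vec_def L2_set_def sum_3 e' add.commute)
  then obtain O' where O': "orthogonal_transformation O'" "O' e = e'"
    using orthogonal_transformation_exists[of e e'] e by auto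
  define A where "A x = O' x - (1 / 2) *\<^sub>R c" for x
  have lin: "linear O'" using O'(1) by (simp add: orthogonal_transformation_def)
  have inj: "inj O'" using O'(1) by (simp add: orthogonal_transformation_inj)
  have "self_homeomorphism O'"
    using lin inj by (intro self_homeomorphism_linear) (auto simp: linear_injective_0)
  then have A: "self_homeomorphism A"
    using self_homeomorphism_comp[OF isotopic_id_self_homeomorphism[OF isotopic_id_translation[of "- ((1 / 2) *\<^sub>R c)"]]]
    by (auto simp: A_def[abs_def] o_def)
  show ?thesis
  proof (rule that[OF A])
    fix x
    have "A x \<noteq> 0 \<and> inversion (A x) + c \<in> std_circle \<longleftrightarrow> c \<bullet> A x = - 1 / 2 \<and> A x $ 3 = 0"
    proof (cases "A x = 0")
      case False
      then have "inversion (A x) $ 3 = 0 \<longleftrightarrow> A x $ 3 = 0" by (simp add: inversion_def)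
      then show ?thesis using False circle_0_inversion[OF c'(1) False] c' by (auto simp: std_circle_def)
    qed simp
    also have "\<dots> \<longleftrightarrow> c \<bullet> O' x = 0 \<and> O' x $ 3 = 0"
      using c' by (simp add: A_def inner_diff_right dot_square_norm)
    also have "\<dots> \<longleftrightarrow> (\<exists>s. O' x = s *\<^sub>R e')"
    proof
      assume *: "c \<bullet> O' x = 0 \<and> O' x $ 3 = 0"
      define y where "y = O' x"
      have y: "c $ 1 * y $ 1 + c $ 2 * y $ 2 = 0" "y $ 3 = 0"
        using * c' by (simp_all add: inner_vec_def sum_3 y_def)
      define s where "s = c $ 1 * y $ 2 - c $ 2 * y $ 1"
      have "s * (c $ 2) = c $ 2 * (c $ 1 * y $ 2) - (c $ 2)\<^sup>2 * y $ 1"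
        by (simp add: s_def algebra_simps power2_eq_square)
      also have "\<dots> = - ((c $ 1)\<^sup>2 + (c $ 2)\<^sup>2) * y $ 1 + c $ 1 * (c $ 1 * y $ 1 + c $ 2 * y $ 2)"
        by (simp add: algebra_simps power2_eq_square)
      finally have 1: "y $ 1 = - (s * c $ 2)" using c2 y by simp
      have "s * (c $ 1) = (c $ 1)\<^sup>2 * y $ 2 - c $ 2 * (c $ 1 * y $ 1)"
        by (simp add: s_def algebra_simps power2_eq_square)
      also have "\<dots> = ((c $ 1)\<^sup>2 + (c $ 2)\<^sup>2) * y $ 2 - c $ 2 * (c $ 1 * y $ 1 + c $ 2 * y $ 2)"
        by (simp add: algebra_simps power2_eq_square)
      finally have 2: "y $ 2 = s * c $ 1" using c2 y by simp
      have "y = s *\<^sub>R e'" using 1 2 y(2) by (simp add: vec_eq_iff forall_3 e')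
      then show "\<exists>s. O' x = s *\<^sub>R e'" by (auto simp: y_def)
    next
      assume "\<exists>s. O' x = s *\<^sub>R e'"
      then show "c \<bullet> O' x = 0 \<and> O' x $ 3 = 0"
        by (auto simp: e' c' inner_vec_def sum_3 algebra_simps)
    qed
    also have "\<dots> \<longleftrightarrow> (\<exists>s. O' x = O' (s *\<^sub>R e))"
      by (simp add: linear_scale[OF lin] O'(2))
    also have "\<dots> \<longleftrightarrow> x \<in> range (\<lambda>s. s *\<^sub>R e)"
      using inj by (auto simp: inj_eq)
    finally show "A x \<noteq> 0 \<and> inversion (A x) + c \<in> std_circle \<longleftrightarrow> x \<in> range (\<lambda>s. s *\<^sub>R e)" .
  qed
qed

text \<open>Let \<open>h\<close> be the distance of \<open>q\<close> from the line and
  \<open>f\<close> the unit normal towards \<open>q\<close>. The nearest point of the line inverts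
  to the point of the circle opposite 0, so the circle has diameter \<open>1 / h\<close> and its
  centre on the ray of \<open>- f\<close>.\<close>

lemma trivial_knot_inverted_line:
  fixes e q :: "real^3"
  assumes e: "norm e = 1" and q: "q \<notin> range (\<lambda>s. s *\<^sub>R e)"
  shows "trivial_knot {w. w = 0 \<or> inversion w + q \<in> range (\<lambda>s. s *\<^sub>R e)}" (is "trivial_knot ?C")
proof -
  have ee: "e \<bullet> e = 1" using e by (simp add: dot_square_norm)
  define g where "g = q - (q \<bullet> e) *\<^sub>R e"
  have g: "g \<noteq> 0" using q by (auto simp: g_def)
  define h where "h = norm g"
  define f where "f = (1 / h) *\<^sub>R g"
  have h: "h > 0" using g by (simp add: h_def)
  have f: "norm f = 1" using h by (simp add: f_def h_def)
  have ge: "g \<bullet> e = 0" "e \<bullet> g = 0" by (simp_all add: g_def inner_diff_left inner_diff_right ee inner_commute)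
  then have ef: "e \<bullet> f = 0" by (simp add: f_def)
  have q_eq: "q = (q \<bullet> e) *\<^sub>R e + h *\<^sub>R f" using h by (simp add: f_def g_def)
  have ff: "f \<bullet> f = 1" using f by (simp add: dot_square_norm)
  define n where "n = cross3 e f"
  note ons = orthonormal_expansion[OF e f ef, folded n_def]
  have en: "e \<bullet> n = 0" "f \<bullet> n = 0" "f \<bullet> e = 0" using ons ef by (simp_all add: inner_commute)
  have qf: "q \<bullet> f = h" and qn: "q \<bullet> n = 0"
    by (subst q_eq, simp add: inner_add_left ef ff en)+
  have line: "x \<in> range (\<lambda>s. s *\<^sub>R e) \<longleftrightarrow> x \<bullet> f = 0 \<and> x \<bullet> n = 0" for x
  proof
    assume "x \<bullet> f = 0 \<and> x \<bullet> n = 0"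
    then have "x = (x \<bullet> e) *\<^sub>R e" using ons(4)[of x] by simp
    then show "x \<in> range (\<lambda>s. s *\<^sub>R e)" by blast
  qed (auto simp: ef en)
  have "?C = {w. w \<bullet> n = 0 \<and> norm (w - (- (1 / (2 * h))) *\<^sub>R f) = 1 / (2 * h)}"
  proof (rule set_eqI)
    fix w
    have r: "norm (w - (- (1 / (2 * h))) *\<^sub>R f) = 1 / (2 * h) \<longleftrightarrow> (norm w)\<^sup>2 + (w \<bullet> f) / h = 0"
    proof -
      have "(norm (w - (- (1 / (2 * h))) *\<^sub>R f))\<^sup>2 = (norm w)\<^sup>2 + (w \<bullet> f) / h + (1 / (2 * h))\<^sup>2"
        using h by (simp add: power2_norm_eq_inner inner_add_left inner_add_right ff inner_commute[of f w])
           (simp add: field_simps power2_eq_square)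
      moreover have "norm (w - (- (1 / (2 * h))) *\<^sub>R f) = 1 / (2 * h)
          \<longleftrightarrow> (norm (w - (- (1 / (2 * h))) *\<^sub>R f))\<^sup>2 = (1 / (2 * h))\<^sup>2"
        using h by (intro power2_eq_iff_nonneg[symmetric]) auto
      ultimately show ?thesis by simp
    qed
    show "w \<in> ?C \<longleftrightarrow> w \<in> {w. w \<bullet> n = 0 \<and> norm (w - (- (1 / (2 * h))) *\<^sub>R f) = 1 / (2 * h)}"
    proof (cases "w = 0")
      case True
      then show ?thesis using r by simp
    next
      case False
      then have w: "(norm w)\<^sup>2 \<noteq> 0" by simp
      have "inversion w + q \<in> range (\<lambda>s. s *\<^sub>R e) \<longleftrightarrow> w \<bullet> f / (norm w)\<^sup>2 + h = 0 \<and> w \<bullet> n = 0"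
        unfolding line using w by (simp add: inner_add_left qf qn inversion_def)
      also have "\<dots> \<longleftrightarrow> (norm w)\<^sup>2 + (w \<bullet> f) / h = 0 \<and> w \<bullet> n = 0"
        using w h by (simp add: field_simps)
      finally show ?thesis using False r by auto
    qed
  qed
  also have "trivial_knot \<dots>"
    using ons(1) h en by (intro trivial_knot_round_circle) auto
  finally show ?thesis .
qed

text \<open>Inverting at a point where \<open>P\<close> is straight turns \<open>\<phi>\<close> into a homeomorphism of a line onto a
  curve that is straight far away. After the swindle it becomes the identity far away, and
  inverting back makes it tangent to the identity at the chosen point.\<close>

lemma trivial_knot_locally_straight:
  assumes phi: "self_homeomorphism \<phi>" and P: "P = \<phi> ` std_circle"
    and z: "z \<in> P" and e: "norm e = 1" and r: "r > 0"
    and flat: "\<And>x. norm (x - z) < r \<Longrightarrow> x \<in> P \<longleftrightarrow> x - z \<in> range (\<lambda>s. s *\<^sub>R e)"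
  shows "trivial_knot P"
proof -
  define L where "L = range (\<lambda>s. s *\<^sub>R e)"
  have cone: "c *\<^sub>R x \<in> L \<longleftrightarrow> x \<in> L" if "c \<noteq> 0" for c x
  proof
    assume "c *\<^sub>R x \<in> L"
    then obtain s where "c *\<^sub>R x = s *\<^sub>R e" by (auto simp: L_def)
    then have "(1 / c) *\<^sub>R (c *\<^sub>R x) = (1 / c) *\<^sub>R (s *\<^sub>R e)" by simp
    then have "x = (s / c) *\<^sub>R e" using that by simp
    then show "x \<in> L" by (auto simp: L_def)
  qed (auto simp: L_def)
  have L0: "0 \<in> L" unfolding L_def by (rule image_eqI[of _ _ 0]) auto
  have phi_inj: "\<phi> x = \<phi> y \<longleftrightarrow> x = y" for x y
    using self_homeomorphismD(2)[OF phi] by (auto simp: inj_eq)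
  obtain c where c: "c \<in> std_circle" "\<phi> c = z" using z P by blast
  obtain A where A: "self_homeomorphism A"
    "\<And>x. A x \<noteq> 0 \<and> inversion (A x) + c \<in> std_circle \<longleftrightarrow> x \<in> L"
    using ex_circle_to_line[OF e c(1)] unfolding L_def by metis
  define \<phi>1 where "\<phi>1 = (\<lambda>x. x + - z) \<circ> \<phi> \<circ> (\<lambda>x. x + c)"
  have phi1: "self_homeomorphism \<phi>1"
    unfolding \<phi>1_def
    by (intro self_homeomorphism_comp phi isotopic_id_self_homeomorphism[OF isotopic_id_translation])
  have phi1_0: "\<phi>1 x = 0 \<longleftrightarrow> x = 0" for x
    using phi_inj[of "x + c" c] c by (simp add: \<phi>1_def)
  \<comment> \<open>\<open>\<psi>\<close> is \<open>\<phi>\<close> with the chosen point sent to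
    infinity in both source and target; through \<open>A\<close> the punctured circle in the source
    becomes the line \<open>L\<close>.\<close>
  define \<psi> where "\<psi> = (inversion \<circ> \<phi>1 \<circ> inversion) \<circ> A"
  have psi: "self_homeomorphism \<psi>"
    unfolding \<psi>_def using phi1 phi1_0 A(1)
    by (intro self_homeomorphism_comp[of "inversion \<circ> \<phi>1 \<circ> inversion"] self_homeomorphism_inversion) auto
  define P' where "P' = {x. x \<noteq> 0 \<and> inversion x + z \<in> P}"
  have im: "\<psi> x \<in> P' \<longleftrightarrow> x \<in> L" for x
  proof -
    have "\<psi> x \<in> P' \<longleftrightarrow> A x \<noteq> 0 \<and> \<phi> (inversion (A x) + c) \<in> P"
      using phi1_0 by (simp add: P'_def \<psi>_def) (simp add: \<phi>1_def)
    also have "\<dots> \<longleftrightarrow> A x \<noteq> 0 \<and> inversion (A x) + c \<in> std_circle"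
      unfolding P by (simp add: image_iff phi_inj)
    finally show ?thesis using A(2) by simp
  qed
  have out: "x \<in> P' \<longleftrightarrow> x \<in> L" if "norm x \<ge> 2 / r" for x
  proof -
    have x0: "x \<noteq> 0" using that r by auto
    then have "norm (inversion x) < r"
      using that r unfolding norm_inversion by (simp add: field_simps)
    then have "inversion x + z \<in> P \<longleftrightarrow> inversion x \<in> L"
      using flat[of "inversion x + z"] by (simp add: L_def)
    also have "\<dots> \<longleftrightarrow> x \<in> L" unfolding inversion_def using x0 by (intro cone) simp
    finally show ?thesis using x0 by (simp add: P'_def)
  qed
  have r2: "2 / r > 0" using r by simp
  obtain \<Theta> R where Th: "self_homeomorphism \<Theta>" "\<And>x. norm x \<ge> R \<Longrightarrow> \<Theta> x = x"
    "\<And>x. \<Theta> x \<in> P' \<longleftrightarrow> x \<in> L"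
    using swindle[OF cone L0 psi im r2 out] by (metis less_irrefl)
  \<comment> \<open>Inverting back needs a map that fixes 0. Translation by \<open>q\<close>
    arranges this at the cost of a bounded displacement far out, and it moves the line off 0, as 0
    is not in \<open>P'\<close>.\<close>
  define q where "q = inv \<Theta> 0"
  have Thq: "\<Theta> q = 0" using self_homeomorphism_inv_simps[OF Th(1)] by (simp add: q_def)
  then have qL: "q \<notin> L" using Th(3)[of q] by (simp add: P'_def)
  have Th0: "\<Theta> x = 0 \<longleftrightarrow> x = q" for x
    using Thq self_homeomorphismD(2)[OF Th(1)] by (metis inj_eq)
  define F where "F = inversion \<circ> (\<Theta> \<circ> (\<lambda>x. x + q)) \<circ> inversion"
  have F: "self_homeomorphism F"
    unfolding F_def using Thq
    by (intro self_homeomorphism_inversion self_homeomorphism_comp Th 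
          isotopic_id_self_homeomorphism[OF isotopic_id_translation]) auto
  have F0: "F 0 = 0" using Thq by (simp add: F_def)
  have iso: "isotopic_id F"
  proof (rule Alexander_trick[OF F F0])
    fix \<epsilon> :: real assume eps: "\<epsilon> > 0"
    \<comment> \<open>If \<open>norm v\<close> exceeds \<open>B\<close>, then \<open>v + q\<close>
      lies where \<open>\<Theta>\<close> is the identity, and \<open>norm q / norm (v + q)\<close>
      is at most \<open>\<epsilon>\<close>.\<close>
    define B where "B = \<bar>R\<bar> + norm q + 1 + norm q / \<epsilon>"
    have "norm q / \<epsilon> \<ge> 0" using eps by simp
    then have B: "B > 0" "B \<ge> \<bar>R\<bar> + norm q + 1" "B \<ge> norm q + norm q / \<epsilon>"
      unfolding B_def using norm_ge_zero[of q] by linarith+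
    have "norm (F x - x) \<le> \<epsilon> * norm x" if x: "norm x < 1 / B" for x
    proof (cases "x = 0")
      case True then show ?thesis using F0 by simp
    next
      case False
      define v where "v = inversion x"
      have v: "v \<noteq> 0" "norm v > B" "x = inversion v" "norm v = 1 / norm x"
        using False x B(1) by (simp_all add: v_def norm_inversion field_simps)
      have u: "norm (v + q) \<ge> norm v - norm q" by (rule norm_diff_ineq)
      have u0: "v + q \<noteq> 0" using u v B by auto
      have "norm (v + q) \<ge> R" using u v(2) B(2) by linarith
      then have "F x = inversion (v + q)" using Th(2) by (simp add: F_def v_def)
      then have "norm (F x - x) = norm q / (norm (v + q) * norm v)"
        using norm_inversion_diff[OF u0 v(1)] v(3) by simp
      also have "\<dots> = (norm q / norm (v + q)) * norm x" using v(4) by simp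
      also have "\<dots> \<le> \<epsilon> * norm x"
      proof (rule mult_right_mono)
        have "norm q / \<epsilon> \<le> norm (v + q)" using u v(2) B(3) by linarith
        then show "norm q / norm (v + q) \<le> \<epsilon>"
          using u0 eps by (simp add: field_simps)
      qed simp
      finally show ?thesis .
    qed
    then show "\<exists>\<delta>>0. \<forall>x. norm x < \<delta> \<longrightarrow> norm (F x - x) \<le> \<epsilon> * norm x"
      using B(1) by (intro exI[of _ "1 / B"]) auto
  qed
  define C where "C = {w. w = 0 \<or> inversion w + q \<in> L}"
  have FC: "F w + z \<in> P \<longleftrightarrow> w \<in> C" for w
  proof (cases "w = 0")
    case True then show ?thesis using F0 z by (simp add: C_def)
  next
    case False
    then have "\<Theta> (inversion w + q) \<noteq> 0" using Th0 by simp
    then have "F w + z \<in> P \<longleftrightarrow> \<Theta> (inversion w + q) \<in> P'" by (simp add: F_def P'_def)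
    then show ?thesis using Th(3) False by (simp add: C_def)
  qed
  have "ambient_isotopic C P"
  proof (rule ambient_isotopicI)
    show "isotopic_id ((\<lambda>x. x + z) \<circ> F)" by (intro isotopic_id_comp iso isotopic_id_translation)
    have "surj ((\<lambda>x. x + z) \<circ> F)"
      using self_homeomorphismD(3)[OF isotopic_id_self_homeomorphism[OF \<open>isotopic_id ((\<lambda>x. x + z) \<circ> F)\<close>]] .
    then show "((\<lambda>x. x + z) \<circ> F) ` C = P"
      using FC by (auto simp: image_iff surj_def) (metis (full_types))
  qed
  moreover have "trivial_knot C"
    unfolding C_def L_def using e qL by (intro trivial_knot_inverted_line) (auto simp: L_def)
  ultimately show ?thesis using trivial_knot_ambient_isotopic ambient_isotopic_sym by blast
qed

section \<open>Polygonal curves near a generic point\<close>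

lemma infinite_std_circle: "infinite std_circle"
proof
  assume "finite std_circle"
  then have "finite ((\<lambda>x. x $ 1) ` std_circle)" by simp
  moreover have "{0..1} \<subseteq> (\<lambda>x. x $ 1) ` std_circle"
  proof
    fix t :: real assume t: "t \<in> {0..1}"
    then have "t\<^sup>2 \<le> 1" by (simp add: abs_square_le_1)
    then have "vector [t, sqrt (1 - t\<^sup>2), 0] \<in> std_circle"
      by (simp add: std_circle_def norm_vec_def L2_set_def sum_3)
    then show "t \<in> (\<lambda>x. x $ 1) ` std_circle" by (force intro: rev_image_eqI)
  qed
  ultimately show False using finite_subset infinite_Icc[of "0::real" 1] by (metis zero_less_one)
qed

text \<open>A segment that shares two points with a chosen nondegenerate one lies on the same line.
  So an inner point of the chosen segment is straight as soon as it avoids the finitely many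
  crossings in exactly one point.\<close>

lemma polygonal_locally_straight:
  assumes "polygonal P" "infinite P"
  obtains z e r where "z \<in> P" "norm e = 1" "r > 0"
    "\<And>x. norm (x - z) < r \<Longrightarrow> x \<in> P \<longleftrightarrow> x - z \<in> range (\<lambda>s. s *\<^sub>R e)"
proof -
  obtain F where F: "finite F" "P = (\<Union>(a, b)\<in>F. closed_segment a b)"
    using assms(1) by (auto simp: polygonal_def)
  have "\<exists>(a, b)\<in>F. a \<noteq> b"
  proof (rule ccontr)
    assume "\<not> ?thesis"
    then have "P = fst ` F" unfolding F(2) by force
    then show False using F(1) assms(2) by simp
  qed
  then obtain p q where pq: "(p, q) \<in> F" "p \<noteq> q" by auto
  \<comment> \<open>The inner union is the intersection of the two segments if that is a single
    point, and empty otherwise.\<close>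
  define bad where "bad = (\<Union>(a, b)\<in>F. \<Union>y\<in>{y. closed_segment a b \<inter> closed_segment p q = {y}}. {y})"
  have "finite bad"
    unfolding bad_def
  proof (intro finite_UN_I F(1), clarify)
    fix a b
    show "finite (\<Union>y\<in>{y. closed_segment a b \<inter> closed_segment p q = {y}}. {y})"
      by (cases "\<exists>y. closed_segment a b \<inter> closed_segment p q = {y}") auto
  qed
  moreover have "infinite (open_segment p q)" using pq(2) by simp
  ultimately obtain z where z: "z \<in> open_segment p q" "z \<notin> bad"
    by (meson finite_subset subsetI)
  define e where "e = (1 / norm (q - p)) *\<^sub>R (q - p)"
  have d: "norm (q - p) > 0" using pq by simp
  have e: "norm e = 1" using d by (simp add: e_def)
  have qp: "q - p = norm (q - p) *\<^sub>R e" using d by (simp add: e_def)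
  obtain l where l: "0 < l" "l < 1" "z = (1 - l) *\<^sub>R p + l *\<^sub>R q"
    using z(1) by (auto simp: in_segment)
  have z': "z = p + l *\<^sub>R (q - p)" using l(3) by (simp add: algebra_simps)
  have zP: "z \<in> closed_segment p q" using z(1) by (simp add: open_closed_segment)
  have "\<exists>r>0. \<forall>x. norm (x - z) < r \<longrightarrow> x \<in> closed_segment a b \<longrightarrow> x - z \<in> range (\<lambda>s. s *\<^sub>R e)"
    if ab: "(a, b) \<in> F" for a b
  proof (cases "z \<in> closed_segment a b")
    case False
    then have "open (- closed_segment a b)" "z \<in> - closed_segment a b" by auto
    then obtain r where "r > 0" "ball z r \<subseteq> - closed_segment a b"
      by (meson open_contains_ball)
    then show ?thesis by (intro exI[of _ r]) (auto simp: dist_norm norm_minus_commute subset_eq)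
  next
    case True
    then have "closed_segment a b \<inter> closed_segment p q \<noteq> {z}"
      using z(2) ab by (auto simp: bad_def)
    then obtain y where y: "y \<in> closed_segment a b" "y \<in> closed_segment p q" "y \<noteq> z"
      using True zP by blast
    obtain m where m: "y = (1 - m) *\<^sub>R p + m *\<^sub>R q" using y(2) by (auto simp: in_segment)
    have yz: "y - z = ((m - l) * norm (q - p)) *\<^sub>R e"
    proof -
      have "y - z = (m - l) *\<^sub>R (q - p)" unfolding m l(3) by (simp add: algebra_simps)
      then show ?thesis using qp by (metis scaleR_scaleR)
    qed
    obtain u v where u: "z = (1 - u) *\<^sub>R a + u *\<^sub>R b" and v: "y = (1 - v) *\<^sub>R a + v *\<^sub>R b"
      using True y(1) by (auto simp: in_segment)
    have yz': "y - z = (v - u) *\<^sub>R (b - a)" unfolding u v by (simp add: algebra_simps)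
    have uv: "v - u \<noteq> 0" using yz' y(3) by auto
    have "(1 / (v - u)) *\<^sub>R (y - z) = b - a" unfolding yz' using uv by simp
    then have ba: "b - a = (1 / (v - u) * ((m - l) * norm (q - p))) *\<^sub>R e" unfolding yz by simp
    have "x - z \<in> range (\<lambda>s. s *\<^sub>R e)" if x: "x \<in> closed_segment a b" for x
    proof -
      obtain t where t: "x = (1 - t) *\<^sub>R a + t *\<^sub>R b" using x by (auto simp: in_segment)
      have "x - z = (t - u) *\<^sub>R (b - a)" unfolding t u by (simp add: algebra_simps)
      then have "x - z = ((t - u) * (1 / (v - u) * ((m - l) * norm (q - p)))) *\<^sub>R e"
        unfolding ba by simp
      then show ?thesis by blast
    qed
    then show ?thesis by (intro exI[of _ 1]) auto
  qed
  then obtain \<rho> where \<rho>: "\<And>a b. (a, b) \<in> F \<Longrightarrow> \<rho> a b > 0"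
    "\<And>a b x. (a, b) \<in> F \<Longrightarrow> norm (x - z) < \<rho> a b \<Longrightarrow> x \<in> closed_segment a b
        \<Longrightarrow> x - z \<in> range (\<lambda>s. s *\<^sub>R e)"
    by metis
  \<comment> \<open>The first two radii are the distances from \<open>z\<close> to the ends
    \<open>p\<close> and \<open>q\<close>, so the ball does not reach beyond the chosen
    segment.\<close>
  define r where "r = Min (insert (l * norm (q - p)) (insert ((1 - l) * norm (q - p)) (case_prod \<rho> ` F)))"
  have fin: "finite (case_prod \<rho> ` F)" using F(1) by simp
  have r0: "r > 0" unfolding r_def using fin \<rho>(1) l d by (subst Min_gr_iff) auto
  have r1: "r \<le> l * norm (q - p)" "r \<le> (1 - l) * norm (q - p)"
    unfolding r_def by (rule Min_le, use fin in simp, simp)+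
  have r2: "r \<le> \<rho> a b" if "(a, b) \<in> F" for a b
    unfolding r_def using fin that by (intro Min_le) (auto intro!: rev_image_eqI[OF that])
  show ?thesis
  proof (rule that[OF _ e r0])
    show "z \<in> P" using zP pq(1) unfolding F(2) by blast
    fix x assume x: "norm (x - z) < r"
    show "x \<in> P \<longleftrightarrow> x - z \<in> range (\<lambda>s. s *\<^sub>R e)"
    proof
      assume "x \<in> P"
      then obtain a b where ab: "(a, b) \<in> F" "x \<in> closed_segment a b" unfolding F(2) by auto
      then show "x - z \<in> range (\<lambda>s. s *\<^sub>R e)"
        using \<rho>(2)[OF ab(1) _ ab(2)] r2[OF ab(1)] x by simp
    next
      assume "x - z \<in> range (\<lambda>s. s *\<^sub>R e)"
      then obtain s where s: "x - z = s *\<^sub>R e" by blast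
      have s_abs: "\<bar>s\<bar> < r" using x e unfolding s by simp
      define m where "m = l + s / norm (q - p)"
      have "- s < l * norm (q - p)" "s < (1 - l) * norm (q - p)" using s_abs r1 by linarith+
      then have m: "0 \<le> m" "m \<le> 1" using d by (simp_all add: m_def field_simps)
      have "x = p + m *\<^sub>R (q - p)"
      proof -
        have "x = z + s *\<^sub>R e" using s by (simp add: algebra_simps)
        also have "\<dots> = p + l *\<^sub>R (q - p) + (s / norm (q - p)) *\<^sub>R (q - p)"
          unfolding z' e_def by simp
        finally show ?thesis by (simp only: m_def scaleR_add_left add.assoc)
      qed
      then have "x = (1 - m) *\<^sub>R p + m *\<^sub>R q" by (simp add: algebra_simps)
      then have "x \<in> closed_segment p q" using m by (auto simp: in_segment)
      then show "x \<in> P" using pq(1) unfolding F(2) by blast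
    qed
  qed
qed

theorem trivial_knot_polygonal:
  assumes phi: "self_homeomorphism \<phi>" and P: "polygonal (\<phi> ` std_circle)"
  shows "trivial_knot (\<phi> ` std_circle)"
proof -
  have "infinite (\<phi> ` std_circle)"
    using infinite_std_circle self_homeomorphismD(2)[OF phi] by (meson finite_imageD inj_on_subset subset_UNIV)
  then obtain z e r where "z \<in> \<phi> ` std_circle" "norm e = 1" "r > 0"
    "\<And>x. norm (x - z) < r \<Longrightarrow> x \<in> \<phi> ` std_circle \<longleftrightarrow> x - z \<in> range (\<lambda>s. s *\<^sub>R e)"
    using polygonal_locally_straight[OF P] by metis
  then show ?thesis by (intro trivial_knot_locally_straight[OF phi refl]) auto
qed

text \<open>Undoing the isotopy of \<open>K\<close> and then applying \<open>h\<close> exhibits the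
  image as that of the circle under one homeomorphism, to which the swindle applies.\<close>

lemma trivial_knot_polygonal_image:
  assumes K: "trivial_knot K" and h: "self_homeomorphism h" and poly: "polygonal (h ` K)"
  shows "trivial_knot (h ` K)"
proof -
  obtain k where k: "isotopic_id k" "k ` K = std_circle"
    using K unfolding trivial_knot_iff by (rule ambient_isotopicE)
  note k_hom = isotopic_id_self_homeomorphism[OF k(1)]
  have "K = inv k ` std_circle"
    using self_homeomorphism_inv_simps[OF k_hom] by (auto simp flip: k(2) simp: image_iff)
  then have "h ` K = (h \<circ> inv k) ` std_circle" by (simp add: image_comp)
  moreover have "self_homeomorphism (h \<circ> inv k)"
    using h k_hom by (intro self_homeomorphism_comp self_homeomorphism_inv)
  ultimately show ?thesis using trivial_knot_polygonal poly by metis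
qed

section \<open>Triangles as unknots\<close>

definition affinely_free :: "real^3 \<Rightarrow> real^3 \<Rightarrow> real^3 \<Rightarrow> bool" where
  "affinely_free p q r \<longleftrightarrow> (\<forall>\<alpha> \<beta>. \<alpha> *\<^sub>R (q - p) + \<beta> *\<^sub>R (r - p) = 0 \<longrightarrow> \<alpha> = 0 \<and> \<beta> = 0)"

text \<open>With \<open>m\<close> the centroid, \<open>u = p - m\<close> and \<open>v = q - m\<close>, the boundary of the triangle is
  the set of all \<open>m + \<alpha> u + \<beta> v\<close> such that \<open>max (\<alpha> + \<beta>) (max (\<beta> - 2 \<alpha>) (\<alpha> - 2 \<beta>)) = 1\<close>.\<close>

lemma triangle_eq:
  fixes p q r :: "real^3"
  assumes "3 *\<^sub>R m = p + q + r"
  shows "closed_segment p q \<union> closed_segment q r \<union> closed_segment r p =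
    {m + \<alpha> *\<^sub>R (p - m) + \<beta> *\<^sub>R (q - m) | \<alpha> \<beta>. max (\<alpha> + \<beta>) (max (\<beta> - 2 * \<alpha>) (\<alpha> - 2 * \<beta>)) = 1}"
    (is "?T = ?S")
proof -
  have r: "r = 3 *\<^sub>R m - p - q" using assms by (simp add: algebra_simps)
  have pq: "(1 - t) *\<^sub>R p + t *\<^sub>R q = m + (1 - t) *\<^sub>R (p - m) + t *\<^sub>R (q - m)" for t
    by (simp add: algebra_simps)
  have qr: "(1 - t) *\<^sub>R q + t *\<^sub>R r = m + (- t) *\<^sub>R (p - m) + (1 - 2 * t) *\<^sub>R (q - m)" for t
    unfolding r by (simp add: vec_eq_iff algebra_simps)
  have rp: "(1 - t) *\<^sub>R r + t *\<^sub>R p = m + (2 * t - 1) *\<^sub>R (p - m) + (t - 1) *\<^sub>R (q - m)" for t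
    unfolding r by (simp add: vec_eq_iff algebra_simps)
  have mem: "m + \<alpha> *\<^sub>R (p - m) + \<beta> *\<^sub>R (q - m) \<in> ?S"
    if "max (\<alpha> + \<beta>) (max (\<beta> - 2 * \<alpha>) (\<alpha> - 2 * \<beta>)) = 1" for \<alpha> \<beta>
    using that by blast
  show ?thesis
  proof
    show "?T \<subseteq> ?S"
    proof
      fix y assume "y \<in> ?T"
      then consider t where "0 \<le> t" "t \<le> 1" "y = (1 - t) *\<^sub>R p + t *\<^sub>R q"
        | t where "0 \<le> t" "t \<le> 1" "y = (1 - t) *\<^sub>R q + t *\<^sub>R r"
        | t where "0 \<le> t" "t \<le> 1" "y = (1 - t) *\<^sub>R r + t *\<^sub>R p"
        by (auto simp: in_segment)
      then show "y \<in> ?S"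
      proof cases
        case 1 then show ?thesis unfolding 1(3) pq by (intro mem) (auto simp: max_def)
      next
        case 2 then show ?thesis unfolding 2(3) qr by (intro mem) (auto simp: max_def)
      next
        case 3 then show ?thesis unfolding 3(3) rp by (intro mem) (auto simp: max_def)
      qed
    qed
    show "?S \<subseteq> ?T"
    proof
      fix y assume "y \<in> ?S"
      then obtain \<alpha> \<beta> where y: "y = m + \<alpha> *\<^sub>R (p - m) + \<beta> *\<^sub>R (q - m)"
        and g: "max (\<alpha> + \<beta>) (max (\<beta> - 2 * \<alpha>) (\<alpha> - 2 * \<beta>)) = 1" by blast
      from g have le: "\<alpha> + \<beta> \<le> 1" "\<beta> - 2 * \<alpha> \<le> 1" "\<alpha> - 2 * \<beta> \<le> 1" by linarith+
      from g consider "\<alpha> + \<beta> = 1" | "\<beta> - 2 * \<alpha> = 1" | "\<alpha> - 2 * \<beta> = 1" by linarith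
      then show "y \<in> ?T"
      proof cases
        case 1
        then have "y = (1 - \<beta>) *\<^sub>R p + \<beta> *\<^sub>R q" "0 \<le> \<beta>" "\<beta> \<le> 1"
          unfolding pq y using le by (auto simp: eq_diff_eq)
        then show ?thesis by (auto simp: in_segment)
      next
        case 2
        then have "y = (1 - (- \<alpha>)) *\<^sub>R q + (- \<alpha>) *\<^sub>R r" "0 \<le> - \<alpha>" "- \<alpha> \<le> 1"
          unfolding qr y using le by (auto simp: diff_eq_eq)
        then have "y \<in> closed_segment q r" unfolding in_segment by blast
        then show ?thesis by blast
      next
        case 3
        then have "y = (1 - (\<beta> + 1)) *\<^sub>R r + (\<beta> + 1) *\<^sub>R p" "0 \<le> \<beta> + 1" "\<beta> + 1 \<le> 1"
          unfolding rp y using le by (auto simp: diff_eq_eq)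
        then have "y \<in> closed_segment r p" unfolding in_segment by blast
        then show ?thesis by blast
      qed
    qed
  qed
qed

text \<open>By \<open>trivial_knot_polygonal\<close> a homeomorphism of space that carries the
  circle to the triangle suffices. It is a radial rescaling from the round ball to a triangular
  prism, followed by an affine map.\<close>

lemma trivial_knot_triangle:
  assumes free: "affinely_free p q r"
  shows "trivial_knot (closed_segment p q \<union> closed_segment q r \<union> closed_segment r p)"
proof -
  define m where "m = (1 / 3) *\<^sub>R (p + q + r)"
  define u v where "u = p - m" and "v = q - m"
  define k where "k = cross3 u v"
  have m3: "3 *\<^sub>R m = p + q + r" by (simp add: m_def)
  have uv: "\<alpha> = 0 \<and> \<beta> = 0" if "\<alpha> *\<^sub>R u + \<beta> *\<^sub>R v = 0" for \<alpha> \<beta>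
  proof -
    have u_eq: "u = (- 1 / 3) *\<^sub>R (q - p) + (- 1 / 3) *\<^sub>R (r - p)"
      and v_eq: "v = (2 / 3) *\<^sub>R (q - p) + (- 1 / 3) *\<^sub>R (r - p)"
      by (simp_all add: u_def v_def m_def vec_eq_iff field_simps)
    have "\<alpha> *\<^sub>R u + \<beta> *\<^sub>R v = ((2 * \<beta> - \<alpha>) / 3) *\<^sub>R (q - p) + (- (\<alpha> + \<beta>) / 3) *\<^sub>R (r - p)"
      unfolding u_eq v_eq by (simp add: vec_eq_iff field_simps)
    then have "(2 * \<beta> - \<alpha>) / 3 = 0 \<and> - (\<alpha> + \<beta>) / 3 = 0"
      using free that unfolding affinely_free_def by metis
    then show ?thesis by auto
  qed
  have k0: "k \<noteq> 0"
  proof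
    assume "k = 0"
    then have "(u \<bullet> v) *\<^sub>R u - (u \<bullet> u) *\<^sub>R v = 0" using Lagrange[of u u v] by (simp add: k_def)
    then have "u \<bullet> u = 0" using uv[of "u \<bullet> v" "- (u \<bullet> u)"] by simp
    then show False using uv[of 1 0] by simp
  qed
  \<comment> \<open>The gauge of the prism over the triangle in the coordinates
    \<open>\<alpha>\<close>, \<open>\<beta>\<close>; the third coordinate makes it positive away
    from 0.\<close>
  define g where "g x = max (x $ 1 + x $ 2) (max (x $ 2 - 2 * x $ 1) (max (x $ 1 - 2 * x $ 2) \<bar>x $ 3\<bar>))"
    for x :: "real^3"
  have g_scale: "g (c *\<^sub>R x) = c * g x" if "c \<ge> 0" for c x
    using that by (simp add: g_def max_mult_distrib_left abs_mult right_diff_distrib distrib_left mult.left_commute)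
  have g_pos: "g x > 0" if "x \<noteq> 0" for x
  proof (rule ccontr)
    assume "\<not> ?thesis"
    then have "x $ 1 + x $ 2 \<le> 0" "x $ 2 - 2 * x $ 1 \<le> 0" "x $ 1 - 2 * x $ 2 \<le> 0" "\<bar>x $ 3\<bar> \<le> 0"
      by (auto simp: g_def)
    then have "x $ 1 = 0" "x $ 2 = 0" "x $ 3 = 0" by linarith+
    then show False using that by (simp add: vec_eq_iff forall_3)
  qed
  have g0: "g 0 = 0" by (simp add: g_def)
  have cont_g: "continuous_on UNIV g" unfolding g_def by (intro continuous_intros)
  \<comment> \<open>The minimum of the gauge on the unit sphere bounds the rescaling factor, which
    gives continuity of \<open>\<Psi>\<close> at 0.\<close>
  have "compact (sphere 0 1 :: (real^3) set)" by simp
  moreover have "sphere 0 1 \<noteq> ({} :: (real^3) set)" by simp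
  ultimately obtain x0 where x0: "x0 \<in> sphere 0 1" "\<And>x. x \<in> sphere 0 1 \<Longrightarrow> g x0 \<le> g x"
    using continuous_attains_inf[of "sphere 0 1" g] continuous_on_subset[OF cont_g] by blast
  have g_ge: "g x0 * norm x \<le> g x" for x
  proof (cases "x = 0")
    case False
    then have "g x0 \<le> g ((1 / norm x) *\<^sub>R x)" by (intro x0) simp
    then show ?thesis using False g_scale[of "1 / norm x" x] by (simp add: field_simps)
  qed (simp add: g0)
  have gx0: "g x0 > 0" using x0(1) by (intro g_pos) auto
  define \<Psi> where "\<Psi> x = (norm x / g x) *\<^sub>R x" for x
  have g_Psi: "g (\<Psi> x) = norm x" for x
    using g_pos[of x] by (cases "x = 0") (simp_all add: \<Psi>_def g_scale less_imp_le g0)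
  have Psi_inv: "\<Psi> ((g y / norm y) *\<^sub>R y) = y" for y
    using g_pos[of y] by (cases "y = 0") (simp_all add: \<Psi>_def g_scale less_imp_le)
  have "self_homeomorphism \<Psi>"
  proof (rule self_homeomorphismI)
    show "surj \<Psi>" using Psi_inv by (rule surjI)
    show "inj \<Psi>"
    proof (rule injI)
      fix x y assume eq: "\<Psi> x = \<Psi> y"
      have rec: "x = (g (\<Psi> x) / norm (\<Psi> x)) *\<^sub>R \<Psi> x" for x
        using g_pos[of x] by (cases "x = 0") (simp_all add: g_Psi, simp_all add: \<Psi>_def)
      show "x = y" using rec[of x] rec[of y] eq by simp
    qed
    show "continuous_on UNIV \<Psi>"
      unfolding continuous_on_eq_continuous_at[OF open_UNIV]
    proof
      fix x
      show "isCont \<Psi> x"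
      proof (cases "x = 0")
        case False
        have "isCont g x" using cont_g by (simp add: continuous_on_eq_continuous_at)
        then show ?thesis unfolding \<Psi>_def using g_pos[OF False] by (intro continuous_intros) auto
      next
        case True
        have "norm (\<Psi> y) \<le> norm y / g x0" for y
        proof (cases "y = 0")
          case False
          have "norm y / g y \<le> 1 / g x0"
            using g_ge[of y] gx0 g_pos[OF False] by (simp add: field_simps)
          then have "norm y / g y * norm y \<le> 1 / g x0 * norm y" by (intro mult_right_mono) auto
          then show ?thesis using g_pos[OF False] by (simp add: \<Psi>_def)
        qed (simp add: \<Psi>_def)
        then have *: "norm (\<Psi> y) < e" if "norm y < e * g x0" for y e
          using that gx0 by (metis le_less_trans pos_divide_less_eq)
        show ?thesis unfolding True continuous_at_eps_delta
        proof (intro allI impI)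
          fix e :: real assume "e > 0"
          then show "\<exists>d>0. \<forall>x'. dist x' 0 < d \<longrightarrow> dist (\<Psi> x') (\<Psi> 0) < e"
            using * gx0 by (intro exI[of _ "e * g x0"]) (auto simp: \<Psi>_def)
        qed
      qed
    qed
  qed
  define Af where "Af x = (x $ 1) *\<^sub>R u + (x $ 2) *\<^sub>R v + (x $ 3) *\<^sub>R k" for x :: "real^3"
  have "self_homeomorphism Af"
  proof (rule self_homeomorphism_linear)
    show "linear Af" by (rule linearI) (simp_all add: Af_def scaleR_add_left scaleR_add_right)
    fix x assume "Af x = 0"
    moreover have "Af x \<bullet> k = x $ 3 * (k \<bullet> k)"
      by (simp add: Af_def inner_add_left k_def dot_cross_self)
    ultimately have 3: "x $ 3 = 0" using k0 by simp
    then have "x $ 1 = 0 \<and> x $ 2 = 0" using \<open>Af x = 0\<close> by (intro uv) (simp add: Af_def)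
    then show "x = 0" using 3 by (simp add: vec_eq_iff forall_3)
  qed
  define \<phi> where "\<phi> = (\<lambda>x. x + m) \<circ> (Af \<circ> \<Psi>)"
  have phi: "self_homeomorphism \<phi>"
    unfolding \<phi>_def using \<open>self_homeomorphism Af\<close> \<open>self_homeomorphism \<Psi>\<close>
    by (intro self_homeomorphism_comp isotopic_id_self_homeomorphism[OF isotopic_id_translation])
  have Psi_C: "\<Psi> ` std_circle = {y. g y = 1 \<and> y $ 3 = 0}"
  proof
    show "\<Psi> ` std_circle \<subseteq> {y. g y = 1 \<and> y $ 3 = 0}"
      using g_Psi by (auto simp: std_circle_def) (simp add: \<Psi>_def)
    show "{y. g y = 1 \<and> y $ 3 = 0} \<subseteq> \<Psi> ` std_circle"
    proof clarify
      fix y :: "real^3" assume y: "g y = 1" "y $ 3 = 0"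
      then have "y \<noteq> 0" using g0 by auto
      then have "(g y / norm y) *\<^sub>R y \<in> std_circle" using y by (simp add: std_circle_def)
      then show "y \<in> \<Psi> ` std_circle" using Psi_inv[of y] by (metis image_eqI)
    qed
  qed
  have "\<phi> ` std_circle = {m + \<alpha> *\<^sub>R u + \<beta> *\<^sub>R v | \<alpha> \<beta>. max (\<alpha> + \<beta>) (max (\<beta> - 2 * \<alpha>) (\<alpha> - 2 * \<beta>)) = 1}"
    (is "_ = ?S")
  proof -
    have "\<phi> ` std_circle = (\<lambda>x. Af x + m) ` {y. g y = 1 \<and> y $ 3 = 0}"
      unfolding Psi_C[symmetric] by (auto simp: \<phi>_def)
    also have "\<dots> = ?S"
    proof
      show "(\<lambda>x. Af x + m) ` {y. g y = 1 \<and> y $ 3 = 0} \<subseteq> ?S"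
      proof clarify
        fix y :: "real^3" assume y: "g y = 1" "y $ 3 = 0"
        then have "max (y $ 1 + y $ 2) (max (y $ 2 - 2 * y $ 1) (y $ 1 - 2 * y $ 2)) = 1"
          by (auto simp: g_def max_def split: if_splits)
        moreover have "Af y + m = m + (y $ 1) *\<^sub>R u + (y $ 2) *\<^sub>R v" using y by (simp add: Af_def add_ac)
        ultimately show "\<exists>\<alpha> \<beta>. Af y + m = m + \<alpha> *\<^sub>R u + \<beta> *\<^sub>R v \<and>
            max (\<alpha> + \<beta>) (max (\<beta> - 2 * \<alpha>) (\<alpha> - 2 * \<beta>)) = 1" by blast
      qed
      show "?S \<subseteq> (\<lambda>x. Af x + m) ` {y. g y = 1 \<and> y $ 3 = 0}"
      proof clarify
        fix \<alpha> \<beta> :: real assume 1: "max (\<alpha> + \<beta>) (max (\<beta> - 2 * \<alpha>) (\<alpha> - 2 * \<beta>)) = 1"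
        define y :: "real^3" where "y = vector [\<alpha>, \<beta>, 0]"
        have y: "y $ 1 = \<alpha>" "y $ 2 = \<beta>" "y $ 3 = 0" by (simp_all add: y_def)
        have "g y = 1" using 1 by (auto simp: g_def y max_def split: if_splits)
        then show "m + \<alpha> *\<^sub>R u + \<beta> *\<^sub>R v \<in> (\<lambda>x. Af x + m) ` {y. g y = 1 \<and> y $ 3 = 0}"
          using y by (intro image_eqI[of _ _ y]) (auto simp: Af_def add_ac)
      qed
    qed
    finally show ?thesis .
  qed
  then have T: "\<phi> ` std_circle = closed_segment p q \<union> closed_segment q r \<union> closed_segment r p"
    unfolding triangle_eq[OF m3] u_def v_def .
  have "polygonal (closed_segment p q \<union> closed_segment q r \<union> closed_segment r p)"
    unfolding polygonal_def by (intro exI[of _ "{(p, q), (q, r), (r, p)}"]) auto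
  then show ?thesis using trivial_knot_polygonal[OF phi] by (simp add: T)
qed

section \<open>Triangle moves\<close>

lemma polygonal_segment: "polygonal (closed_segment a b)"
  unfolding polygonal_def by (intro exI[of _ "{(a, b)}"]) auto

lemma polygonal_empty: "polygonal {}"
  unfolding polygonal_def by (intro exI[of _ "{}"]) auto

lemma polygonal_Un:
  assumes "polygonal S" "polygonal T" shows "polygonal (S \<union> T)"
proof -
  obtain F G where "finite F" "S = (\<Union>(a, b)\<in>F. closed_segment a b)"
    "finite G" "T = (\<Union>(a, b)\<in>G. closed_segment a b)"
    using assms by (auto simp: polygonal_def)
  then show ?thesis unfolding polygonal_def by (intro exI[of _ "F \<union> G"]) auto
qed

lemma polygonal_UN:
  assumes "finite I" "\<And>i. i \<in> I \<Longrightarrow> polygonal (S i)" shows "polygonal (\<Union>i\<in>I. S i)"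
  using assms by (induction I rule: finite_induct) (simp_all add: polygonal_empty polygonal_Un)

lemma polygonal_affine_image:
  assumes "polygonal S" "linear f" shows "polygonal ((\<lambda>x. c + f x) ` S)"
proof -
  obtain F where F: "finite F" "S = (\<Union>(a, b)\<in>F. closed_segment a b)"
    using assms(1) by (auto simp: polygonal_def)
  have "(\<lambda>x. c + f x) ` closed_segment a b = closed_segment (c + f a) (c + f b)" for a b
    by (simp add: closed_segment_translation closed_segment_linear_image[OF assms(2)] image_image)
  then have "(\<lambda>x. c + f x) ` S = (\<Union>(a, b)\<in>F. closed_segment (c + f a) (c + f b))"
    unfolding F(2) by (simp only: image_UN case_prod_unfold)
  then show ?thesis
    unfolding polygonal_def using F(1)
    by (intro exI[of _ "(\<lambda>(a, b). (c + f a, c + f b)) ` F"]) (simp add: case_prod_unfold)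
qed

lemma ambient_isotopic_homeomorphic_image:
  assumes "ambient_isotopic X Y" and g: "self_homeomorphism g"
  shows "ambient_isotopic (g ` X) (g ` Y)"
proof -
  obtain h where h: "isotopic_id h" "h ` X = Y" using assms(1) by (rule ambient_isotopicE)
  have gi: "self_homeomorphism (inv g)" using g by (rule self_homeomorphism_inv)
  have "inv (inv g) = g" using self_homeomorphismD(4)[OF g] by (simp add: inv_inv_eq)
  then have "isotopic_id (g \<circ> h \<circ> inv g)" using isotopic_id_conj[OF h(1) gi] by simp
  moreover have "(g \<circ> h \<circ> inv g) ` (g ` X) = g ` Y"
    unfolding h(2)[symmetric] by (simp add: image_image self_homeomorphism_inv_simps[OF g])
  ultimately show ?thesis by (rule ambient_isotopicI)
qed

text \<open>The tent over the segment from \<open>- E1\<close> to \<open>E1\<close> with top \<open>E2\<close>, cut down steeply outside the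
  triangle. Its slope in the direction \<open>E2\<close> stays above \<open>-1\<close>, as the shear requires.\<close>

definition tent :: "real \<Rightarrow> real^3 \<Rightarrow> real" where
  "tent M x = max 0 (1 - \<bar>x $ 1\<bar> - max (M / (M + 1) * x $ 2) (- M * x $ 2) - M * \<bar>x $ 3\<bar>)"

definition std_triangle :: "(real^3) set" where
  "std_triangle = {x. x $ 3 = 0 \<and> 0 \<le> x $ 2 \<and> x $ 2 \<le> 1 - \<bar>x $ 1\<bar>}"

lemma tent_slope_nonneg:
  fixes M y :: real
  assumes "M > 0" shows "0 \<le> max (M / (M + 1) * y) (- M * y)"
proof (cases "y \<ge> 0")
  case True
  then have "0 \<le> M / (M + 1) * y" using assms by (intro mult_nonneg_nonneg) auto
  then show ?thesis by simp
next
  case False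
  then have "0 \<le> M * (- y)" using assms by (intro mult_nonneg_nonneg) auto
  then show ?thesis by simp
qed

text \<open>The support shrinks towards the triangle as the parameter grows. Finitely many segments
  can thus be treated separately and the largest parameter taken.\<close>

lemma tent_mono:
  assumes "0 < M" "M \<le> N" shows "tent N x \<le> tent M x"
proof -
  have c: "M / (M + 1) \<le> N / (N + 1)" using assms by (simp add: field_simps)
  have "max (M / (M + 1) * x $ 2) (- M * x $ 2) \<le> max (N / (N + 1) * x $ 2) (- N * x $ 2)"
  proof (cases "x $ 2 \<ge> 0")
    case True
    have "M / (M + 1) * x $ 2 \<le> N / (N + 1) * x $ 2" using c True by (rule mult_right_mono)
    moreover have "- M * x $ 2 \<le> 0" using assms True by simp
    moreover have "0 \<le> max (N / (N + 1) * x $ 2) (- N * x $ 2)"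
      using assms by (intro tent_slope_nonneg) simp
    ultimately show ?thesis by linarith
  next
    case False
    then have "M * (- (x $ 2)) \<le> N * (- (x $ 2))" using assms by (intro mult_right_mono) auto
    moreover have "M / (M + 1) * x $ 2 \<le> 0" using assms False by (intro mult_nonneg_nonpos) auto
    moreover have "0 \<le> max (N / (N + 1) * x $ 2) (- N * x $ 2)"
      using assms by (intro tent_slope_nonneg) simp
    ultimately show ?thesis by linarith
  qed
  moreover have "M * \<bar>x $ 3\<bar> \<le> N * \<bar>x $ 3\<bar>" using assms by (intro mult_right_mono) auto
  ultimately show ?thesis unfolding tent_def by linarith
qed

lemma isotopic_id_tent:
  assumes M: "M > 0"
  shows "isotopic_id (\<lambda>x. x + tent M x *\<^sub>R axis 2 1)"
proof (rule isotopic_id_shear)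
  show "continuous_on UNIV (tent M)" unfolding tent_def by (intro continuous_intros)
  show "0 \<le> tent M x" for x by (simp add: tent_def)
  have ge: "max (M / (M + 1) * y) (- M * y) \<ge> 0" for y
    using M by (rule tent_slope_nonneg)
  show "tent M x \<le> 1" for x
  proof -
    have "M * \<bar>x $ 3\<bar> \<ge> 0" using M by simp
    then show ?thesis unfolding tent_def using ge[of "x $ 2"] by linarith
  qed
  fix x :: "real^3" and s :: real assume s: "0 < s"
  define c where "c = M / (M + 1)"
  have c: "0 < c" "c < 1" using M by (auto simp: c_def)
  have cs: "c * s < s" "c * s > 0" "M * s > 0" using c s M by auto
  have comps: "(x + s *\<^sub>R axis 2 1) $ 1 = x $ 1" "(x + s *\<^sub>R axis 2 1) $ 2 = x $ 2 + s"
    "(x + s *\<^sub>R axis 2 1) $ 3 = x $ 3" by (simp_all add: axis_def)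
  define p where "p = max (c * x $ 2) (- M * x $ 2)"
  define q where "q = max (c * (x $ 2 + s)) (- M * (x $ 2 + s))"
  have "c * (x $ 2 + s) \<le> p + c * s" unfolding p_def distrib_left by simp
  moreover have "- M * (x $ 2 + s) \<le> - M * x $ 2" using M s by simp
  then have "- M * (x $ 2 + s) \<le> p + c * s" unfolding p_def using cs(2) by linarith
  ultimately have "q \<le> p + c * s" unfolding q_def by (rule max.boundedI)
  then show "tent M x - tent M (x + s *\<^sub>R axis 2 1) < s"
    unfolding tent_def c_def[symmetric] comps p_def[symmetric] q_def[symmetric] using cs(1) s by linarith
qed

text \<open>A ray leaves the corner with first coordinate \<open>\<sigma>\<close> in the direction
  \<open>(g1, g2, g3)\<close>, and \<open>- \<sigma> * g1\<close> is its speed towards the middle,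
  where the tent is high. Either the tent drops faster than that for some \<open>M\<close>, or the
  ray enters the triangle, which is the second alternative.\<close>

lemma tent_direction:
  fixes \<sigma> g1 g2 g3 :: real
  assumes "\<bar>\<sigma>\<bar> = 1"
  obtains M where "M > 0" "- \<sigma> * g1 \<le> max (M / (M + 1) * g2) (- M * g2) + M * \<bar>g3\<bar>"
  | "g3 = 0" "0 \<le> g2" "g2 \<le> - \<sigma> * g1" "g1 \<noteq> 0"
proof -
  have g1: "- \<sigma> * g1 \<le> \<bar>g1\<bar>" using assms by (metis abs_ge_self abs_minus abs_mult mult_1)
  have ge: "max (M / (M + 1) * y) (- M * y) \<ge> 0" if "M > 0" for M y :: real
    using that by (rule tent_slope_nonneg)
  consider "g3 \<noteq> 0" | "g3 = 0" "g2 < 0" | "g3 = 0" "g2 \<ge> 0" "- \<sigma> * g1 < g2"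
    | "g3 = 0" "g2 \<ge> 0" "g2 \<le> - \<sigma> * g1" "g1 \<noteq> 0" | "g3 = 0" "g2 = 0" "g1 = 0"
    using assms by fastforce
  then show ?thesis
  proof cases
    case 1
    define M where "M = 1 + \<bar>g1\<bar> / \<bar>g3\<bar>"
    have M: "M > 0" unfolding M_def by (intro add_pos_nonneg) auto
    have "\<bar>g1\<bar> \<le> M * \<bar>g3\<bar>" using 1 by (simp add: M_def field_simps)
    then show ?thesis using that(1)[OF M] ge[OF M, of g2] g1 by linarith
  next
    case 2
    define M where "M = 1 + \<bar>g1\<bar> / \<bar>g2\<bar>"
    have M: "M > 0" unfolding M_def by (intro add_pos_nonneg) auto
    have "\<bar>g1\<bar> \<le> - M * g2" using 2 by (simp add: M_def field_simps)
    then show ?thesis using that(1)[OF M] 2(1) g1 by simp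
  next
    case 3
    \<comment> \<open>With the denominator of \<open>M / (M + 1)\<close> cleared, \<open>M\<close>
      times the positive gap between \<open>g2\<close> and \<open>- \<sigma> * g1\<close> has to
      reach \<open>- \<sigma> * g1\<close>.\<close>
    define M where "M = 1 + \<bar>g1\<bar> / (g2 - (- \<sigma> * g1))"
    have M: "M > 0" unfolding M_def using 3 by (intro add_pos_nonneg) auto
    have "M * (g2 - (- \<sigma> * g1)) = (g2 - (- \<sigma> * g1)) + \<bar>g1\<bar>"
      unfolding M_def distrib_right using 3 by simp
    then have "\<bar>g1\<bar> \<le> M * (g2 - (- \<sigma> * g1))" using 3 by linarith
    then have "- \<sigma> * g1 * (M + 1) \<le> M * g2" using g1 by (simp add: algebra_simps)
    then have "- \<sigma> * g1 \<le> M / (M + 1) * g2" using M by (simp add: field_simps)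
    then show ?thesis using that(1)[OF M] 3(1) by simp
  next
    case 4
    then show ?thesis using that(2) by simp
  next
    case 5
    then show ?thesis using that(1)[of 1] by simp
  qed
qed

text \<open>The hypothesis on \<open>g\<close> is invariant under positive scaling, so it gives the claim on the
  whole ray.\<close>

lemma tent_direction_eq_0:
  assumes \<sigma>: "\<bar>\<sigma>\<bar> = 1" and M: "M > 0" and \<mu>: "\<mu> \<ge> 0"
    and g: "- \<sigma> * g $ 1 \<le> max (M / (M + 1) * g $ 2) (- M * g $ 2) + M * \<bar>g $ 3\<bar>"
  shows "tent M (\<sigma> *\<^sub>R axis 1 1 + \<mu> *\<^sub>R g) = 0"
proof -
  have c: "(\<sigma> *\<^sub>R axis 1 1 + \<mu> *\<^sub>R g) $ 1 = \<sigma> + \<mu> * g $ 1" "(\<sigma> *\<^sub>R axis 1 1 + \<mu> *\<^sub>R g) $ 2 = \<mu> * g $ 2"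
    "(\<sigma> *\<^sub>R axis 1 1 + \<mu> *\<^sub>R g) $ 3 = \<mu> * g $ 3"
    by (simp_all add: axis_def)
  have "\<sigma> * \<sigma> = 1" using \<sigma> by (metis abs_mult_self_eq mult_1)
  then have "1 + \<sigma> * (\<mu> * g $ 1) = \<sigma> * (\<sigma> + \<mu> * g $ 1)" by (simp add: distrib_left)
  also have "\<dots> \<le> \<bar>\<sigma> + \<mu> * g $ 1\<bar>" using \<sigma> by (metis abs_ge_self abs_mult mult_1)
  finally have "1 - \<bar>\<sigma> + \<mu> * g $ 1\<bar> \<le> \<mu> * (- \<sigma> * g $ 1)" by (simp add: algebra_simps)
  also have "\<dots> \<le> \<mu> * (max (M / (M + 1) * g $ 2) (- M * g $ 2) + M * \<bar>g $ 3\<bar>)"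
    using g \<mu> by (rule mult_left_mono)
  also have "\<dots> = max (M / (M + 1) * (\<mu> * g $ 2)) (- M * (\<mu> * g $ 2)) + M * \<bar>\<mu> * g $ 3\<bar>"
    using \<mu> by (simp add: distrib_left max_mult_distrib_left abs_mult mult.left_commute)
  finally show ?thesis unfolding tent_def c by linarith
qed

lemma tent_ray_eq_0:
  assumes \<sigma>: "\<bar>\<sigma>\<bar> = 1" and l: "l > 0"
    and disj: "\<And>\<mu>. 0 < \<mu> \<Longrightarrow> \<mu> \<le> l \<Longrightarrow> \<sigma> *\<^sub>R axis 1 1 + \<mu> *\<^sub>R g \<in> std_triangle
      \<Longrightarrow> \<sigma> *\<^sub>R axis 1 1 + \<mu> *\<^sub>R g \<in> {axis 1 1, - axis 1 1}"
  obtains M where "M > 0" "\<And>\<mu>. \<mu> \<ge> 0 \<Longrightarrow> tent M (\<sigma> *\<^sub>R axis 1 1 + \<mu> *\<^sub>R g) = 0"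
proof (rule tent_direction[OF \<sigma>, of "g $ 1" "g $ 2" "g $ 3"])
  fix M assume "M > 0" "- \<sigma> * g $ 1 \<le> max (M / (M + 1) * g $ 2) (- M * g $ 2) + M * \<bar>g $ 3\<bar>"
  then show ?thesis using that tent_direction_eq_0[OF \<sigma>] by blast
next
  assume g: "g $ 3 = 0" "0 \<le> g $ 2" "g $ 2 \<le> - \<sigma> * g $ 1" "g $ 1 \<noteq> 0"
  \<comment> \<open>Up to the second bound the first coordinate does not cross 0, so its absolute
    value decreases linearly along the ray.\<close>
  define \<mu> where "\<mu> = min l (1 / \<bar>g $ 1\<bar>)"
  have \<mu>: "\<mu> > 0" "\<mu> \<le> l" "\<mu> \<le> 1 / \<bar>g $ 1\<bar>" using l g(4) by (auto simp: \<mu>_def)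
  have c: "(\<sigma> *\<^sub>R axis 1 1 + t *\<^sub>R g) $ 1 = \<sigma> + t * g $ 1" "(\<sigma> *\<^sub>R axis 1 1 + t *\<^sub>R g) $ 2 = t * g $ 2"
    "(\<sigma> *\<^sub>R axis 1 1 + t *\<^sub>R g) $ 3 = t * g $ 3" for t
    by (simp_all add: axis_def)
  have in_tri: "\<sigma> *\<^sub>R axis 1 1 + t *\<^sub>R g \<in> std_triangle" if "0 < t" "t \<le> \<mu>" for t
  proof -
    have "t * \<bar>g $ 1\<bar> \<le> \<mu> * \<bar>g $ 1\<bar>" using that by (intro mult_right_mono) auto
    also have "\<dots> \<le> 1" using \<mu>(3) g(4) by (simp add: field_simps)
    finally have t1: "t * \<bar>g $ 1\<bar> \<le> 1" .
    have "t * g $ 2 \<le> t * (- \<sigma> * g $ 1)" using g(3) that by (intro mult_left_mono) auto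
    moreover have "\<bar>\<sigma> + t * g $ 1\<bar> = 1 - t * (- \<sigma> * g $ 1)"
    proof -
      have "\<bar>- \<sigma> * g $ 1\<bar> = \<bar>g $ 1\<bar>" using \<sigma> by (simp add: abs_mult)
      moreover have "0 \<le> - \<sigma> * g $ 1" using g by linarith
      ultimately have "- \<sigma> * g $ 1 = \<bar>g $ 1\<bar>" by simp
      then have "t * (- \<sigma> * g $ 1) = t * \<bar>g $ 1\<bar>" by (simp only:)
      then have "t * (- \<sigma> * g $ 1) \<le> 1" using t1 by simp
      moreover from \<sigma> have "\<sigma> = 1 \<or> \<sigma> = - 1" by linarith
      ultimately show ?thesis by (elim disjE) simp_all
    qed
    moreover have "0 \<le> t * g $ 2" "t * g $ 3 = 0" using g that by simp_all
    ultimately show ?thesis unfolding std_triangle_def mem_Collect_eq c by linarith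
  qed
  have "\<sigma> + t * g $ 1 = 1 \<or> \<sigma> + t * g $ 1 = - 1" if "0 < t" "t \<le> \<mu>" for t
  proof -
    have "\<sigma> *\<^sub>R axis 1 1 + t *\<^sub>R g \<in> {axis 1 1, - axis 1 1}"
      using disj[OF _ _ in_tri] that \<mu>(2) by (meson order_trans)
    then show ?thesis unfolding c(1)[symmetric] by (elim insertE) (simp_all add: axis_def)
  qed
  \<comment> \<open>All these points lie in the triangle and would have to be corners, but two
    different points on the ray and its starting point cannot all have first coordinate 1 or -1 when
    one is halfway between the others.\<close>
  from this[of \<mu>] this[of "\<mu> / 2"]
  have "\<sigma> + \<mu> * g $ 1 = 1 \<or> \<sigma> + \<mu> * g $ 1 = - 1"
    "\<sigma> + \<mu> * g $ 1 / 2 = 1 \<or> \<sigma> + \<mu> * g $ 1 / 2 = - 1" using \<mu>(1) by simp_all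
  moreover have "\<mu> * g $ 1 \<noteq> 0" using \<mu>(1) g(4) by simp
  moreover have "\<sigma> = 1 \<or> \<sigma> = - 1" using \<sigma> by linarith
  ultimately have False by linarith
  then show ?thesis ..
qed

text \<open>A segment through a corner is split there into two rays. One that avoids both corners is
  disjoint from the compact triangle, hence at positive distance from it, and a steep enough tent
  does not reach it.\<close>

lemma tent_segment_eq_0:
  assumes "closed_segment a b \<inter> std_triangle \<subseteq> {axis 1 1, - axis 1 1}"
  shows "\<exists>M>0. \<forall>x\<in>closed_segment a b. tent M x = 0"
proof (cases "\<exists>\<sigma>. \<bar>\<sigma>\<bar> = 1 \<and> \<sigma> *\<^sub>R axis 1 1 \<in> closed_segment a b")
  case True
  then obtain \<sigma> where \<sigma>: "\<bar>\<sigma>\<bar> = 1" "\<sigma> *\<^sub>R axis 1 1 \<in> closed_segment a b" by blast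
  then obtain t where t: "0 \<le> t" "t \<le> 1" "\<sigma> *\<^sub>R axis 1 1 = (1 - t) *\<^sub>R a + t *\<^sub>R b"
    by (auto simp: in_segment)
  define g where "g = b - a"
  have seg: "\<sigma> *\<^sub>R axis 1 1 + \<mu> *\<^sub>R g \<in> closed_segment a b" if "- t \<le> \<mu>" "\<mu> \<le> 1 - t" for \<mu>
    unfolding in_segment t(3) g_def using that
    by (intro exI[of _ "t + \<mu>"]) (auto simp: algebra_simps)
  have 1: "\<exists>M>0. \<forall>\<mu>. 0 \<le> \<mu> \<and> \<mu> \<le> 1 - t \<longrightarrow> tent M (\<sigma> *\<^sub>R axis 1 1 + \<mu> *\<^sub>R g) = 0"
  proof (cases "t = 1")
    case True
    then show ?thesis using \<sigma>(1) by (intro exI[of _ 1]) (auto simp: tent_def axis_def)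
  next
    case False
    obtain M where "M > 0" "\<And>\<mu>. \<mu> \<ge> 0 \<Longrightarrow> tent M (\<sigma> *\<^sub>R axis 1 1 + \<mu> *\<^sub>R g) = 0"
    proof (rule tent_ray_eq_0[OF \<sigma>(1), of "1 - t" g])
      show "\<sigma> *\<^sub>R axis 1 1 + \<mu> *\<^sub>R g \<in> {axis 1 1, - axis 1 1}"
        if "0 < \<mu>" "\<mu> \<le> 1 - t" "\<sigma> *\<^sub>R axis 1 1 + \<mu> *\<^sub>R g \<in> std_triangle" for \<mu>
        using that seg[of \<mu>] t assms by auto
    qed (use False t in auto)
    then show ?thesis by blast
  qed
  have 2: "\<exists>M>0. \<forall>\<mu>. 0 \<le> \<mu> \<and> \<mu> \<le> t \<longrightarrow> tent M (\<sigma> *\<^sub>R axis 1 1 + \<mu> *\<^sub>R (- g)) = 0"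
  proof (cases "t = 0")
    case True
    then show ?thesis using \<sigma>(1) by (intro exI[of _ 1]) (auto simp: tent_def axis_def)
  next
    case False
    obtain M where "M > 0" "\<And>\<mu>. \<mu> \<ge> 0 \<Longrightarrow> tent M (\<sigma> *\<^sub>R axis 1 1 + \<mu> *\<^sub>R (- g)) = 0"
    proof (rule tent_ray_eq_0[OF \<sigma>(1), of t "- g"])
      show "\<sigma> *\<^sub>R axis 1 1 + \<mu> *\<^sub>R (- g) \<in> {axis 1 1, - axis 1 1}"
        if "0 < \<mu>" "\<mu> \<le> t" "\<sigma> *\<^sub>R axis 1 1 + \<mu> *\<^sub>R (- g) \<in> std_triangle" for \<mu>
        using that seg[of "- \<mu>"] t assms by auto
    qed (use False t in auto)
    then show ?thesis by blast
  qed
  obtain M1 M2 where M1: "M1 > 0" "\<And>\<mu>. 0 \<le> \<mu> \<Longrightarrow> \<mu> \<le> 1 - t \<Longrightarrow> tent M1 (\<sigma> *\<^sub>R axis 1 1 + \<mu> *\<^sub>R g) = 0"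
    and M2: "M2 > 0" "\<And>\<mu>. 0 \<le> \<mu> \<Longrightarrow> \<mu> \<le> t \<Longrightarrow> tent M2 (\<sigma> *\<^sub>R axis 1 1 + \<mu> *\<^sub>R (- g)) = 0"
    using 1 2 by metis
  define M where "M = max M1 M2"
  have 0: "tent M x = 0" if "tent M1 x = 0 \<or> tent M2 x = 0" for x
  proof -
    have "tent M x \<le> tent M1 x" "tent M x \<le> tent M2 x"
      using M1(1) M2(1) by (auto simp: M_def intro!: tent_mono)
    moreover have "tent M x \<ge> 0" by (simp add: tent_def)
    ultimately show ?thesis using that by linarith
  qed
  have "tent M x = 0" if x: "x \<in> closed_segment a b" for x
  proof -
    obtain s where s: "0 \<le> s" "s \<le> 1" "x = (1 - s) *\<^sub>R a + s *\<^sub>R b" using x by (auto simp: in_segment)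
    have eq: "x = \<sigma> *\<^sub>R axis 1 1 + (s - t) *\<^sub>R g" "x = \<sigma> *\<^sub>R axis 1 1 + (t - s) *\<^sub>R (- g)"
      unfolding s(3) t(3) g_def by (simp_all add: algebra_simps)
    show ?thesis
    proof (cases "s \<ge> t")
      case True
      then show ?thesis using M1(2)[of "s - t"] s(2) 0 by (metis diff_ge_0_iff_ge diff_right_mono eq(1))
    next
      case False
      then show ?thesis using M2(2)[of "t - s"] s(1) 0 eq(2) by auto
    qed
  qed
  then show ?thesis using M1(1) by (intro exI[of _ M]) (auto simp: M_def)
next
  case False
  have disj: "closed_segment a b \<inter> std_triangle = {}"
  proof (rule ccontr)
    assume "\<not> ?thesis"
    then obtain x where x: "x \<in> closed_segment a b" "x \<in> {axis 1 1, - axis 1 1}" using assms by blast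
    then have "x = 1 *\<^sub>R axis 1 1 \<or> x = (- 1) *\<^sub>R axis 1 1" by simp
    moreover have "\<bar>1 :: real\<bar> = 1" "\<bar>- 1 :: real\<bar> = 1" by simp_all
    ultimately show False using False x(1) by blast
  qed
  have "closed std_triangle"
    unfolding std_triangle_def
    by (intro closed_Collect_conj closed_Collect_eq closed_Collect_le continuous_intros)
  then obtain \<delta> where \<delta>: "\<delta> > 0" "\<And>x y. x \<in> closed_segment a b \<Longrightarrow> y \<in> std_triangle \<Longrightarrow> \<delta> \<le> dist x y"
    using separate_compact_closed[OF compact_segment _ disj] by blast
  \<comment> \<open>A point of the support is moved into the triangle by clamping its second
    coordinate and dropping the third. Each costs at most \<open>1 / M\<close>, and two thirds of
    \<open>\<delta>\<close> is less than \<open>\<delta>\<close>.\<close>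
  define M where "M = 3 / \<delta>"
  have M: "M > 0" using \<delta>(1) by (simp add: M_def)
  have "tent M x = 0" if x: "x \<in> closed_segment a b" for x
  proof (rule ccontr)
    assume "tent M x \<noteq> 0"
    then have t: "1 - \<bar>x $ 1\<bar> > max (M / (M + 1) * x $ 2) (- M * x $ 2) + M * \<bar>x $ 3\<bar>"
      by (auto simp: tent_def max_def split: if_splits)
    have ge: "max (M / (M + 1) * x $ 2) (- M * x $ 2) \<ge> 0" "M * \<bar>x $ 3\<bar> \<ge> 0"
      using M tent_slope_nonneg by simp_all
    have x1: "\<bar>x $ 1\<bar> < 1" using t ge by linarith
    have "M * \<bar>x $ 3\<bar> < 1" using t ge by linarith
    then have x3: "\<bar>x $ 3\<bar> < 1 / M" using M by (simp add: field_simps)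
    have "- M * x $ 2 < 1" using t ge by linarith
    then have x2: "- (1 / M) < x $ 2" using M by (simp add: field_simps)
    have "M / (M + 1) * x $ 2 < 1 - \<bar>x $ 1\<bar>" using t ge by linarith
    then have "M * x $ 2 < (1 - \<bar>x $ 1\<bar>) * (M + 1)" using M by (simp add: field_simps)
    also have "\<dots> \<le> M * (1 - \<bar>x $ 1\<bar>) + 1" by (simp add: algebra_simps)
    finally have x2': "x $ 2 < 1 - \<bar>x $ 1\<bar> + 1 / M" using M by (simp add: field_simps)
    define z where "z = max 0 (min (x $ 2) (1 - \<bar>x $ 1\<bar>))"
    define y :: "real^3" where "y = vector [x $ 1, z, 0]"
    have y: "y $ 1 = x $ 1" "y $ 2 = z" "y $ 3 = 0" by (simp_all add: y_def)
    have "y \<in> std_triangle" unfolding std_triangle_def using x1 by (auto simp: y z_def)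
    then have "\<delta> \<le> dist x y" using \<delta>(2) x by blast
    also have "\<dots> \<le> (\<Sum>i\<in>UNIV. \<bar>(x - y) $ i\<bar>)" unfolding dist_norm by (rule norm_le_l1_cart)
    also have "\<dots> = \<bar>x $ 2 - z\<bar> + \<bar>x $ 3\<bar>" by (simp add: sum_3 y)
    also have "\<dots> < 1 / M + 1 / M"
    proof -
      have "1 / M > 0" using M by simp
      then have "\<bar>x $ 2 - z\<bar> \<le> 1 / M" unfolding z_def using x1 x2 x2' by linarith
      then show ?thesis using x3 by linarith
    qed
    also have "1 / M + 1 / M < \<delta>" using \<delta>(1) by (simp add: M_def)
    finally have "\<delta> < \<delta>" .
    then show False by simp
  qed
  then show ?thesis using M by blast
qed

lemma std_triangle_move:
  assumes "polygonal K" "K \<inter> std_triangle \<subseteq> {axis 1 1, - axis 1 1}"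
  shows "ambient_isotopic ({x. x $ 2 = 0 \<and> x $ 3 = 0 \<and> \<bar>x $ 1\<bar> \<le> 1} \<union> K)
    ({x. x $ 3 = 0 \<and> \<bar>x $ 1\<bar> \<le> 1 \<and> x $ 2 = 1 - \<bar>x $ 1\<bar>} \<union> K)" (is "ambient_isotopic (?A \<union> K) (?B \<union> K)")
proof -
  obtain F where F: "finite F" "K = (\<Union>(a, b)\<in>F. closed_segment a b)"
    using assms(1) by (auto simp: polygonal_def)
  have "\<exists>M>0. \<forall>x\<in>closed_segment a b. tent M x = 0" if "(a, b) \<in> F" for a b
    using that assms(2) unfolding F(2) by (intro tent_segment_eq_0) blast
  then obtain m where m: "\<And>a b. (a, b) \<in> F \<Longrightarrow> m a b > 0"
    "\<And>a b x. (a, b) \<in> F \<Longrightarrow> x \<in> closed_segment a b \<Longrightarrow> tent (m a b) x = 0" by metis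
  define M where "M = Max (insert 1 (case_prod m ` F))"
  have fin: "finite (insert 1 (case_prod m ` F))" using F(1) by simp
  have "1 \<le> M" unfolding M_def using fin by (intro Max_ge) auto
  then have M: "M > 0" by linarith
  have K0: "tent M x = 0" if "x \<in> K" for x
  proof -
    obtain a b where ab: "(a, b) \<in> F" "x \<in> closed_segment a b" using \<open>x \<in> K\<close> F(2) by auto
    have "m a b \<le> M" unfolding M_def using fin ab by (intro Max_ge) (auto intro!: rev_image_eqI[OF ab(1)])
    then have "tent M x \<le> 0" using tent_mono[OF m(1)[OF ab(1)]] m(2)[OF ab] by metis
    moreover have "tent M x \<ge> 0" by (simp add: tent_def)
    ultimately show ?thesis by simp
  qed
  have A: "tent M x = 1 - \<bar>x $ 1\<bar>" if "x \<in> ?A" for x using that by (auto simp: tent_def)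
  show ?thesis
  proof (rule ambient_isotopicI[OF isotopic_id_tent[OF M]])
    have "(\<lambda>x. x + tent M x *\<^sub>R axis 2 1) ` K = K" using K0 by (simp cong: image_cong)
    moreover have "(\<lambda>x. x + tent M x *\<^sub>R axis 2 1) ` ?A = ?B"
    proof
      show "(\<lambda>x. x + tent M x *\<^sub>R axis 2 1) ` ?A \<subseteq> ?B" using A by (auto simp: axis_def)
      show "?B \<subseteq> (\<lambda>x. x + tent M x *\<^sub>R axis 2 1) ` ?A"
      proof
        fix y assume y: "y \<in> ?B"
        have x: "y - (1 - \<bar>y $ 1\<bar>) *\<^sub>R axis 2 1 \<in> ?A" using y by (auto simp: axis_def)
        have "y = (y - (1 - \<bar>y $ 1\<bar>) *\<^sub>R axis 2 1) + tent M (y - (1 - \<bar>y $ 1\<bar>) *\<^sub>R axis 2 1) *\<^sub>R axis 2 1"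
          unfolding A[OF x] by (simp add: axis_def)
        then show "y \<in> (\<lambda>x. x + tent M x *\<^sub>R axis 2 1) ` ?A" using x by (metis (no_types, lifting) image_eqI)
      qed
    qed
    ultimately show "(\<lambda>x. x + tent M x *\<^sub>R axis 2 1) ` (?A \<union> K) = ?B \<union> K" by (simp add: image_Un)
  qed
qed

text \<open>Affine coordinates with origin at the midpoint of \<open>p\<close> and \<open>r\<close>
  put \<open>p\<close>, \<open>r\<close>, \<open>q\<close> at \<open>- axis 1 1\<close>,
  \<open>axis 1 1\<close>, \<open>axis 2 1\<close>, and \<open>n\<close> supplies the third
  direction. The standard move is transported by conjugation.\<close>

theorem triangle_move:
  assumes free: "affinely_free p q r" and K: "polygonal K" "K \<inter> convex hull {p, q, r} \<subseteq> {p, r}"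
  shows "ambient_isotopic (closed_segment p r \<union> K) (closed_segment p q \<union> closed_segment q r \<union> K)"
proof -
  define m where "m = (1 / 2) *\<^sub>R (p + r)"
  define a where "a = (1 / 2) *\<^sub>R (r - p)"
  define d where "d = q - m"
  define n where "n = cross3 a d"
  have p: "p = m - a" and r: "r = m + a" and q: "q = m + d"
    by (simp_all add: m_def a_def d_def vec_eq_iff field_simps)
  have ad: "\<alpha> = 0 \<and> \<beta> = 0" if "\<alpha> *\<^sub>R a + \<beta> *\<^sub>R d = 0" for \<alpha> \<beta>
  proof -
    have "\<beta> *\<^sub>R (q - p) + ((\<alpha> - \<beta>) / 2) *\<^sub>R (r - p) = \<alpha> *\<^sub>R a + \<beta> *\<^sub>R d"
      unfolding p q r by (simp add: vec_eq_iff field_simps)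
    then have "\<beta> = 0 \<and> (\<alpha> - \<beta>) / 2 = 0"
      using free that unfolding affinely_free_def by metis
    then show ?thesis by auto
  qed
  have n0: "n \<noteq> 0"
  proof
    assume "n = 0"
    then have "(a \<bullet> d) *\<^sub>R a - (a \<bullet> a) *\<^sub>R d = 0" using Lagrange[of a a d] by (simp add: n_def)
    then have "a \<bullet> a = 0" using ad[of "a \<bullet> d" "- (a \<bullet> a)"] by simp
    then show False using ad[of 1 0] by simp
  qed
  define L where "L x = (x $ 1) *\<^sub>R a + (x $ 2) *\<^sub>R d + (x $ 3) *\<^sub>R n" for x :: "real^3"
  have lin: "linear L" by (rule linearI) (simp_all add: L_def scaleR_add_left scaleR_add_right)
  have L0: "x = 0" if "L x = 0" for x
  proof -
    have "L x \<bullet> n = x $ 3 * (n \<bullet> n)"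
      by (simp add: L_def inner_add_left n_def dot_cross_self)
    then have 3: "x $ 3 = 0" using n0 that by simp
    then have "x $ 1 = 0 \<and> x $ 2 = 0" using that by (intro ad) (simp add: L_def)
    then show "x = 0" using 3 by (simp add: vec_eq_iff forall_3)
  qed
  then have "inj L" using lin by (simp add: linear_injective_0)
  then obtain L' where L': "linear L'" "\<And>x. L' (L x) = x" "\<And>x. L (L' x) = x"
    using linear_injective_isomorphism[OF lin] by blast
  define \<Phi> where "\<Phi> x = m + L x" for x
  define \<Phi>' where "\<Phi>' y = - L' m + L' y" for y
  have inv1: "\<Phi> (\<Phi>' y) = y" and inv2: "\<Phi>' (\<Phi> x) = x" for x y
    by (simp_all add: \<Phi>_def \<Phi>'_def L' linear_add[OF lin] linear_add[OF L'(1)] linear_diff[OF lin])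
  have \<Phi>: "self_homeomorphism \<Phi>"
    using self_homeomorphism_comp[OF isotopic_id_self_homeomorphism[OF isotopic_id_translation[of m]]
      self_homeomorphism_linear[OF lin L0]]
    by (simp add: \<Phi>_def[abs_def] o_def add.commute)
  have \<Phi>_axis: "\<Phi> (axis 1 1) = r" "\<Phi> (- axis 1 1) = p"
    by (simp_all add: \<Phi>_def L_def axis_def p r)
  have tri: "\<Phi> x \<in> convex hull {p, q, r}" if "x \<in> std_triangle" for x
  proof -
    have x: "x $ 3 = 0" "0 \<le> x $ 2" "x $ 2 \<le> 1 - \<bar>x $ 1\<bar>" using that by (auto simp: std_triangle_def)
    have "\<Phi> x = ((1 - x $ 1 - x $ 2) / 2) *\<^sub>R p + (x $ 2) *\<^sub>R q + ((1 + x $ 1 - x $ 2) / 2) *\<^sub>R r"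
      by (simp add: \<Phi>_def L_def p q r x vec_eq_iff field_simps)
    moreover have "0 \<le> (1 - x $ 1 - x $ 2) / 2" "0 \<le> (1 + x $ 1 - x $ 2) / 2"
      using x(3) abs_ge_self[of "x $ 1"] abs_ge_minus_self[of "x $ 1"] by simp_all
    moreover have "(1 - x $ 1 - x $ 2) / 2 + x $ 2 + (1 + x $ 1 - x $ 2) / 2 = 1" by (simp add: field_simps)
    ultimately show ?thesis unfolding convex_hull_3 using x(2) by blast
  qed
  let ?A = "{x :: real^3. x $ 2 = 0 \<and> x $ 3 = 0 \<and> \<bar>x $ 1\<bar> \<le> 1}"
  let ?B = "{x :: real^3. x $ 3 = 0 \<and> \<bar>x $ 1\<bar> \<le> 1 \<and> x $ 2 = 1 - \<bar>x $ 1\<bar>}"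
  have coords: "\<Phi> (vector [s, t, 0]) = m + s *\<^sub>R a + t *\<^sub>R d" for s t
    by (simp add: \<Phi>_def L_def add.assoc)
  have vec: "x = vector [x $ 1, x $ 2, 0]" if "x $ 3 = 0" for x :: "real^3"
    using that by (simp add: vec_eq_iff forall_3)
  have A: "\<Phi> ` ?A = closed_segment p r"
  proof
    show "\<Phi> ` ?A \<subseteq> closed_segment p r"
    proof clarify
      fix x :: "real^3" assume x: "x $ 2 = 0" "x $ 3 = 0" "\<bar>x $ 1\<bar> \<le> 1"
      have "\<Phi> x = (1 - (1 + x $ 1) / 2) *\<^sub>R p + ((1 + x $ 1) / 2) *\<^sub>R r"
        using x by (simp add: \<Phi>_def L_def p r vec_eq_iff field_simps)
      moreover have "0 \<le> (1 + x $ 1) / 2" "(1 + x $ 1) / 2 \<le> 1" using x(3) by (simp_all add: abs_le_iff)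
      ultimately show "\<Phi> x \<in> closed_segment p r" unfolding in_segment by blast
    qed
    show "closed_segment p r \<subseteq> \<Phi> ` ?A"
    proof
      fix y assume "y \<in> closed_segment p r"
      then obtain t where t: "0 \<le> t" "t \<le> 1" "y = (1 - t) *\<^sub>R p + t *\<^sub>R r" by (auto simp: in_segment)
      have "y = \<Phi> (vector [2 * t - 1, 0, 0])"
        unfolding coords t(3) p r by (simp add: vec_eq_iff field_simps)
      moreover have "vector [2 * t - 1, 0, 0] \<in> ?A" using t by simp
      ultimately show "y \<in> \<Phi> ` ?A" by blast
    qed
  qed
  have B: "\<Phi> ` ?B = closed_segment p q \<union> closed_segment q r"
  proof
    show "\<Phi> ` ?B \<subseteq> closed_segment p q \<union> closed_segment q r"
    proof clarify
      fix x :: "real^3" assume x: "x $ 3 = 0" "\<bar>x $ 1\<bar> \<le> 1" "x $ 2 = 1 - \<bar>x $ 1\<bar>" "\<Phi> x \<notin> closed_segment q r"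
      show "\<Phi> x \<in> closed_segment p q"
      proof (cases "x $ 1 \<le> 0")
        case True
        have "\<Phi> x = (1 - (1 + x $ 1)) *\<^sub>R p + (1 + x $ 1) *\<^sub>R q"
        proof -
          have x2: "x $ 2 = 1 + x $ 1" using x(3) True by simp
          show ?thesis unfolding \<Phi>_def L_def p q x(1) x2 by (simp add: vec_eq_iff algebra_simps)
        qed
        moreover have "0 \<le> 1 + x $ 1" "1 + x $ 1 \<le> 1" using x(2) True by (simp_all add: abs_le_iff)
        ultimately show ?thesis unfolding in_segment by blast
      next
        case False
        have "\<Phi> x = (1 - x $ 1) *\<^sub>R q + (x $ 1) *\<^sub>R r"
        proof -
          have x2: "x $ 2 = 1 - x $ 1" using x(3) False by simp
          show ?thesis unfolding \<Phi>_def L_def q r x(1) x2 by (simp add: vec_eq_iff algebra_simps)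
        qed
        moreover have "0 \<le> x $ 1" "x $ 1 \<le> 1" using x(2) False by (simp_all add: abs_le_iff)
        ultimately have "\<Phi> x \<in> closed_segment q r" unfolding in_segment by blast
        then show ?thesis using x by simp
      qed
    qed
    have "y \<in> \<Phi> ` ?B" if y: "y \<in> closed_segment p q" for y
    proof -
      obtain t where t: "0 \<le> t" "t \<le> 1" "y = (1 - t) *\<^sub>R p + t *\<^sub>R q" using y by (auto simp: in_segment)
      have "y = \<Phi> (vector [t - 1, t, 0])"
        unfolding coords t(3) p q by (simp add: vec_eq_iff algebra_simps)
      moreover have "vector [t - 1, t, 0] \<in> ?B" using t by simp
      ultimately show ?thesis by blast
    qed
    moreover have "y \<in> \<Phi> ` ?B" if y: "y \<in> closed_segment q r" for y
    proof -
      obtain t where t: "0 \<le> t" "t \<le> 1" "y = (1 - t) *\<^sub>R q + t *\<^sub>R r" using y by (auto simp: in_segment)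
      have "y = \<Phi> (vector [t, 1 - t, 0])"
        unfolding coords t(3) q r by (simp add: vec_eq_iff algebra_simps)
      moreover have "vector [t, 1 - t, 0] \<in> ?B" using t by simp
      ultimately show ?thesis by blast
    qed
    ultimately show "closed_segment p q \<union> closed_segment q r \<subseteq> \<Phi> ` ?B" by blast
  qed
  have K': "polygonal (\<Phi>' ` K)" unfolding \<Phi>'_def using K(1) L'(1) by (rule polygonal_affine_image)
  have \<Phi>K: "\<Phi> ` (\<Phi>' ` K) = K" by (simp add: image_image inv1)
  have "\<Phi>' ` K \<inter> std_triangle \<subseteq> {axis 1 1, - axis 1 1}"
  proof
    fix x assume x: "x \<in> \<Phi>' ` K \<inter> std_triangle"
    then have "\<Phi> x \<in> K \<inter> convex hull {p, q, r}" using \<Phi>K tri by blast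
    then have "\<Phi> x = p \<or> \<Phi> x = r" using K(2) by blast
    then have "\<Phi>' (\<Phi> x) = \<Phi>' (\<Phi> (- axis 1 1)) \<or> \<Phi>' (\<Phi> x) = \<Phi>' (\<Phi> (axis 1 1))" unfolding \<Phi>_axis by auto
    then show "x \<in> {axis 1 1, - axis 1 1}" unfolding inv2 by auto
  qed
  then have "ambient_isotopic (\<Phi> ` (?A \<union> \<Phi>' ` K)) (\<Phi> ` (?B \<union> \<Phi>' ` K))"
    by (intro ambient_isotopic_homeomorphic_image std_triangle_move K' \<Phi>)
  then show ?thesis unfolding image_Un A B \<Phi>K .
qed

section \<open>Polygonal arcs in general position\<close>

lemma segment_diff_in_span:
  assumes "y \<in> closed_segment a b" "z \<in> closed_segment a b"
  shows "y - z \<in> span {b - a}"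
proof -
  obtain s t where st: "y = (1 - s) *\<^sub>R a + s *\<^sub>R b" "z = (1 - t) *\<^sub>R a + t *\<^sub>R b"
    using assms by (auto simp: in_segment)
  have "y - z = (s - t) *\<^sub>R (b - a)" unfolding st by (simp add: algebra_simps)
  then show ?thesis by (simp add: span_base span_scale)
qed

text \<open>The spans of pairs of segment directions have measure zero, so some \<open>w0\<close>
  avoids them all. Two segments that meet then admit no difference along \<open>w0\<close>; two
  disjoint ones are a positive distance apart, which a short multiple of \<open>w0\<close> cannot
  bridge.\<close>

lemma generic_translation:
  assumes "polygonal S"
  obtains w :: "real^3"
  where "\<And>x y s. x \<in> S \<Longrightarrow> y \<in> S \<Longrightarrow> \<bar>s\<bar> \<le> 1 \<Longrightarrow> y = x + s *\<^sub>R w \<Longrightarrow> s = 0"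
proof -
  obtain F where F: "finite F" "S = (\<Union>(a, b)\<in>F. closed_segment a b)"
    using assms by (auto simp: polygonal_def)
  let ?span = "\<lambda>i j. span {snd i - fst i, snd j - fst j} :: (real^3) set"
  have "negligible (?span i j)" for i j
  proof (rule negligible_lowdim)
    have "dim (?span i j) \<le> card {snd i - fst i, snd j - fst j}"
      by (rule dim_le_card) auto
    also have "\<dots> < DIM(real^3)" by (simp add: card_insert_if)
    finally show "dim (?span i j) < DIM(real^3)" .
  qed
  then have "negligible (\<Union>i\<in>F. \<Union>j\<in>F. ?span i j)"
    using F(1) by (intro negligible_Union) (auto intro!: negligible_Union)
  then have "(\<Union>i\<in>F. \<Union>j\<in>F. ?span i j) \<noteq> UNIV" using non_negligible_UNIV by metis
  then obtain w0 where w0: "\<And>i j. i \<in> F \<Longrightarrow> j \<in> F \<Longrightarrow> w0 \<notin> ?span i j" by blast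
  have "\<exists>\<delta>>0. \<forall>x\<in>closed_segment (fst i) (snd i). \<forall>y\<in>closed_segment (fst j) (snd j). \<forall>s.
      \<bar>s\<bar> * norm w0 < \<delta> \<longrightarrow> y = x + s *\<^sub>R w0 \<longrightarrow> s = 0" if ij: "i \<in> F" "j \<in> F" for i j
  proof (cases "closed_segment (fst i) (snd i) \<inter> closed_segment (fst j) (snd j) = {}")
    case True
    obtain \<delta> where \<delta>: "\<delta> > 0" "\<And>x y. x \<in> closed_segment (fst i) (snd i) \<Longrightarrow>
        y \<in> closed_segment (fst j) (snd j) \<Longrightarrow> \<delta> \<le> dist x y"
      using separate_compact_closed[OF compact_segment closed_segment True] by blast
    have "\<not> \<bar>s\<bar> * norm w0 < \<delta>" if "x \<in> closed_segment (fst i) (snd i)"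
      "y \<in> closed_segment (fst j) (snd j)" "y = x + s *\<^sub>R w0" for x y s
      using \<delta>(2)[OF that(1,2)] that(3) by (simp add: dist_norm)
    then show ?thesis using \<delta>(1) by blast
  next
    case False
    then obtain z where z: "z \<in> closed_segment (fst i) (snd i)" "z \<in> closed_segment (fst j) (snd j)" by blast
    have "s = 0" if "x \<in> closed_segment (fst i) (snd i)"
      "y \<in> closed_segment (fst j) (snd j)" "y = x + s *\<^sub>R w0" for x y s
    proof (rule ccontr)
      assume s: "s \<noteq> 0"
      have "x - z \<in> ?span i j" "y - z \<in> ?span i j"
        using segment_diff_in_span[OF that(1) z(1)] segment_diff_in_span[OF that(2) z(2)]
          span_mono[of "{snd i - fst i}" "{snd i - fst i, snd j - fst j}"]
          span_mono[of "{snd j - fst j}" "{snd i - fst i, snd j - fst j}"] by auto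
      from span_diff[OF this(2,1)] have "(y - z) - (x - z) \<in> ?span i j" .
      then have "s *\<^sub>R w0 \<in> ?span i j" using that(3) by simp
      then have "(1 / s) *\<^sub>R (s *\<^sub>R w0) \<in> ?span i j" by (rule span_scale)
      then show False using w0[OF ij] s by simp
    qed
    then show ?thesis by (intro exI[of _ 1]) auto
  qed
  then obtain \<delta> where \<delta>: "\<And>i j. i \<in> F \<Longrightarrow> j \<in> F \<Longrightarrow> \<delta> i j > 0"
    "\<And>i j x y s. i \<in> F \<Longrightarrow> j \<in> F \<Longrightarrow> x \<in> closed_segment (fst i) (snd i) \<Longrightarrow>
      y \<in> closed_segment (fst j) (snd j) \<Longrightarrow> \<bar>s\<bar> * norm w0 < \<delta> i j \<Longrightarrow> y = x + s *\<^sub>R w0 \<Longrightarrow> s = 0"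
    by metis
  define d where "d = Min (insert 1 (case_prod \<delta> ` (F \<times> F)))"
  have fin: "finite (insert 1 (case_prod \<delta> ` (F \<times> F)))" using F(1) by simp
  have d: "d > 0" unfolding d_def using fin \<delta>(1) by (subst Min_gr_iff) auto
  have d_le: "d \<le> \<delta> i j" if "i \<in> F" "j \<in> F" for i j
    unfolding d_def using fin that by (intro Min_le) (auto intro!: rev_image_eqI[of "(i, j)"])
  define \<epsilon> where "\<epsilon> = d / (norm w0 + 1)"
  have n1: "norm w0 + 1 > 0" by (simp add: add_nonneg_pos)
  have \<epsilon>: "\<epsilon> > 0" using d n1 by (simp add: \<epsilon>_def)
  have "\<epsilon> * norm w0 < \<epsilon> * (norm w0 + 1)" using \<epsilon> by simp
  also have "\<dots> = d" using n1 by (simp add: \<epsilon>_def)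
  finally have \<epsilon>d: "\<epsilon> * norm w0 < d" .
  show ?thesis
  proof (rule that[of "\<epsilon> *\<^sub>R w0"])
    fix x y s assume xy: "x \<in> S" "y \<in> S" and s: "\<bar>s\<bar> \<le> 1" and eq: "y = x + s *\<^sub>R (\<epsilon> *\<^sub>R w0)"
    obtain i j where i: "i \<in> F" "x \<in> closed_segment (fst i) (snd i)"
      and j: "j \<in> F" "y \<in> closed_segment (fst j) (snd j)"
      using xy unfolding F(2) by (auto simp: case_prod_unfold)
    have "\<bar>s * \<epsilon>\<bar> * norm w0 = \<bar>s\<bar> * (\<epsilon> * norm w0)" using \<epsilon> by (simp add: abs_mult)
    also have "\<dots> \<le> 1 * (\<epsilon> * norm w0)" using s \<epsilon> by (intro mult_right_mono) auto
    also have "\<dots> < \<delta> i j" using \<epsilon>d d_le[OF i(1) j(1)] by simp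
    finally have "s * \<epsilon> = 0" using \<delta>(2)[OF i(1) j(1) i(2) j(2), of "s * \<epsilon>"] eq by simp
    then show "s = 0" using \<epsilon> by simp
  qed
qed

text \<open>The inverse of the arc is monotone along a segment through an inner point of the piece, so
  that segment contains the whole piece.\<close>

lemma arc_straight_piece:
  fixes \<gamma> :: "real \<Rightarrow> real^3"
  assumes arc: "arc \<gamma>" and F: "path_image \<gamma> = (\<Union>(a, b)\<in>F. closed_segment a b)"
    and u: "0 \<le> u" "u < v" "v \<le> 1"
    and gap: "\<And>a b s. (a, b) \<in> F \<Longrightarrow> u < s \<Longrightarrow> s < v \<Longrightarrow> \<gamma> s \<noteq> a \<and> \<gamma> s \<noteq> b"
  shows "\<gamma> ` {u..v} = closed_segment (\<gamma> u) (\<gamma> v)"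
proof -
  obtain h where h: "homeomorphism {0..1} (path_image \<gamma>) \<gamma> h"
    using arc homeomorphism_arc by blast
  define s where "s = (u + v) / 2"
  have s: "u < s" "s < v" "0 \<le> s" "s \<le> 1" using u by (auto simp: s_def)
  then have "\<gamma> s \<in> path_image \<gamma>" by (auto simp: path_image_def)
  then obtain a b where ab: "(a, b) \<in> F" "\<gamma> s \<in> closed_segment a b" using F by auto
  have sub: "closed_segment a b \<subseteq> path_image \<gamma>" using ab(1) F by auto
  have main: "\<gamma> ` {u..v} = closed_segment (\<gamma> u) (\<gamma> v)"
    if seg: "closed_segment p q \<subseteq> path_image \<gamma>" "\<gamma> s \<in> closed_segment p q"
      and gap: "\<And>s. u < s \<Longrightarrow> s < v \<Longrightarrow> \<gamma> s \<noteq> p \<and> \<gamma> s \<noteq> q" and le: "h p \<le> h q" for p q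
  proof -
    define l where "l t = (1 - t) *\<^sub>R p + t *\<^sub>R q" for t
    define f where "f t = h (l t)" for t
    have l_in: "l t \<in> closed_segment p q" if "t \<in> {0..1}" for t
      using that by (auto simp: l_def in_segment)
    have h1: "h y \<in> {0..1}" "\<gamma> (h y) = y" if "y \<in> path_image \<gamma>" for y
      using h that by (auto simp: homeomorphism_def)
    have h2: "h (\<gamma> t) = t" if "t \<in> {0..1}" for t
      using h that by (auto simp: homeomorphism_def)
    have \<gamma>f: "\<gamma> (f t) = l t" "f t \<in> {0..1}" if "t \<in> {0..1}" for t
      using h1 l_in[OF that] seg(1) by (auto simp: f_def)
    obtain \<tau> where \<tau>: "\<tau> \<in> {0..1}" "\<gamma> s = l \<tau>" using seg(2) by (auto simp: in_segment l_def)
    have fs: "f \<tau> = s" using \<tau> h2[of s] s by (simp add: f_def flip: \<tau>(2))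
    have pq: "p \<noteq> q"
    proof
      assume "p = q"
      then have "\<gamma> s = p" using seg(2) by simp
      then show False using gap s by blast
    qed
    have cont: "continuous_on {0..1} f"
      unfolding f_def
      by (rule continuous_on_compose2[of "path_image \<gamma>" h])
         (use h l_in seg(1) in \<open>auto simp: homeomorphism_def l_def intro!: continuous_intros\<close>)
    have "inj_on f {0..1}"
    proof (rule inj_onI)
      fix x y assume xy: "x \<in> {0..1}" "y \<in> {0..1}" "f x = f y"
      then have "l x = l y" using \<gamma>f by metis
      then have "(x - y) *\<^sub>R (q - p) = 0" by (simp add: l_def algebra_simps)
      then show "x = y" using pq by simp
    qed
    then have "strict_mono_on {0..1} f \<or> strict_antimono_on {0..1} f"
      using injective_eq_monotone_map[OF _ cont] by (simp add: is_interval_cc)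
    moreover have f01: "f 0 = h p" "f 1 = h q" by (simp_all add: f_def l_def)
    moreover have "\<not> strict_antimono_on {0..1} f"
    proof
      assume "strict_antimono_on {0..1} f"
      then have "f 1 < f 0" by (rule monotone_onD) auto
      then show False using f01 le by simp
    qed
    ultimately have mono: "strict_mono_on {0..1} f" by blast
    have f_less: "f x < f y \<longleftrightarrow> x < y" if "x \<in> {0..1}" "y \<in> {0..1}" for x y
      using mono that by (meson strict_mono_on_less)
    have f_le: "f x \<le> f y \<longleftrightarrow> x \<le> y" if "x \<in> {0..1}" "y \<in> {0..1}" for x y
      using mono that by (meson strict_mono_on_less_eq)
    have p_in: "h p \<in> {0..1}" "\<gamma> (h p) = p" "h q \<in> {0..1}" "\<gamma> (h q) = q"
      using h1 seg(1) by auto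
    have "h p \<le> s" "s \<le> h q" using f_le[of 0 \<tau>] f_le[of \<tau> 1] \<tau>(1) fs f01 by auto
    \<comment> \<open>\<open>p\<close> and \<open>q\<close> are not reached between times
      \<open>u\<close> and \<open>v\<close>, while \<open>s\<close> lies between the times at which
      they are reached.\<close>
    then have hu: "h p \<le> u" "v \<le> h q" using gap[of "h p"] gap[of "h q"] p_in s by force+
    have surj: "\<exists>t\<in>{0..1}. f t = x" if "u \<le> x" "x \<le> v" for x
      using IVT'[of f 0 x 1] cont f01 hu that by force
    obtain \<mu> \<nu> where \<mu>: "\<mu> \<in> {0..1}" "f \<mu> = u" and \<nu>: "\<nu> \<in> {0..1}" "f \<nu> = v"
      using surj u(2) by (metis less_imp_le order_refl)
    have \<mu>\<nu>: "\<mu> < \<nu>" using f_less[OF \<mu>(1) \<nu>(1)] \<mu>(2) \<nu>(2) u(2) by simp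
    have \<gamma>uv: "\<gamma> u = l \<mu>" "\<gamma> v = l \<nu>" using \<gamma>f \<mu> \<nu> by auto
    have l_seg: "(1 - r) *\<^sub>R l \<mu> + r *\<^sub>R l \<nu> = l (\<mu> + r * (\<nu> - \<mu>))" for r
      by (simp add: l_def algebra_simps)
    show ?thesis
    proof
      show "\<gamma> ` {u..v} \<subseteq> closed_segment (\<gamma> u) (\<gamma> v)"
      proof clarify
        fix x assume x: "x \<in> {u..v}"
        then obtain t where t: "t \<in> {0..1}" "f t = x" using surj[of x] by auto
        have "\<mu> \<le> t" "t \<le> \<nu>" using f_le[OF \<mu>(1) t(1)] f_le[OF t(1) \<nu>(1)] x t(2) \<mu>(2) \<nu>(2) by auto
        then have "0 \<le> (t - \<mu>) / (\<nu> - \<mu>)" "(t - \<mu>) / (\<nu> - \<mu>) \<le> 1" using \<mu>\<nu> by (auto simp: field_simps)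
        moreover have "l t = (1 - (t - \<mu>) / (\<nu> - \<mu>)) *\<^sub>R l \<mu> + ((t - \<mu>) / (\<nu> - \<mu>)) *\<^sub>R l \<nu>"
          unfolding l_seg using \<mu>\<nu> by simp
        ultimately show "\<gamma> x \<in> closed_segment (\<gamma> u) (\<gamma> v)"
          unfolding in_segment \<gamma>uv using \<gamma>f(1)[OF t(1)] t(2) by auto
      qed
      show "closed_segment (\<gamma> u) (\<gamma> v) \<subseteq> \<gamma> ` {u..v}"
      proof
        fix y assume "y \<in> closed_segment (\<gamma> u) (\<gamma> v)"
        then obtain r where r: "0 \<le> r" "r \<le> 1" "y = l (\<mu> + r * (\<nu> - \<mu>))"
          unfolding in_segment \<gamma>uv l_seg by blast
        have "0 \<le> r * (\<nu> - \<mu>)" "r * (\<nu> - \<mu>) \<le> 1 * (\<nu> - \<mu>)"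
          using r(1,2) \<mu>\<nu> by (intro mult_nonneg_nonneg mult_right_mono; simp)+
        then have b: "\<mu> \<le> \<mu> + r * (\<nu> - \<mu>)" "\<mu> + r * (\<nu> - \<mu>) \<le> \<nu>" by (simp_all only: mult_1)
        then have t: "\<mu> + r * (\<nu> - \<mu>) \<in> {0..1}" using \<mu>(1) \<nu>(1) by auto
        have "u \<le> f (\<mu> + r * (\<nu> - \<mu>))" "f (\<mu> + r * (\<nu> - \<mu>)) \<le> v"
          using f_le[OF \<mu>(1) t] f_le[OF t \<nu>(1)] b \<mu>(2) \<nu>(2) by auto
        then show "y \<in> \<gamma> ` {u..v}" using \<gamma>f(1)[OF t] r(3) by (metis atLeastAtMost_iff image_eqI)
      qed
    qed
  qed
  show ?thesis
  proof (cases "h a \<le> h b")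
    case True
    then show ?thesis using main[OF sub ab(2)] gap[OF ab(1)] by blast
  next
    case False
    then show ?thesis
      using main[of b a] sub ab(2) gap[OF ab(1)] by (auto simp: closed_segment_commute)
  qed
qed

text \<open>Cutting at every time at which the arc passes an end of one of its segments provides the
  gaps that \<open>arc_straight_piece\<close> asks for. The prescribed node \<open>c\<close> will be
  the time of the middle vertex of a path of two edges.\<close>

lemma polygonal_arc_nodes:
  fixes \<gamma> :: "real \<Rightarrow> real^3"
  assumes arc: "arc \<gamma>" and poly: "polygonal (path_image \<gamma>)" and c: "c \<in> {0..1}"
  obtains n t where "t 0 = 0" "t n = 1" "\<And>i j. i < j \<Longrightarrow> j \<le> n \<Longrightarrow> t i < (t j :: real)"
    "\<exists>m\<le>n. t m = c"
    "\<And>i. i < n \<Longrightarrow> \<gamma> ` {t i..t (Suc i)} = closed_segment (\<gamma> (t i)) (\<gamma> (t (Suc i)))"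
proof -
  obtain F where F: "finite F" "path_image \<gamma> = (\<Union>(a, b)\<in>F. closed_segment a b)"
    using poly by (auto simp: polygonal_def)
  define N where "N = {0, 1, c} \<union> {s \<in> {0..1}. \<gamma> s \<in> fst ` F \<union> snd ` F}"
  have "finite (\<gamma> -` (fst ` F \<union> snd ` F) \<inter> {0..1})"
    using F(1) arc by (intro finite_vimage_IntI) (auto simp: arc_def)
  moreover have "{s \<in> {0..1}. \<gamma> s \<in> fst ` F \<union> snd ` F} = \<gamma> -` (fst ` F \<union> snd ` F) \<inter> {0..1}" by auto
  ultimately have N: "finite N" "N \<subseteq> {0..1}" using c by (auto simp: N_def)
  define ts where "ts = sorted_list_of_set N"
  have ts: "sorted_wrt (<) ts" "set ts = N" using N(1) by (auto simp: ts_def)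
  have N0: "0 \<in> N" "1 \<in> N" "c \<in> N" by (auto simp: N_def)
  define n where "n = length ts - 1"
  have len: "length ts = Suc n" using ts(2) N0 by (cases ts) (auto simp: n_def)
  have mono: "ts ! i < ts ! j" if "i < j" "j \<le> n" for i j
    using ts(1) that len by (auto simp: sorted_wrt_iff_nth_less)
  have ex: "\<exists>k\<le>n. ts ! k = s" if "s \<in> N" for s
    using that ts(2) len by (metis in_set_conv_nth less_Suc_eq_le)
  have in_N: "ts ! k \<in> N" if "k \<le> n" for k using that ts(2) len by (metis le_imp_less_Suc nth_mem)
  show ?thesis
  proof (rule that[of "(!) ts" n])
    show "ts ! 0 = 0"
    proof -
      obtain k where "k \<le> n" "ts ! k = 0" using ex N0 by blast
      then show ?thesis using mono[of 0 k] in_N[of 0] N(2) by (cases "k = 0") auto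
    qed
    show "ts ! n = 1"
    proof -
      obtain k where "k \<le> n" "ts ! k = 1" using ex N0 by blast
      then show ?thesis using mono[of k n] in_N[of n] N(2) by (cases "k = n") auto
    qed
    show "\<exists>m\<le>n. ts ! m = c" using ex N0 by blast
    fix i assume i: "i < n"
    have b: "ts ! i \<in> {0..1}" "ts ! Suc i \<in> {0..1}" using in_N[of i] in_N[of "Suc i"] i N(2) by auto
    show "\<gamma> ` {ts ! i..ts ! Suc i} = closed_segment (\<gamma> (ts ! i)) (\<gamma> (ts ! Suc i))"
    proof (rule arc_straight_piece[OF arc F(2)])
      show "ts ! i < ts ! Suc i" using mono i by simp
      fix a b' s assume ab: "(a, b') \<in> F" and s: "ts ! i < s" "s < ts ! Suc i"
      have "s \<notin> N"
      proof
        assume "s \<in> N"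
        then obtain k where k: "k \<le> n" "ts ! k = s" using ex by blast
        have "i < k" using s(1) k mono[of k i] i by (cases "k < i"; cases "k = i") auto
        moreover have "k < Suc i" using s(2) k mono[of "Suc i" k] by (cases "Suc i < k"; cases "k = Suc i") auto
        ultimately show False by simp
      qed
      then have "\<gamma> s \<notin> fst ` F \<union> snd ` F" using b s by (auto simp: N_def)
      then show "\<gamma> s \<noteq> a \<and> \<gamma> s \<noteq> b'" using ab by force
    qed (use b in auto)
  qed (use mono in auto)
qed

section \<open>Strips along polygonal arcs\<close>

text \<open>\<open>S\<close> is all that the copy has to avoid, not only the arc.
  \<open>generic\<close> says that the translates of \<open>S\<close> by
  \<open>s *\<^sub>R w\<close>, for \<open>s\<close> between 0 and 1, are pairwise disjoint. With at
  least two segments there is an inner node to push off.\<close>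

locale strip =
  fixes x :: "nat \<Rightarrow> real^3" and n :: nat and w :: "real^3" and S :: "(real^3) set"
  assumes n2: "n \<ge> 2"
    and generic: "\<And>a b s. a \<in> S \<Longrightarrow> b \<in> S \<Longrightarrow> \<bar>s\<bar> \<le> 1 \<Longrightarrow> b = a + s *\<^sub>R w \<Longrightarrow> s = 0"
    and X_S: "\<And>i. i < n \<Longrightarrow> closed_segment (x i) (x (Suc i)) \<subseteq> S"
    and x_neq: "\<And>i. i < n \<Longrightarrow> x i \<noteq> x (Suc i)"
    and X_Int: "\<And>i j z. i < j \<Longrightarrow> j < n \<Longrightarrow> z \<in> closed_segment (x i) (x (Suc i))
      \<Longrightarrow> z \<in> closed_segment (x j) (x (Suc j)) \<Longrightarrow> j = Suc i \<and> z = x j"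
begin

definition X :: "nat \<Rightarrow> (real^3) set" where
  "X i = closed_segment (x i) (x (Suc i))"

text \<open>The ends stay in place, so the copy joins the same points as the arc, and the strip
  tapers to a triangle over the first and the last segment.\<close>

definition ht :: "nat \<Rightarrow> real" where
  "ht i = (if 0 < i \<and> i < n then 1 else 0)"

definition y :: "nat \<Rightarrow> real^3" where
  "y i = x i + ht i *\<^sub>R w"

definition Y :: "nat \<Rightarrow> (real^3) set" where
  "Y i = closed_segment (y i) (y (Suc i))"

lemma y_0 [simp]: "y 0 = x 0" and y_n [simp]: "y n = x n"
  by (simp_all add: y_def ht_def)

lemma ht_01: "0 \<le> ht i" "ht i \<le> 1"
  by (simp_all add: ht_def)

lemma X_subset: "i < n \<Longrightarrow> X i \<subseteq> S"
  using X_S by (simp add: X_def)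

lemma X_inter: "i < j \<Longrightarrow> j < n \<Longrightarrow> z \<in> X i \<Longrightarrow> z \<in> X j \<Longrightarrow> j = Suc i \<and> z = x j"
  using X_Int by (simp add: X_def)

lemma x_in_X: "x i \<in> X i" "x (Suc i) \<in> X i"
  by (simp_all add: X_def)

lemma x_in_X_iff:
  assumes "k \<le> n" "i < n" "x k \<in> X i"
  shows "k = i \<or> k = Suc i"
proof (rule ccontr)
  assume *: "\<not> ?thesis"
  show False
  proof (cases "k < i")
    case True
    then have "x k = x i" "i = Suc k" using X_inter[OF True assms(2) x_in_X(1) assms(3)] by auto
    then show False using x_neq[of k] assms by simp
  next
    case False
    then obtain j where j: "k = Suc j" "i < j" using * by (cases k) auto
    then have "x k = x j" using X_inter[OF j(2), of "x k"] x_in_X(2)[of j] assms by auto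
    then show False using x_neq[of j] assms j by simp
  qed
qed

text \<open>Base point and height are coordinates on the swept set; the disjointness arguments below
  compare them.\<close>

lemma unique_rep:
  assumes "a \<in> S" "b \<in> S" "0 \<le> s" "s \<le> 1" "0 \<le> t" "t \<le> 1" "a + s *\<^sub>R w = b + t *\<^sub>R w"
  shows "a = b \<and> s = t"
proof -
  have "b = a + (s - t) *\<^sub>R w" using assms(7) by (simp add: algebra_simps)
  then have "s - t = 0" using assms by (intro generic[of a b]) auto
  then show ?thesis using assms(7) by simp
qed

text \<open>If \<open>w\<close> were parallel to a segment, a short multiple of it would lead from
  one end of the segment to another point of the segment, against \<open>generic\<close>.\<close>

lemma w_free:
  assumes "i < n" "\<alpha> *\<^sub>R (x (Suc i) - x i) + \<beta> *\<^sub>R w = 0"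
  shows "\<alpha> = 0 \<and> \<beta> = 0"
proof -
  have "\<beta> = 0"
  proof (rule ccontr)
    assume \<beta>: "\<beta> \<noteq> 0"
    define k where "k = - \<alpha> / \<beta>"
    have "(1 / \<beta>) *\<^sub>R (\<beta> *\<^sub>R w) = (1 / \<beta>) *\<^sub>R (- \<alpha> *\<^sub>R (x (Suc i) - x i))"
      using assms(2) by (simp add: add_eq_0_iff2)
    then have w: "w = k *\<^sub>R (x (Suc i) - x i)" using \<beta> by (simp add: k_def)
    \<comment> \<open>Small enough that the step stays within the segment; the sign of
      \<open>k\<close> decides from which end it starts.\<close>
    define s where "s = 1 / (1 + \<bar>k\<bar>)"
    have s: "0 < s" "s \<le> 1" "\<bar>s * k\<bar> \<le> 1" by (auto simp: s_def abs_mult field_simps)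
    show False
    proof (cases "k \<ge> 0")
      case True
      have "x i + s *\<^sub>R w = (1 - s * k) *\<^sub>R x i + (s * k) *\<^sub>R x (Suc i)"
        unfolding w by (simp add: algebra_simps)
      moreover have "0 \<le> s * k" "s * k \<le> 1" using True s by (auto simp: abs_le_iff)
      ultimately have "x i + s *\<^sub>R w \<in> X i" unfolding X_def in_segment by blast
      then have "s = 0" using X_subset[OF assms(1)] x_in_X(1)[of i] s by (intro generic[of "x i" "x i + s *\<^sub>R w"]) auto
      then show False using s by simp
    next
      case False
      have "x (Suc i) + s *\<^sub>R w = (1 - (1 + s * k)) *\<^sub>R x i + (1 + s * k) *\<^sub>R x (Suc i)"
        unfolding w by (simp add: algebra_simps)
      moreover have "0 \<le> 1 + s * k" "1 + s * k \<le> 1" using False s by (auto simp: abs_le_iff mult_le_0_iff)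
      ultimately have "x (Suc i) + s *\<^sub>R w \<in> X i" unfolding X_def in_segment by blast
      then have "s = 0" using X_subset[OF assms(1)] x_in_X(2)[of i] s
        by (intro generic[of "x (Suc i)" "x (Suc i) + s *\<^sub>R w"]) auto
      then show False using s by simp
    qed
  qed
  then show ?thesis using assms x_neq[of i] by auto
qed

lemma Y_rep:
  assumes "z \<in> Y j"
  obtains t where "0 \<le> t" "t \<le> 1"
    "z = ((1 - t) *\<^sub>R x j + t *\<^sub>R x (Suc j)) + ((1 - t) * ht j + t * ht (Suc j)) *\<^sub>R w"
proof -
  obtain t where "0 \<le> t" "t \<le> 1" "z = (1 - t) *\<^sub>R y j + t *\<^sub>R y (Suc j)"
    using assms by (auto simp: Y_def in_segment)
  then show ?thesis by (intro that[of t]) (auto simp: y_def algebra_simps)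
qed

lemma convex_ht:
  assumes "0 \<le> t" "t \<le> 1"
  shows "0 \<le> (1 - t) * ht j + t * ht (Suc j)" "(1 - t) * ht j + t * ht (Suc j) \<le> 1"
proof -
  show "0 \<le> (1 - t) * ht j + t * ht (Suc j)"
    using assms ht_01 by (intro add_nonneg_nonneg mult_nonneg_nonneg) auto
  have "(1 - t) * ht j + t * ht (Suc j) \<le> (1 - t) * 1 + t * 1"
    using assms ht_01 by (intro add_mono mult_left_mono) auto
  then show "(1 - t) * ht j + t * ht (Suc j) \<le> 1" by simp
qed

text \<open>Equal coordinates force the base point into two segments of the arc, so it is their
  common node.\<close>

lemma above_X_in_Y:
  assumes ij: "i < j" "j < n" and a: "a \<in> X i" "0 \<le> s" "s \<le> 1" "a + s *\<^sub>R w \<in> Y j"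
  shows "a + s *\<^sub>R w = y (Suc i)"
proof -
  obtain t where t: "0 \<le> t" "t \<le> 1"
    "a + s *\<^sub>R w = ((1 - t) *\<^sub>R x j + t *\<^sub>R x (Suc j)) + ((1 - t) * ht j + t * ht (Suc j)) *\<^sub>R w"
    using Y_rep[OF a(4)] .
  have b: "(1 - t) *\<^sub>R x j + t *\<^sub>R x (Suc j) \<in> X j" unfolding X_def in_segment using t by blast
  have eq: "a = (1 - t) *\<^sub>R x j + t *\<^sub>R x (Suc j)" "s = (1 - t) * ht j + t * ht (Suc j)"
    using unique_rep[OF _ _ a(2,3) convex_ht[OF t(1,2)] t(3)] a(1) b X_subset[of i] X_subset[of j] ij by auto
  have aj: "j = Suc i" "a = x j" using X_inter[OF ij a(1)] b eq(1) by auto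
  have "t *\<^sub>R (x j - x (Suc j)) = 0" using eq(1) aj(2) by (simp add: algebra_simps)
  then have "t = 0" using x_neq[OF ij(2)] by simp
  then show ?thesis using eq aj by (simp add: y_def)
qed

text \<open>Points of \<open>S\<close> have height 0, and the height along the copy vanishes only at
  its two ends.\<close>

lemma Y_inter_S:
  assumes "j < n" "z \<in> Y j" "z \<in> S"
  shows "z = x 0 \<or> z = x n"
proof -
  obtain t where t: "0 \<le> t" "t \<le> 1"
    "z = ((1 - t) *\<^sub>R x j + t *\<^sub>R x (Suc j)) + ((1 - t) * ht j + t * ht (Suc j)) *\<^sub>R w"
    using Y_rep[OF assms(2)] .
  have b: "(1 - t) *\<^sub>R x j + t *\<^sub>R x (Suc j) \<in> X j" unfolding X_def in_segment using t by blast
  have "z = (1 - t) *\<^sub>R x j + t *\<^sub>R x (Suc j)" and 0: "(1 - t) * ht j + t * ht (Suc j) = 0"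
    using unique_rep[OF _ _ _ _ convex_ht[OF t(1,2)], of z _ 0] t(3) b X_subset[OF assms(1)] assms(3) by auto
  consider "j = 0" | "j > 0" "Suc j < n" | "j > 0" "Suc j = n" using assms(1) by linarith
  then show ?thesis
  proof cases
    case 1
    then have "t = 0" using 0 n2 by (simp add: ht_def)
    then show ?thesis using 1 t(3) by (simp add: ht_def)
  next
    case 2
    then show ?thesis using 0 assms(1) by (simp add: ht_def)
  next
    case 3
    then have "t = 1" using 0 assms(1) by (simp add: ht_def)
    then show ?thesis using 3 t(3) by (simp add: ht_def)
  qed
qed

lemma Y_inter:
  assumes "i < j" "j < n" "z \<in> Y i" "z \<in> Y j"
  shows "j = Suc i \<and> z = y j"
proof -
  obtain t where t: "0 \<le> t" "t \<le> 1"
    "z = ((1 - t) *\<^sub>R x i + t *\<^sub>R x (Suc i)) + ((1 - t) * ht i + t * ht (Suc i)) *\<^sub>R w"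
    using Y_rep[OF assms(3)] .
  have b: "(1 - t) *\<^sub>R x i + t *\<^sub>R x (Suc i) \<in> X i" unfolding X_def in_segment using t by blast
  have z: "z = y (Suc i)"
    using above_X_in_Y[OF assms(1,2) b convex_ht[OF t(1,2)]] assms(4) t(3) by simp
  obtain u where u: "0 \<le> u" "u \<le> 1"
    "z = ((1 - u) *\<^sub>R x j + u *\<^sub>R x (Suc j)) + ((1 - u) * ht j + u * ht (Suc j)) *\<^sub>R w"
    using Y_rep[OF assms(4)] .
  have c: "(1 - u) *\<^sub>R x j + u *\<^sub>R x (Suc j) \<in> X j" unfolding X_def in_segment using u by blast
  have "x (Suc i) = (1 - u) *\<^sub>R x j + u *\<^sub>R x (Suc j)"
  proof -
    have "x (Suc i) \<in> S" using X_subset[of i] x_in_X(2)[of i] assms(1,2) by auto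
    moreover have "(1 - u) *\<^sub>R x j + u *\<^sub>R x (Suc j) \<in> S" using c X_subset[OF assms(2)] by blast
    ultimately show ?thesis
      using unique_rep[OF _ _ ht_01 convex_ht[OF u(1,2)] u(3)[unfolded z, unfolded y_def]] by blast
  qed
  then have "x (Suc i) \<in> X j" using c by (simp only:)
  from X_inter[OF assms(1,2) x_in_X(2) this] have "j = Suc i" by blast
  then show ?thesis using z by simp
qed

lemma y_neq:
  assumes "i < n" shows "y i \<noteq> y (Suc i)"
proof
  assume "y i = y (Suc i)"
  then have "1 *\<^sub>R (x (Suc i) - x i) + (ht (Suc i) - ht i) *\<^sub>R w = 0"
    by (simp add: y_def algebra_simps)
  then show False using w_free[OF assms] by fastforce
qed

section \<open>Sweeping the strip cell by cell\<close>

context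
  fixes R :: "(real^3) set" and m :: nat
  assumes R: "polygonal R" "R \<subseteq> S" and m: "m \<le> n"
    and R_X: "\<And>i. i < n \<Longrightarrow> R \<inter> X i \<subseteq> {x m, x n}"
begin

text \<open>The part of the curve that stays fixed while cell \<open>i\<close> is crossed.\<close>

definition rest :: "nat \<Rightarrow> (real^3) set" where
  "rest i = (\<Union>j\<in>{j. j < n \<and> j \<noteq> i \<and> (j < i) \<noteq> (j < m)}. X j) \<union> (\<Union>j\<in>{i<..<n}. Y j) \<union> R"

text \<open>The curve after the first \<open>i\<close> cells are crossed. At the start it contains
  the base segments before node \<open>m\<close>; crossing a cell toggles its base segment, hence
  the exclusive or. The rung over \<open>x i\<close> joins the base to what is left of the
  copy.\<close>

definition stage :: "nat \<Rightarrow> (real^3) set" where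
  "stage i = (\<Union>j\<in>{j. j < n \<and> (j < i) \<noteq> (j < m)}. X j) \<union> closed_segment (x i) (y i)
    \<union> (\<Union>j\<in>{i..<n}. Y j) \<union> R"

lemma polygonal_rest: "polygonal (rest i)"
  unfolding rest_def X_def Y_def by (intro polygonal_Un polygonal_UN polygonal_segment R) auto

lemma rest_cases:
  assumes "z \<in> rest i"
  obtains j where "j < n" "j \<noteq> i" "(j < i) \<noteq> (j < m)" "z \<in> X j"
  | j where "i < j" "j < n" "z \<in> Y j"
  | "z \<in> R"
  using assms unfolding rest_def by auto

lemma stage_eq:
  assumes "i < n"
  shows "stage i = closed_segment (x i) (y i) \<union> Y i \<union> (rest i \<union> (if i < m then X i else {}))"
    and "stage (Suc i) = closed_segment (x (Suc i)) (y (Suc i)) \<union> (rest i \<union> (if i < m then {} else X i))"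
proof -
  have 1: "{i..<n} = insert i {i<..<n}" using assms by auto
  have 2: "{j. j < n \<and> (j < i) \<noteq> (j < m)} = {j. j < n \<and> j \<noteq> i \<and> (j < i) \<noteq> (j < m)} \<union> (if i < m then {i} else {})"
    using assms by auto
  show "stage i = closed_segment (x i) (y i) \<union> Y i \<union> (rest i \<union> (if i < m then X i else {}))"
    unfolding stage_def rest_def 1 2 by auto
  have 3: "{Suc i..<n} = {i<..<n}" by auto
  have 4: "{j. j < n \<and> (j < Suc i) \<noteq> (j < m)} = {j. j < n \<and> j \<noteq> i \<and> (j < i) \<noteq> (j < m)} \<union> (if i < m then {} else {i})"
    using assms by (auto simp: less_Suc_eq)
  show "stage (Suc i) = closed_segment (x (Suc i)) (y (Suc i)) \<union> (rest i \<union> (if i < m then {} else X i))"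
    unfolding stage_def rest_def 3 4 by auto
qed

text \<open>The first triangle of the cell cuts off the corner \<open>y i\<close>; in cell 0 the
  rung is degenerate and nothing has to move. The assumption \<open>im\<close> excludes a last cell
  whose base segment is still present: there \<open>y (Suc i)\<close> is \<open>x n\<close>, and the
  new segment would coincide with that base segment.\<close>

lemma stage_half:
  assumes i: "i < n" and im: "i < m \<Longrightarrow> Suc i < n"
  shows "ambient_isotopic (stage i) (closed_segment (x i) (y (Suc i)) \<union> (rest i \<union> (if i < m then X i else {})))"
proof (cases "i = 0")
  case True
  then have "closed_segment (x i) (y i) \<union> Y i = closed_segment (x i) (y (Suc i))"
    by (auto simp: Y_def)
  then show ?thesis unfolding stage_eq(1)[OF i] by (simp add: ambient_isotopic_refl)
next
  case False
  then have hi: "ht i = 1" using i by (simp add: ht_def)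
  let ?K = "rest i \<union> (if i < m then X i else {})"
  have K: "?K \<inter> convex hull {x i, y i, y (Suc i)} \<subseteq> {x i, y (Suc i)}"
  proof
    fix z assume z: "z \<in> ?K \<inter> convex hull {x i, y i, y (Suc i)}"
    then obtain \<alpha> \<beta> \<gamma> where c: "0 \<le> \<alpha>" "0 \<le> \<beta>" "0 \<le> \<gamma>" "\<alpha> + \<beta> + \<gamma> = 1"
      "z = \<alpha> *\<^sub>R x i + \<beta> *\<^sub>R y i + \<gamma> *\<^sub>R y (Suc i)"
      by (auto simp: convex_hull_3)
    \<comment> \<open>The base point and the height of a point of the triangle.\<close>
    define a where "a = (1 - \<gamma>) *\<^sub>R x i + \<gamma> *\<^sub>R x (Suc i)"
    define s where "s = \<beta> + \<gamma> * ht (Suc i)"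
    have \<alpha>: "\<alpha> = 1 - \<beta> - \<gamma>" using c(4) by simp
    have z_eq: "z = a + s *\<^sub>R w" unfolding c(5) \<alpha> a_def s_def y_def hi by (simp add: algebra_simps)
    have "\<gamma> \<le> 1" using c by simp
    then have aX: "a \<in> X i" unfolding X_def in_segment a_def using c(3) by blast
    have "\<gamma> * ht (Suc i) \<le> \<gamma> * 1" "0 \<le> \<gamma> * ht (Suc i)"
      using mult_left_mono[OF ht_01(2)[of "Suc i"] c(3)] mult_nonneg_nonneg[OF c(3) ht_01(1)] by auto
    then have s: "0 \<le> s" "s \<le> 1" using c by (auto simp: s_def)
    \<comment> \<open>Height 0 leaves only \<open>x i\<close>, except in the last cell, where the
      triangle has the whole base segment at height 0.\<close>
    have *: "z = x i \<or> z = y (Suc i)" if zS: "z \<in> S"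
      and zn: "z \<in> X i \<Longrightarrow> Suc i = n \<Longrightarrow> z \<in> {x i, x n}"
    proof -
      have "z = a \<and> 0 = s"
        using unique_rep[of z a 0 s] zS aX X_subset[OF i] s z_eq by auto
      then have az: "z = a" "\<beta> = 0" "\<gamma> * ht (Suc i) = 0"
        using add_nonneg_eq_0_iff[OF c(2) \<open>0 \<le> \<gamma> * ht (Suc i)\<close>] unfolding s_def by simp_all
      show ?thesis
      proof (cases "Suc i = n")
        case True
        have "z \<in> X i" using az aX by simp
        then show ?thesis using zn True y_n by auto
      next
        case False
        then have "\<gamma> = 0" using az(3) i by (simp add: ht_def)
        then show ?thesis using az(1) by (simp add: a_def)
      qed
    qed
    show "z \<in> {x i, y (Suc i)}"
    proof (cases "z \<in> rest i")
      case True
      then show ?thesis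
      proof (cases rule: rest_cases)
        case (1 j)
        have "z \<in> {x i, x n}" if "z \<in> X i" "Suc i = n"
          using X_inter[of j i z] 1 that by (auto simp: less_Suc_eq)
        then show ?thesis using * X_subset[OF 1(1)] 1(4) by blast
      next
        case (2 j)
        then show ?thesis using above_X_in_Y[OF 2(1,2) aX s] z_eq by simp
      next
        case 3
        have "z \<in> {x i, x n}" if "z \<in> X i" "Suc i = n"
        proof -
          have "z = x m \<or> z = x n" using R_X[OF i] 3 that by blast
          then show ?thesis using x_in_X_iff[OF m i] that by auto
        qed
        then show ?thesis using * R(2) 3 by blast
      qed
    next
      case False
      then have zX: "i < m" "z \<in> X i" using z by (auto split: if_splits)
      then show ?thesis using * X_subset[OF i] im by blast
    qed
  qed
  have free: "affinely_free (x i) (y i) (y (Suc i))"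
    unfolding affinely_free_def
  proof (intro allI impI)
    fix \<alpha> \<beta> assume "\<alpha> *\<^sub>R (y i - x i) + \<beta> *\<^sub>R (y (Suc i) - x i) = 0"
    then have "\<beta> *\<^sub>R (x (Suc i) - x i) + (\<alpha> + \<beta> * ht (Suc i)) *\<^sub>R w = 0"
      by (simp add: y_def hi algebra_simps)
    then have "\<beta> = 0 \<and> \<alpha> + \<beta> * ht (Suc i) = 0" by (rule w_free[OF i])
    then show "\<alpha> = 0 \<and> \<beta> = 0" by auto
  qed
  have "polygonal ?K" using polygonal_rest by (auto intro!: polygonal_Un simp: X_def polygonal_segment)
  then show ?thesis
    unfolding stage_eq(1)[OF i] Y_def by (intro ambient_isotopic_sym[OF triangle_move] free K)
qed

text \<open>The second triangle of the cell cancels the base segment if it is present, and otherwise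
  bends the diagonal down to it.\<close>

lemma stage_step:
  assumes i: "Suc i < n"
  shows "ambient_isotopic (stage i) (stage (Suc i))"
proof -
  have i': "i < n" using i by simp
  have hi: "ht (Suc i) = 1" using i by (simp add: ht_def)
  \<comment> \<open>The other base segments of the curve all lie on one side of cell
    \<open>i\<close>, after it if \<open>i < m\<close> and before it otherwise. So they can touch
    the triangle only at the end \<open>x k\<close> that the move keeps.\<close>
  have hull: "z \<in> {x k, y (Suc i)}"
    if z: "z \<in> rest i" "z \<in> convex hull {x i, x (Suc i), y (Suc i)}"
      and k: "k = (if i < m then Suc i else i)" for z k
  proof -
    obtain \<alpha> \<beta> \<gamma> where c: "0 \<le> \<alpha>" "0 \<le> \<beta>" "0 \<le> \<gamma>" "\<alpha> + \<beta> + \<gamma> = 1"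
      "z = \<alpha> *\<^sub>R x i + \<beta> *\<^sub>R x (Suc i) + \<gamma> *\<^sub>R y (Suc i)"
      using z(2) by (auto simp: convex_hull_3)
    define a where "a = (1 - (\<beta> + \<gamma>)) *\<^sub>R x i + (\<beta> + \<gamma>) *\<^sub>R x (Suc i)"
    have \<alpha>: "\<alpha> = 1 - (\<beta> + \<gamma>)" using c(4) by simp
    have z_eq: "z = a + \<gamma> *\<^sub>R w" unfolding c(5) \<alpha> a_def y_def hi by (simp add: algebra_simps)
    have "0 \<le> \<beta> + \<gamma>" "\<beta> + \<gamma> \<le> 1" using c by auto
    then have aX: "a \<in> X i" unfolding X_def in_segment a_def by blast
    have s: "0 \<le> \<gamma>" "\<gamma> \<le> 1" using c by auto
    have in_S: "z \<in> X i" if "z \<in> S"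
      using unique_rep[of z a 0 \<gamma>] that aX X_subset[OF i'] s z_eq by auto
    from z(1) show ?thesis
    proof (cases rule: rest_cases)
      case (1 j)
      then have zi: "z \<in> X i" using in_S X_subset by blast
      show ?thesis
      proof (cases "j < i")
        case True
        then show ?thesis using X_inter[OF True i' 1(4) zi] 1(3) k by auto
      next
        case False
        then have "i < j" using 1(2) by simp
        then show ?thesis using X_inter[OF _ 1(1) zi 1(4)] 1(3) k False by auto
      qed
    next
      case (2 j)
      then show ?thesis using above_X_in_Y[OF 2(1,2) aX s] z_eq by simp
    next
      case 3
      then have zi: "z \<in> X i" using in_S R by blast
      then have "z = x m \<or> z = x n" using R_X[OF i'] 3 by blast
      then show ?thesis using x_in_X_iff[OF m i'] x_in_X_iff[OF le_refl i'] zi i k by (auto split: if_splits)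
    qed
  qed
  have free: "affinely_free (x i) (x (Suc i)) (y (Suc i))" "affinely_free (x (Suc i)) (x i) (y (Suc i))"
    unfolding affinely_free_def
  proof (intro allI impI)
    fix \<alpha> \<beta> assume "\<alpha> *\<^sub>R (x (Suc i) - x i) + \<beta> *\<^sub>R (y (Suc i) - x i) = 0"
    then have "(\<alpha> + \<beta>) *\<^sub>R (x (Suc i) - x i) + \<beta> *\<^sub>R w = 0"
      by (simp add: y_def hi algebra_simps)
    then have "\<alpha> + \<beta> = 0 \<and> \<beta> = 0" by (rule w_free[OF i'])
    then show "\<alpha> = 0 \<and> \<beta> = 0" by simp
  next
    show "\<forall>\<alpha> \<beta>. \<alpha> *\<^sub>R (x i - x (Suc i)) + \<beta> *\<^sub>R (y (Suc i) - x (Suc i)) = 0 \<longrightarrow> \<alpha> = 0 \<and> \<beta> = 0"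
    proof (intro allI impI)
      fix \<alpha> \<beta> assume "\<alpha> *\<^sub>R (x i - x (Suc i)) + \<beta> *\<^sub>R (y (Suc i) - x (Suc i)) = 0"
      then have "(- \<alpha>) *\<^sub>R (x (Suc i) - x i) + \<beta> *\<^sub>R w = 0"
        by (simp add: y_def hi algebra_simps)
      then have "- \<alpha> = 0 \<and> \<beta> = 0" by (rule w_free[OF i'])
      then show "\<alpha> = 0 \<and> \<beta> = 0" by simp
    qed
  qed
  have "ambient_isotopic (stage i) (closed_segment (x i) (y (Suc i)) \<union> (rest i \<union> (if i < m then X i else {})))"
    using i by (intro stage_half) auto
  also have "ambient_isotopic (closed_segment (x i) (y (Suc i)) \<union> (rest i \<union> (if i < m then X i else {})))
      (stage (Suc i))"
  proof (cases "i < m")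
    case True
    have "rest i \<inter> convex hull {x (Suc i), x i, y (Suc i)} \<subseteq> {x (Suc i), y (Suc i)}"
      using hull[of _ "Suc i"] True by (auto simp: insert_commute)
    then have "ambient_isotopic (closed_segment (x (Suc i)) (x i) \<union> closed_segment (x i) (y (Suc i)) \<union> rest i)
        (closed_segment (x (Suc i)) (y (Suc i)) \<union> rest i)"
      by (intro ambient_isotopic_sym[OF triangle_move] free polygonal_rest)
    moreover have "closed_segment (x (Suc i)) (x i) = X i" by (simp add: X_def closed_segment_commute)
    ultimately show ?thesis unfolding stage_eq(2)[OF i'] using True by (simp add: Un_ac)
  next
    case False
    have "rest i \<inter> convex hull {x i, x (Suc i), y (Suc i)} \<subseteq> {x i, y (Suc i)}"
      using hull[of _ i] False by auto
    then have "ambient_isotopic (closed_segment (x i) (y (Suc i)) \<union> rest i)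
        (closed_segment (x i) (x (Suc i)) \<union> closed_segment (x (Suc i)) (y (Suc i)) \<union> rest i)"
      by (intro triangle_move free polygonal_rest)
    then show ?thesis unfolding stage_eq(2)[OF i'] using False by (simp add: X_def Un_ac)
  qed
  finally show ?thesis .
qed

lemma stage_iterate: "i < n \<Longrightarrow> ambient_isotopic (stage 0) (stage i)"
proof (induction i)
  case (Suc i)
  then show ?case using stage_step ambient_isotopic_trans Suc_lessD by blast
qed (simp add: ambient_isotopic_refl)

lemma stage_0: "stage 0 = (\<Union>j\<in>{..<m}. X j) \<union> (\<Union>j\<in>{..<n}. Y j) \<union> R"
proof -
  have "{j. j < n \<and> (j < 0) \<noteq> (j < m)} = {..<m}" using m by auto
  moreover have "x 0 \<in> (\<Union>j\<in>{..<n}. Y j)"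
    using n2 by (intro UN_I[of 0]) (auto simp: Y_def)
  ultimately show ?thesis unfolding stage_def by (auto simp: atLeast0LessThan)
qed

text \<open>The last cell is a triangle because \<open>y n = x n\<close>, so half a step already
  lands on its base segment.\<close>

lemma collapse:
  assumes "m < n"
  shows "ambient_isotopic ((\<Union>j\<in>{..<m}. X j) \<union> (\<Union>j\<in>{..<n}. Y j) \<union> R) ((\<Union>j\<in>{m..<n}. X j) \<union> R)"
proof -
  define i where "i = n - 1"
  have i: "i < n" "Suc i = n" "\<not> i < m" using assms by (auto simp: i_def)
  have "ambient_isotopic (stage 0) (stage i)" using i by (intro stage_iterate)
  also have "ambient_isotopic (stage i) (closed_segment (x i) (y (Suc i)) \<union> (rest i \<union> (if i < m then X i else {})))"
    using i by (intro stage_half) auto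
  also have "closed_segment (x i) (y (Suc i)) \<union> (rest i \<union> (if i < m then X i else {})) = (\<Union>j\<in>{m..<n}. X j) \<union> R"
  proof -
    have "{j. j < n \<and> j \<noteq> i \<and> (j < i) \<noteq> (j < m)} = {m..<i}" "{i<..<n} = {}" "{m..<n} = insert i {m..<i}"
      using i by auto
    moreover have "closed_segment (x i) (y (Suc i)) = X i" using i by (simp add: X_def)
    ultimately show ?thesis unfolding rest_def using i by auto
  qed
  finally show ?thesis unfolding stage_0 .
qed

end

text \<open>With \<open>m = n\<close> and nothing outside the strip, crossing all cells but the last
  shrinks the curve to the boundary of one triangle.\<close>

lemma trivial_knot_boundary:
  "trivial_knot ((\<Union>j\<in>{..<n}. X j) \<union> (\<Union>j\<in>{..<n}. Y j))"
proof -
  define i where "i = n - 1"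
  have i: "i < n" "Suc i = n" "0 < i" using n2 by (auto simp: i_def)
  note R = polygonal_empty empty_subsetI le_refl
  have "ambient_isotopic (stage {} n 0) (stage {} n i)"
    using i by (intro stage_iterate R) auto
  moreover have "stage {} n 0 = (\<Union>j\<in>{..<n}. X j) \<union> (\<Union>j\<in>{..<n}. Y j)"
    using stage_0[OF R] by auto
  moreover have "trivial_knot (stage {} n i)"
  proof -
    have "{j. j < n \<and> (j < i) \<noteq> (j < n)} = {i}" "{i..<n} = {i}" using i by auto
    then have "stage {} n i = X i \<union> closed_segment (x i) (y i) \<union> Y i"
      using stage_def[OF R] by auto
    also have "\<dots> = closed_segment (x i) (y i) \<union> closed_segment (y i) (x n) \<union> closed_segment (x n) (x i)"
      using i by (auto simp: X_def Y_def closed_segment_commute)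
    also have "trivial_knot \<dots>"
    proof (rule trivial_knot_triangle)
      show "affinely_free (x i) (y i) (x n)"
        unfolding affinely_free_def
      proof (intro allI impI)
        fix \<alpha> \<beta> assume "\<alpha> *\<^sub>R (y i - x i) + \<beta> *\<^sub>R (x n - x i) = 0"
        then have "\<beta> *\<^sub>R (x (Suc i) - x i) + \<alpha> *\<^sub>R w = 0"
          using i by (simp add: y_def ht_def algebra_simps)
        then show "\<alpha> = 0 \<and> \<beta> = 0" using w_free[OF i(1)] by blast
      qed
    qed
    finally show ?thesis .
  qed
  ultimately show ?thesis using trivial_knot_ambient_isotopic by metis
qed

end

section \<open>The strip traversed backwards\<close>

context strip
begin

lemma reversed: "strip (\<lambda>i. x (n - i)) n w S"
proof
  have n_Suc: "Suc (n - Suc i) = n - i" if "i < n" for i using that by simp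
  have seg: "closed_segment (x (n - i)) (x (n - Suc i)) = X (n - Suc i)" if "i < n" for i
    using n_Suc[OF that] by (simp add: X_def closed_segment_commute)
  show "2 \<le> n" by (rule n2)
  show "s = 0" if "a \<in> S" "b \<in> S" "\<bar>s\<bar> \<le> 1" "b = a + s *\<^sub>R w" for a b s
    using generic[OF that] .
  show "closed_segment (x (n - i)) (x (n - Suc i)) \<subseteq> S" if "i < n" for i
    using seg[OF that] X_subset[of "n - Suc i"] that by simp
  show "x (n - i) \<noteq> x (n - Suc i)" if "i < n" for i
    using x_neq[of "n - Suc i"] n_Suc[OF that] that by (metis diff_less less_imp_Suc_add zero_less_Suc)
  show "j = Suc i \<and> z = x (n - j)"
    if "i < j" "j < n" "z \<in> closed_segment (x (n - i)) (x (n - Suc i))"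
      "z \<in> closed_segment (x (n - j)) (x (n - Suc j))" for i j z
  proof -
    have "z \<in> X (n - Suc i)" "z \<in> X (n - Suc j)" using that seg[of i] seg[of j] by auto
    then have "n - Suc i = Suc (n - Suc j) \<and> z = x (n - Suc i)"
      using X_inter[of "n - Suc j" "n - Suc i" z] that by auto
    then have *: "n - Suc i = n - j" "z = x (n - Suc i)" using n_Suc[OF that(2)] by auto
    have "j = Suc i" using *(1) that(1,2) by linarith
    then show ?thesis using *(2) by simp
  qed
qed

text \<open>\<open>ht\<close> is symmetric, so the reversed strip has the same copy, and node
  \<open>m\<close> becomes node \<open>n - m\<close>. The sweep thus also runs from the other
  end.\<close>

lemma collapse_reversed:
  assumes "polygonal R" "R \<subseteq> S" "0 < m" "m \<le> n" "\<And>i. i < n \<Longrightarrow> R \<inter> X i \<subseteq> {x m, x 0}"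
  shows "ambient_isotopic ((\<Union>j\<in>{m..<n}. X j) \<union> (\<Union>j\<in>{..<n}. Y j) \<union> R) ((\<Union>j\<in>{..<m}. X j) \<union> R)"
proof -
  interpret rev: strip "\<lambda>i. x (n - i)" n w S by (rule reversed)
  have n_Suc: "Suc (n - Suc i) = n - i" if "i < n" for i using that by simp
  have X: "rev.X i = X (n - Suc i)" if "i < n" for i
    using n_Suc[OF that] by (simp add: rev.X_def X_def closed_segment_commute)
  have y: "rev.y i = y (n - i)" if "i \<le> n" for i
    using that by (auto simp: rev.y_def y_def ht_def)
  have Y: "rev.Y i = Y (n - Suc i)" if "i < n" for i
    using n_Suc[OF that] y[of i] y[of "Suc i"] that
    by (simp add: rev.Y_def Y_def closed_segment_commute)
  have flip: "(\<Union>j\<in>{k..<l}. f (n - Suc j)) = (\<Union>j\<in>{n - l..<n - k}. f j)"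
    if "l \<le> n" for k l and f :: "nat \<Rightarrow> (real^3) set"
  proof (intro equalityI UN_least)
    fix j assume "j \<in> {k..<l}"
    then have "n - Suc j \<in> {n - l..<n - k}" using that by auto
    then show "f (n - Suc j) \<subseteq> (\<Union>j\<in>{n - l..<n - k}. f j)" by blast
  next
    fix j assume "j \<in> {n - l..<n - k}"
    then have "n - Suc j \<in> {k..<l}" "n - Suc (n - Suc j) = j" using that by auto
    then show "f j \<subseteq> (\<Union>j\<in>{k..<l}. f (n - Suc j))" by (metis UN_upper)
  qed
  have "(\<Union>j\<in>{..<n - m}. rev.X j) = (\<Union>j\<in>{m..<n}. X j)"
    using flip[where l = "n - m" and k = 0 and f = X] X assms(4) by (simp add: atLeast0LessThan)
  moreover have "(\<Union>j\<in>{..<n}. rev.Y j) = (\<Union>j\<in>{..<n}. Y j)"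
    using flip[where l = n and k = 0 and f = Y] Y by (simp add: atLeast0LessThan)
  moreover have "(\<Union>j\<in>{n - m..<n}. rev.X j) = (\<Union>j\<in>{..<m}. X j)"
    using flip[where l = n and k = "n - m" and f = X] X assms(4) by (simp add: atLeast0LessThan)
  moreover have "ambient_isotopic ((\<Union>j\<in>{..<n - m}. rev.X j) \<union> (\<Union>j\<in>{..<n}. rev.Y j) \<union> R)
      ((\<Union>j\<in>{n - m..<n}. rev.X j) \<union> R)"
  proof (rule rev.collapse)
    show "R \<inter> rev.X i \<subseteq> {x (n - (n - m)), x (n - n)}" if "i < n" for i
      using assms(5)[of "n - Suc i"] X[OF that] assms(4) that by simp
  qed (use assms in auto)
  ultimately show ?thesis by simp
qed

end

section \<open>The parallel copy as an arc\<close>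

lemma arc_through_nodes:
  fixes z :: "nat \<Rightarrow> real^3"
  assumes "n > 0" "\<And>i. i < n \<Longrightarrow> z i \<noteq> z (Suc i)"
    and "\<And>i j q. i < j \<Longrightarrow> j < n \<Longrightarrow> q \<in> closed_segment (z i) (z (Suc i))
      \<Longrightarrow> q \<in> closed_segment (z j) (z (Suc j)) \<Longrightarrow> j = Suc i \<and> q = z j"
  shows "\<exists>g. arc g \<and> pathstart g = z 0 \<and> pathfinish g = z n
    \<and> path_image g = (\<Union>i\<in>{..<n}. closed_segment (z i) (z (Suc i)))"
  using assms
proof (induction n)
  case (Suc n)
  show ?case
  proof (cases "n = 0")
    case True
    then show ?thesis using Suc.prems by (intro exI[of _ "linepath (z 0) (z 1)"]) auto
  next
    case False
    have "\<exists>g. arc g \<and> pathstart g = z 0 \<and> pathfinish g = z n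
        \<and> path_image g = (\<Union>i\<in>{..<n}. closed_segment (z i) (z (Suc i)))"
    proof (rule Suc.IH)
      show "j = Suc i \<and> q = z j" if "i < j" "j < n" "q \<in> closed_segment (z i) (z (Suc i))"
        "q \<in> closed_segment (z j) (z (Suc j))" for i j q
        using Suc.prems(3)[of i j q] that by simp
    qed (use False Suc.prems(2) in auto)
    then obtain g where g: "arc g" "pathstart g = z 0" "pathfinish g = z n"
      "path_image g = (\<Union>i\<in>{..<n}. closed_segment (z i) (z (Suc i)))" by blast
    have "path_image g \<inter> path_image (linepath (z n) (z (Suc n))) \<subseteq> {z n}"
      using Suc.prems(3)[of _ n] unfolding g(4) by auto
    then have "arc (g +++ linepath (z n) (z (Suc n)))"
      using g Suc.prems(2)[of n] by (intro arc_join) auto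
    moreover have "path_image (g +++ linepath (z n) (z (Suc n)))
        = (\<Union>i\<in>{..<Suc n}. closed_segment (z i) (z (Suc i)))"
      using g by (subst path_image_join) (auto simp: lessThan_Suc)
    ultimately show ?thesis using g by (intro exI[of _ "g +++ linepath (z n) (z (Suc n))"]) auto
  qed
qed simp

text \<open>The conclusions on isotopy and triviality are the sweeps with the base present up to the
  start of the arc, up to \<open>v\<close>, up to \<open>v\<close> in the reversed strip, and up to
  the end. \<open>R\<close> is the part of the cycle outside the strip; it may touch the arc only at
  the ends of the path on which the sweep lands.\<close>

theorem parallel_arc:
  fixes g1 g2 :: "real \<Rightarrow> real^3"
  assumes arcs: "arc g1" "arc g2" and fin: "pathfinish g1 = pathstart g2"
    and inter: "path_image g1 \<inter> path_image g2 \<subseteq> {pathstart g2}"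
    and poly: "polygonal (path_image g1)" "polygonal (path_image g2)"
    and S: "polygonal S" "path_image g1 \<subseteq> S" "path_image g2 \<subseteq> S"
  defines "A1 \<equiv> path_image g1" and "A2 \<equiv> path_image g2"
    and "a \<equiv> pathstart g1" and "v \<equiv> pathfinish g1" and "b \<equiv> pathfinish g2"
  obtains g where "arc g" "pathstart g = a" "pathfinish g = b" "polygonal (path_image g)"
    "path_image g \<inter> S \<subseteq> {a, b}"
    "\<And>R. polygonal R \<Longrightarrow> R \<subseteq> S \<Longrightarrow> R \<inter> (A1 \<union> A2) \<subseteq> {a, b}
      \<Longrightarrow> ambient_isotopic (path_image g \<union> R) (A1 \<union> A2 \<union> R)"
    "\<And>R. polygonal R \<Longrightarrow> R \<subseteq> S \<Longrightarrow> R \<inter> (A1 \<union> A2) \<subseteq> {v, b}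
      \<Longrightarrow> ambient_isotopic (A1 \<union> path_image g \<union> R) (A2 \<union> R)"
    "\<And>R. polygonal R \<Longrightarrow> R \<subseteq> S \<Longrightarrow> R \<inter> (A1 \<union> A2) \<subseteq> {v, a}
      \<Longrightarrow> ambient_isotopic (A2 \<union> path_image g \<union> R) (A1 \<union> R)"
    "trivial_knot (A1 \<union> A2 \<union> path_image g)"
proof -
  define \<gamma> where "\<gamma> = g1 +++ g2"
  have \<gamma>: "arc \<gamma>" unfolding \<gamma>_def using arcs fin inter by (rule arc_join)
  have im: "path_image \<gamma> = A1 \<union> A2" unfolding \<gamma>_def A1_def A2_def using fin by (rule path_image_join)
  have poly_\<gamma>: "polygonal (path_image \<gamma>)" unfolding im A1_def A2_def using poly by (rule polygonal_Un)
  \<comment> \<open>The time at which the two arcs are joined becomes a node, so that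
    \<open>v\<close> is \<open>x m\<close> with \<open>m\<close> strictly between 0 and
    \<open>n\<close>.\<close>
  have "1 / 2 \<in> {0..1 :: real}" by simp
  then obtain n t where t01: "t 0 = 0" "t n = 1"
    and t_less: "\<And>i j. i < j \<Longrightarrow> j \<le> n \<Longrightarrow> t i < t j"
    and m: "\<exists>m\<le>n. t m = 1 / 2"
    and pieces: "\<And>i. i < n \<Longrightarrow> \<gamma> ` {t i..t (Suc i)} = closed_segment (\<gamma> (t i)) (\<gamma> (t (Suc i)))"
    using polygonal_arc_nodes[OF \<gamma> poly_\<gamma>] by metis
  obtain m where m: "m \<le> n" "t m = 1 / 2" using m by blast
  have m0: "0 < m" "m < n"
    using m t01 by (cases "m = 0"; cases "m = n"; simp)+
  have t_le: "t i \<le> t j" if "i \<le> j" "j \<le> n" for i j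
    using t_less[of i j] that by (cases "i = j") auto
  have t_in: "t i \<in> {0..1}" if "i \<le> n" for i
    using t_le[of 0 i] t_le[of i n] that t01 by simp
  have inj: "s = s'" if "\<gamma> s = \<gamma> s'" "s \<in> {0..1}" "s' \<in> {0..1}" for s s'
    using \<gamma> that by (auto simp: arc_def inj_on_def)
  define x where "x i = \<gamma> (t i)" for i
  obtain w where w: "\<And>x y s. x \<in> S \<Longrightarrow> y \<in> S \<Longrightarrow> \<bar>s\<bar> \<le> 1 \<Longrightarrow> y = x + s *\<^sub>R w \<Longrightarrow> s = 0"
    using generic_translation[OF S(1)] by blast
  interpret strip x n w S
  proof
    show "2 \<le> n" using m0 by simp
    show "s = 0" if "a \<in> S" "b \<in> S" "\<bar>s\<bar> \<le> 1" "b = a + s *\<^sub>R w" for a b s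
      using w[OF that] .
    show "closed_segment (x i) (x (Suc i)) \<subseteq> S" if "i < n" for i
    proof -
      have "\<gamma> ` {t i..t (Suc i)} \<subseteq> path_image \<gamma>"
        unfolding path_image_def using t_in[of i] t_in[of "Suc i"] that by (intro image_mono) auto
      then show ?thesis using pieces[OF that] im S unfolding x_def A1_def A2_def by blast
    qed
    show "x i \<noteq> x (Suc i)" if "i < n" for i
      using inj[of "t i" "t (Suc i)"] t_in[of i] t_in[of "Suc i"] t_less[of i "Suc i"] that
      by (auto simp: x_def)
    show "j = Suc i \<and> z = x j"
      if ij: "i < j" "j < n" and z: "z \<in> closed_segment (x i) (x (Suc i))" "z \<in> closed_segment (x j) (x (Suc j))"
      for i j z
    proof -
      have "z \<in> \<gamma> ` {t i..t (Suc i)}" "z \<in> \<gamma> ` {t j..t (Suc j)}"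
        using z pieces[of i] pieces[of j] ij by (auto simp: x_def)
      then obtain s s' where s: "t i \<le> s" "s \<le> t (Suc i)" "z = \<gamma> s"
        and s': "t j \<le> s'" "s' \<le> t (Suc j)" "z = \<gamma> s'" by auto
      have "s = s'"
        using s s' t_in[of i] t_in[of "Suc i"] t_in[of j] t_in[of "Suc j"] ij by (intro inj) auto
      then have "t j \<le> t (Suc i)" "s = t j"
        using s s' t_le[of "Suc i" j] ij by auto
      moreover have "j = Suc i"
        using \<open>t j \<le> t (Suc i)\<close> t_less[of "Suc i" j] ij by (cases "Suc i < j") auto
      ultimately show ?thesis using s by (simp add: x_def)
    qed
  qed
  have X_eq: "X i = \<gamma> ` {t i..t (Suc i)}" if "i < n" for i
    using pieces[OF that] by (simp add: X_def x_def)
  have X_UN: "(\<Union>j\<in>{k..<l}. X j) = \<gamma> ` {t k..t l}" if "k < l" "l \<le> n" for k l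
    using that
  proof (induction l)
    case (Suc l)
    show ?case
    proof (cases "k = l")
      case True
      then show ?thesis using X_eq[of l] Suc.prems by simp
    next
      case False
      then have kl: "k < l" using Suc.prems by simp
      then have "(\<Union>j\<in>{k..<Suc l}. X j) = \<gamma> ` {t k..t l} \<union> X l"
        using Suc by (simp add: atLeastLessThanSuc Un_commute)
      also have "\<dots> = \<gamma> ` ({t k..t l} \<union> {t l..t (Suc l)})"
        using X_eq[of l] Suc.prems by (simp add: image_Un)
      also have "{t k..t l} \<union> {t l..t (Suc l)} = {t k..t (Suc l)}"
        using t_le[of k l] t_le[of l "Suc l"] kl Suc.prems by (intro ivl_disj_un) auto
      finally show ?thesis .
    qed
  qed simp
  have A1: "(\<Union>j\<in>{..<m}. X j) = A1"
  proof -
    have "\<gamma> ` {0..1/2} = g1 ` {0..1}"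
    proof (intro equalityI subsetI)
      fix y assume "y \<in> \<gamma> ` {0..1/2}"
      then obtain s where "s \<in> {0..1/2}" "y = g1 (2 * s)" by (auto simp: \<gamma>_def joinpaths_def)
      then show "y \<in> g1 ` {0..1}" by auto
    next
      fix y assume "y \<in> g1 ` {0..1}"
      then obtain s where "s \<in> {0..1}" "y = g1 s" by auto
      then show "y \<in> \<gamma> ` {0..1/2}" by (intro image_eqI[of _ _ "s / 2"]) (auto simp: \<gamma>_def joinpaths_def)
    qed
    then show ?thesis using X_UN[of 0 m] m m0 t01 by (simp add: A1_def path_image_def atLeast0LessThan)
  qed
  have A2: "(\<Union>j\<in>{m..<n}. X j) = A2"
  proof -
    have "\<gamma> ` {1/2..1} = g2 ` {0..1}"
    proof (intro equalityI subsetI)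
      fix y assume "y \<in> \<gamma> ` {1/2..1}"
      then obtain s where s: "s \<in> {1/2..1}" "y = \<gamma> s" by auto
      have "y = g2 (2 * s - 1)"
      proof (cases "s = 1 / 2")
        case True
        show ?thesis unfolding s(2) True using fin
          by (simp add: \<gamma>_def joinpaths_def pathfinish_def pathstart_def)
      next
        case False
        then show ?thesis using s by (auto simp: \<gamma>_def joinpaths_def)
      qed
      then show "y \<in> g2 ` {0..1}" using s by auto
    next
      fix y assume "y \<in> g2 ` {0..1}"
      then obtain s where s: "s \<in> {0..1}" "y = g2 s" by auto
      have "y = \<gamma> ((s + 1) / 2)"
        using s fin by (cases "s = 0")
          (auto simp: \<gamma>_def joinpaths_def pathfinish_def pathstart_def add_divide_distrib)
      then show "y \<in> \<gamma> ` {1/2..1}" using s by (intro image_eqI[of _ _ "(s + 1) / 2"]) auto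
    qed
    then show ?thesis using X_UN[of m n] m m0 t01 by (simp add: A2_def path_image_def)
  qed
  have A12: "(\<Union>j\<in>{..<n}. X j) = A1 \<union> A2"
  proof -
    have "{..<n} = {..<m} \<union> {m..<n}" using m0 by auto
    then show ?thesis using A1 A2 by auto
  qed
  have x0: "x 0 = a" and xn: "x n = b"
    by (simp_all add: x_def t01 a_def b_def \<gamma>_def joinpaths_def pathstart_def pathfinish_def)
  have xm: "x m = v" by (simp add: x_def m(2) v_def \<gamma>_def joinpaths_def pathfinish_def)
  have R_X: "R \<inter> X i \<subseteq> K" if "R \<inter> (A1 \<union> A2) \<subseteq> K" "i < n" for R i K
    using that A12 by blast
  have "\<exists>g. arc g \<and> pathstart g = y 0 \<and> pathfinish g = y n
      \<and> path_image g = (\<Union>i\<in>{..<n}. closed_segment (y i) (y (Suc i)))"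
    using n2 y_neq Y_inter by (intro arc_through_nodes) (auto simp: Y_def)
  then obtain g where g: "arc g" "pathstart g = a" "pathfinish g = b"
    "path_image g = (\<Union>i\<in>{..<n}. Y i)"
    by (auto simp: Y_def x0 xn)
  show ?thesis
  proof (rule that[OF g(1-3)])
    show "polygonal (path_image g)" unfolding g(4) Y_def by (intro polygonal_UN polygonal_segment) auto
    show "path_image g \<inter> S \<subseteq> {a, b}" unfolding g(4) using Y_inter_S x0 xn by auto
    show "trivial_knot (A1 \<union> A2 \<union> path_image g)"
      using trivial_knot_boundary unfolding g(4) A12 .
    fix R assume R: "polygonal R" "R \<subseteq> S"
    show "ambient_isotopic (path_image g \<union> R) (A1 \<union> A2 \<union> R)" if "R \<inter> (A1 \<union> A2) \<subseteq> {a, b}"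
      using collapse[OF R, of 0] R_X[OF that] n2 x0 xn A12
      unfolding g(4) by (simp add: atLeast0LessThan)
    show "ambient_isotopic (A1 \<union> path_image g \<union> R) (A2 \<union> R)" if "R \<inter> (A1 \<union> A2) \<subseteq> {v, b}"
      using collapse[OF R m(1)] R_X[OF that] m0 xm xn A1 A2
      unfolding g(4) by simp
    show "ambient_isotopic (A2 \<union> path_image g \<union> R) (A1 \<union> R)" if "R \<inter> (A1 \<union> A2) \<subseteq> {v, a}"
      using collapse_reversed[OF R m0(1) m(1)] R_X[OF that] xm x0 A1 A2
      unfolding g(4) by simp
  qed
qed

section \<open>Cycles through the new edge\<close>

lemma graph_embedding_homeomorphic_image:
  assumes emb: "graph_embedding H p \<gamma>" and h: "self_homeomorphism h"
  shows "graph_embedding H (h \<circ> p) (\<lambda>e. h \<circ> \<gamma> e)"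
proof -
  note hD = self_homeomorphismD[OF h]
  have inj: "inj_on h A" for A using hD(2) by (rule inj_on_subset) simp
  have arcs: "arc (h \<circ> \<gamma> e) \<and> {pathstart (h \<circ> \<gamma> e), pathfinish (h \<circ> \<gamma> e)} = (h \<circ> p) ` e"
    if "e \<in> edges H" for e
  proof -
    have e: "arc (\<gamma> e)" "{pathstart (\<gamma> e), pathfinish (\<gamma> e)} = p ` e"
      using emb that by (auto simp: graph_embedding_def)
    have "arc (h \<circ> \<gamma> e)"
      using e(1) continuous_on_subset[OF hD(1)] inj unfolding arc_def
      by (intro conjI path_continuous_image comp_inj_on) auto
    moreover have "{pathstart (h \<circ> \<gamma> e), pathfinish (h \<circ> \<gamma> e)} = h ` {pathstart (\<gamma> e), pathfinish (\<gamma> e)}"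
      by (simp add: pathstart_compose pathfinish_compose)
    ultimately show ?thesis using e(2) by (simp add: image_comp)
  qed
  have mem: "h z \<in> h ` A \<longleftrightarrow> z \<in> A" for z A using hD(2) by (rule inj_image_mem_iff)
  have int: "h ` A \<inter> h ` B \<subseteq> (h \<circ> p) ` C" if "A \<inter> B \<subseteq> p ` C" for A B C
  proof -
    have "h ` A \<inter> h ` B = h ` (A \<inter> B)" using image_Int[OF hD(2)] by simp
    also have "\<dots> \<subseteq> h ` p ` C" using that by (rule image_mono)
    finally show ?thesis by (simp add: image_comp)
  qed
  show ?thesis
    unfolding graph_embedding_def path_image_compose
  proof (intro conjI ballI impI)
    show "inj_on (h \<circ> p) (verts H)"
      using emb inj by (auto simp: graph_embedding_def intro: comp_inj_on)
    fix e assume e: "e \<in> edges H"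
    show "arc (h \<circ> \<gamma> e)" "{pathstart (h \<circ> \<gamma> e), pathfinish (h \<circ> \<gamma> e)} = (h \<circ> p) ` e"
      using arcs[OF e] by blast+
    show "(h \<circ> p) v \<notin> h ` path_image (\<gamma> e)" if "v \<in> verts H" "v \<notin> e" for v
      using emb e that by (simp add: mem graph_embedding_def)
    show "h ` path_image (\<gamma> e) \<inter> h ` path_image (\<gamma> e') \<subseteq> (h \<circ> p) ` (e \<inter> e')"
      if "e' \<in> edges H" "e \<noteq> e'" for e'
      using emb e that by (intro int) (simp add: graph_embedding_def)
  qed
qed

lemma finite_cycle_edges: "finite (cycle_edges vs)"
proof -
  have "cycle_edges vs = (\<lambda>i. {vs ! i, vs ! (Suc i mod length vs)}) ` {..<length vs}"
    by (auto simp: cycle_edges_def)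
  then show ?thesis by simp
qed

text \<open>The homeomorphism from tameness straightens all edges at once;
  \<open>trivial_knot_polygonal_image\<close> keeps the cycles trivial under it.\<close>

lemma knotless_polygonal_embedding:
  assumes "\<not> intrinsically_knotted H"
  obtains p \<gamma> where "graph_embedding H p \<gamma>" "\<And>e. e \<in> edges H \<Longrightarrow> polygonal (path_image (\<gamma> e))"
    "\<And>vs. graph_cycle H vs \<Longrightarrow> trivial_knot (cycle_image \<gamma> vs)"
proof -
  obtain p \<gamma> where tame: "tame_embedding H p \<gamma>"
    and triv: "\<And>vs. graph_cycle H vs \<Longrightarrow> trivial_knot (cycle_image \<gamma> vs)"
    using assms by (auto simp: intrinsically_knotted_def)
  obtain h where h: "self_homeomorphism h" "\<And>e. e \<in> edges H \<Longrightarrow> polygonal (h ` path_image (\<gamma> e))"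
    and emb: "graph_embedding H p \<gamma>"
    using tame by (auto simp: tame_embedding_def)
  show ?thesis
  proof (rule that[OF graph_embedding_homeomorphic_image[OF emb h(1)]])
    show "polygonal (path_image (h \<circ> \<gamma> e))" if "e \<in> edges H" for e
      using h(2)[OF that] by (simp add: path_image_compose)
    fix vs assume vs: "graph_cycle H vs"
    have eq: "cycle_image (\<lambda>e. h \<circ> \<gamma> e) vs = h ` cycle_image \<gamma> vs"
      by (simp add: cycle_image_def path_image_compose image_UN)
    have "polygonal (h ` cycle_image \<gamma> vs)"
      unfolding cycle_image_def image_UN using vs h(2)
      by (intro polygonal_UN finite_cycle_edges) (auto simp: graph_cycle_def)
    then show "trivial_knot (cycle_image (\<lambda>e. h \<circ> \<gamma> e) vs)"
      unfolding eq by (rule trivial_knot_polygonal_image[OF triv[OF vs] h(1)])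
  qed
qed

lemma polygonal_embedding_not_intrinsically_knotted:
  assumes "graph_embedding G p \<gamma>" "\<And>e. e \<in> edges G \<Longrightarrow> polygonal (path_image (\<gamma> e))"
    and "\<And>vs. graph_cycle G vs \<Longrightarrow> trivial_knot (cycle_image \<gamma> vs)"
  shows "\<not> intrinsically_knotted G"
proof -
  have "tame_embedding G p \<gamma>"
    unfolding tame_embedding_def using assms(1,2) self_homeomorphism_id by (intro conjI exI[of _ id]) auto
  then show ?thesis using assms(3) unfolding intrinsically_knotted_def by blast
qed

section \<open>Vertex lists of paths and cycles\<close>

fun path_edges :: "'a list \<Rightarrow> 'a set set" where
  "path_edges (u # v # vs) = insert {u, v} (path_edges (v # vs))"
| "path_edges _ = {}"

lemma path_edges_append:
  "xs \<noteq> [] \<Longrightarrow> ys \<noteq> [] \<Longrightarrow> path_edges (xs @ ys) = insert {last xs, hd ys} (path_edges xs \<union> path_edges ys)"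
proof (induction xs rule: path_edges.induct)
  case ("2_2" u)
  then show ?case by (cases ys) auto
qed auto

lemma path_edges_rev: "path_edges (rev xs) = path_edges xs"
proof (induction xs)
  case (Cons u xs)
  show ?case
  proof (cases "xs = []")
    case False
    then have "path_edges (rev (u # xs)) = insert {hd xs, u} (path_edges xs)"
      using path_edges_append[of "rev xs" "[u]"] Cons by (simp add: last_rev)
    also have "\<dots> = path_edges (u # xs)" using False by (cases xs) (auto simp: insert_commute)
    finally show ?thesis .
  qed simp
qed simp

lemma path_edges_subset: "e \<in> path_edges xs \<Longrightarrow> e \<subseteq> set xs"
  by (induction xs rule: path_edges.induct) auto

lemma path_edges_nth: "path_edges xs = {{xs ! i, xs ! Suc i} | i. Suc i < length xs}"
proof (induction xs rule: path_edges.induct)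
  case (1 u v vs)
  have "{{(u # v # vs) ! i, (u # v # vs) ! Suc i} | i. Suc i < length (u # v # vs)}
      = insert {u, v} {{(v # vs) ! i, (v # vs) ! Suc i} | i. Suc i < length (v # vs)}" (is "?L = ?R")
  proof (intro equalityI subsetI)
    fix e assume "e \<in> ?L"
    then obtain i where "e = {(u # v # vs) ! i, (u # v # vs) ! Suc i}" "Suc i < length (u # v # vs)" by blast
    then show "e \<in> ?R" by (cases i) auto
  next
    fix e assume "e \<in> ?R"
    then consider "e = {u, v}" | i where "e = {(v # vs) ! i, (v # vs) ! Suc i}" "Suc i < length (v # vs)" by blast
    then show "e \<in> ?L"
    proof cases
      case 1
      then show ?thesis by (intro CollectI exI[of _ 0]) auto
    next
      case (2 i)
      then show ?thesis by (intro CollectI exI[of _ "Suc i"]) auto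
    qed
  qed
  then show ?case using 1 by simp
qed auto

lemma cycle_edges_eq:
  assumes "vs \<noteq> []"
  shows "cycle_edges vs = insert {last vs, hd vs} (path_edges vs)"
proof (intro equalityI subsetI)
  fix e assume "e \<in> cycle_edges vs"
  then obtain i where i: "i < length vs" "e = {vs ! i, vs ! (Suc i mod length vs)}"
    by (auto simp: cycle_edges_def)
  show "e \<in> insert {last vs, hd vs} (path_edges vs)"
  proof (cases "Suc i < length vs")
    case True
    then show ?thesis using i by (auto simp: path_edges_nth)
  next
    case False
    then have "Suc i = length vs" "i = length vs - 1" using i by simp_all
    then have "last vs = vs ! i" "e = {vs ! i, hd vs}" using i assms by (simp_all add: last_conv_nth hd_conv_nth)
    then show ?thesis by simp
  qed
next
  fix e assume "e \<in> insert {last vs, hd vs} (path_edges vs)"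
  then consider "e = {last vs, hd vs}" | i where "Suc i < length vs" "e = {vs ! i, vs ! Suc i}"
    by (auto simp: path_edges_nth)
  then show "e \<in> cycle_edges vs"
  proof cases
    case 1
    then show ?thesis using assms unfolding cycle_edges_def
      by (intro CollectI exI[of _ "length vs - 1"]) (auto simp: last_conv_nth hd_conv_nth)
  next
    case (2 i)
    then show ?thesis unfolding cycle_edges_def by (intro CollectI exI[of _ i]) auto
  qed
qed

lemma cycle_edges_append:
  "xs \<noteq> [] \<Longrightarrow> ys \<noteq> [] \<Longrightarrow> cycle_edges (xs @ ys)
    = insert {last xs, hd ys} (insert {last ys, hd xs} (path_edges xs \<union> path_edges ys))"
  by (auto simp: cycle_edges_eq path_edges_append)

lemma split_at_path_edge:
  "e \<in> path_edges vs \<Longrightarrow> \<exists>xs c d ys. vs = xs @ c # d # ys \<and> e = {c, d}"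
proof (induction vs rule: path_edges.induct)
  case (1 u v vs)
  show ?case
  proof (cases "e = {u, v}")
    case True
    then show ?thesis by (intro exI[of _ "[]"]) auto
  next
    case False
    then obtain xs c d ys where "v # vs = xs @ c # d # ys" "e = {c, d}" using 1 by auto
    then show ?thesis by (intro exI[of _ "u # xs"]) auto
  qed
qed auto

text \<open>The vertex list is rotated until the given edge is the closing one, and reversed if its
  ends come in the wrong order. Length at least 3 leaves an inner vertex.\<close>

lemma cycle_through_edge:
  assumes "distinct vs" "length vs \<ge> 3" "{a, b} \<in> cycle_edges vs"
  obtains us where "us \<noteq> []" "distinct (a # us @ [b])" "set (a # us @ [b]) = set vs"
    "cycle_edges vs = insert {a, b} (path_edges (a # us @ [b]))"
proof -
  note found = that
  have vs0: "vs \<noteq> []" using assms(2) by auto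
  obtain ws where ws: "distinct ws" "length ws \<ge> 3" "set ws = set vs" "cycle_edges ws = cycle_edges vs"
    "{last ws, hd ws} = {a, b}"
  proof (cases "{a, b} = {last vs, hd vs}")
    case True
    then show ?thesis using that[of vs] assms by simp
  next
    case False
    then have "{a, b} \<in> path_edges vs" using assms(3) by (simp add: cycle_edges_eq[OF vs0])
    then obtain xs c d ys where vs: "vs = xs @ c # d # ys" "{a, b} = {c, d}"
      using split_at_path_edge by metis
    \<comment> \<open>Here the list is cut between \<open>c\<close> and \<open>d\<close> and its two
      parts are exchanged.\<close>
    show ?thesis
    proof (rule that[of "(d # ys) @ (xs @ [c])"])
      have "vs = (xs @ [c]) @ (d # ys)" using vs by simp
      then show "cycle_edges ((d # ys) @ (xs @ [c])) = cycle_edges vs"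
        by (simp only: cycle_edges_append not_Cons_self2 append_is_Nil_conv list.distinct simp_thms)
           (auto simp: insert_commute)
    qed (use vs assms in auto)
  qed
  have fin: ?thesis
    if ws: "distinct ws" "length ws \<ge> 3" "set ws = set vs" "path_edges ws = P" "hd ws = a" "last ws = b"
      "insert {a, b} P = cycle_edges vs" for ws P
  proof -
    obtain us' where "ws = a # us'" using ws by (cases ws) auto
    moreover from this obtain us where "us' = us @ [b]" using ws(2,6) by (cases us' rule: rev_cases) auto
    ultimately have "ws = a # us @ [b]" by simp
    then show ?thesis using ws by (intro found[of us]) auto
  qed
  have ws0: "ws \<noteq> []" using ws(2) by auto
  have C: "insert {a, b} (path_edges ws) = cycle_edges vs"
    using ws(4,5) by (simp add: cycle_edges_eq[OF ws0])
  consider "hd ws = a" "last ws = b" | "hd ws = b" "last ws = a"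
    using ws(5) by (auto simp: doubleton_eq_iff)
  then show ?thesis
  proof cases
    case 1
    then show ?thesis using fin[of ws] ws C by simp
  next
    case 2
    then show ?thesis using fin[of "rev ws"] ws C ws0 by (simp add: path_edges_rev hd_rev last_rev)
  qed
qed

lemma endpoints_not_in_path_edges:
  assumes "us \<noteq> []" "distinct (a # us @ [b])"
  shows "{a, b} \<notin> path_edges (a # us @ [b])"
proof
  assume *: "{a, b} \<in> path_edges (a # us @ [b])"
  obtain u us' where us: "us = u # us'" using assms(1) by (cases us) auto
  then have "{a, b} = {a, u} \<or> {a, b} \<in> path_edges (us @ [b])" using * by simp
  then show False
  proof
    assume "{a, b} = {a, u}"
    then show False using assms us by (auto simp: doubleton_eq_iff)
  next
    assume "{a, b} \<in> path_edges (us @ [b])"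
    then show False using path_edges_subset[of "{a, b}" "us @ [b]"] assms by auto
  qed
qed

section \<open>Putting back the deleted edge\<close>

lemma oriented_arc:
  assumes "arc g" "{pathstart g, pathfinish g} = {u, v}"
  obtains g' where "arc g'" "path_image g' = path_image g" "pathstart g' = u" "pathfinish g' = v"
proof (cases "pathstart g = u")
  case True
  then show ?thesis using that[of g] assms by (auto simp: doubleton_eq_iff)
next
  case False
  then show ?thesis using that[of "reversepath g"] assms
    by (auto simp: doubleton_eq_iff arc_reversepath)
qed

theorem add_edge_to_triangle:
  assumes G: "simple_graph G" and ab: "{a, b} \<in> edges G" and va: "{v, a} \<in> edges G" and vb: "{v, b} \<in> edges G"
    and deg: "vdegree G v = 3" and H: "\<not> intrinsically_knotted (delete_edge G {a, b})"
  shows "\<not> intrinsically_knotted G"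
proof -
  let ?H = "delete_edge G {a, b}"
  have edgesH: "edges ?H = edges G - {{a, b}}" and vertsH: "verts ?H = verts G"
    by (simp_all add: delete_edge_def)
  have edge: "finite e" "e \<subseteq> verts G" "card e = 2" if "e \<in> edges G" for e
    using G that by (auto simp: simple_graph_def intro: finite_subset)
  have "card {a, b} = 2" "card {v, a} = 2" "card {v, b} = 2"
    using edge(3) ab va vb by blast+
  then have neq: "a \<noteq> b" "v \<noteq> a" "v \<noteq> b" by auto
  have in_verts: "a \<in> verts G" "b \<in> verts G" "v \<in> verts G" using edge(2) ab va by blast+
  have vaH: "{v, a} \<in> edges ?H" and vbH: "{v, b} \<in> edges ?H"
    using va vb neq by (auto simp: edgesH doubleton_eq_iff)
  obtain p \<gamma> where emb: "graph_embedding ?H p \<gamma>"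
    and poly: "\<And>e. e \<in> edges ?H \<Longrightarrow> polygonal (path_image (\<gamma> e))"
    and triv: "\<And>vs. graph_cycle ?H vs \<Longrightarrow> trivial_knot (cycle_image \<gamma> vs)"
    using knotless_polygonal_embedding[OF H] by metis
  have inj: "inj_on p (verts G)" using emb by (simp add: graph_embedding_def vertsH)
  have arcs: "arc (\<gamma> e)" "{pathstart (\<gamma> e), pathfinish (\<gamma> e)} = p ` e" if "e \<in> edges ?H" for e
    using emb that by (auto simp: graph_embedding_def)
  have off: "p u \<notin> path_image (\<gamma> e)" if "e \<in> edges ?H" "u \<in> verts G" "u \<notin> e" for e u
    using emb that by (auto simp: graph_embedding_def vertsH)
  have cross: "path_image (\<gamma> e) \<inter> path_image (\<gamma> e') \<subseteq> p ` (e \<inter> e')"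
    if "e \<in> edges ?H" "e' \<in> edges ?H" "e \<noteq> e'" for e e'
    using emb that by (auto simp: graph_embedding_def)
  define img where "img E = (\<Union>e\<in>E. path_image (\<gamma> e))" for E
  have finE: "finite (edges G)"
  proof (rule finite_subset)
    show "edges G \<subseteq> Pow (verts G)" using edge(2) by blast
    show "finite (Pow (verts G))" using G by (simp add: simple_graph_def)
  qed
  have poly_img: "polygonal (img E)" if "E \<subseteq> edges ?H" for E
    unfolding img_def using that finE edgesH poly by (intro polygonal_UN) (auto intro: finite_subset)
  \<comment> \<open>Vertices are added so that the new arc also avoids those that lie on no
    edge.\<close>
  define S where "S = img (edges ?H) \<union> p ` verts G"
  have "polygonal (\<Union>u\<in>verts G. closed_segment (p u) (p u))"
    using G by (intro polygonal_UN polygonal_segment) (simp add: simple_graph_def)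
  moreover have "(\<Union>u\<in>verts G. closed_segment (p u) (p u)) = p ` verts G" by auto
  ultimately have S: "polygonal S" unfolding S_def using poly_img[of "edges ?H"] by (auto intro: polygonal_Un)
  have img_S: "img E \<subseteq> S" if "E \<subseteq> edges ?H" for E using that by (auto simp: S_def img_def)
  define A1 where "A1 = path_image (\<gamma> {v, a})"
  define A2 where "A2 = path_image (\<gamma> {v, b})"
  have A12: "A1 \<inter> A2 \<subseteq> {p v}"
    using cross[OF vaH vbH] neq by (auto simp: A1_def A2_def doubleton_eq_iff)
  obtain g1 where g1: "arc g1" "path_image g1 = A1" "pathstart g1 = p a" "pathfinish g1 = p v"
    using oriented_arc[of "\<gamma> {v, a}" "p a" "p v"] arcs[OF vaH] unfolding A1_def by (auto simp: insert_commute)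
  obtain g2 where g2: "arc g2" "path_image g2 = A2" "pathstart g2 = p v" "pathfinish g2 = p b"
    using oriented_arc[of "\<gamma> {v, b}" "p v" "p b"] arcs[OF vbH] unfolding A2_def by auto
  have A_S: "A1 \<subseteq> S" "A2 \<subseteq> S" using img_S[of "{{v, a}}"] img_S[of "{{v, b}}"] vaH vbH
    by (auto simp: A1_def A2_def img_def)
  have fin12: "pathfinish g1 = pathstart g2" using g1 g2 by simp
  have int12: "path_image g1 \<inter> path_image g2 \<subseteq> {pathstart g2}" using A12 g1 g2 by simp
  have poly12: "polygonal (path_image g1)" "polygonal (path_image g2)"
    using poly[OF vaH] poly[OF vbH] g1 g2 by (simp_all add: A1_def A2_def)
  have sub12: "path_image g1 \<subseteq> S" "path_image g2 \<subseteq> S" using A_S g1 g2 by simp_all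
  obtain g where g: "arc g" "pathstart g = p a" "pathfinish g = p b" "polygonal (path_image g)"
    and g_S: "path_image g \<inter> S \<subseteq> {p a, p b}"
    and move1: "\<And>R. polygonal R \<Longrightarrow> R \<subseteq> S \<Longrightarrow> R \<inter> (A1 \<union> A2) \<subseteq> {p a, p b}
      \<Longrightarrow> ambient_isotopic (path_image g \<union> R) (A1 \<union> A2 \<union> R)"
    and move2: "\<And>R. polygonal R \<Longrightarrow> R \<subseteq> S \<Longrightarrow> R \<inter> (A1 \<union> A2) \<subseteq> {p v, p b}
      \<Longrightarrow> ambient_isotopic (A1 \<union> path_image g \<union> R) (A2 \<union> R)"
    and move3: "\<And>R. polygonal R \<Longrightarrow> R \<subseteq> S \<Longrightarrow> R \<inter> (A1 \<union> A2) \<subseteq> {p v, p a}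
      \<Longrightarrow> ambient_isotopic (A2 \<union> path_image g \<union> R) (A1 \<union> R)"
    and move4: "trivial_knot (A1 \<union> A2 \<union> path_image g)"
    by (rule parallel_arc[OF g1(1) g2(1) fin12 int12 poly12 S sub12, unfolded g1(2-4) g2(2-4)])
      (rule that)
  define \<gamma>' where "\<gamma>' = \<gamma>({a, b} := g)"
  have \<gamma>'_old: "\<gamma>' e = \<gamma> e" if "e \<in> edges ?H" for e using that by (auto simp: \<gamma>'_def edgesH)
  have \<gamma>'_new: "\<gamma>' {a, b} = g" by (simp add: \<gamma>'_def)
  have edges_cases: "e = {a, b} \<or> e \<in> edges ?H" if "e \<in> edges G" for e using that by (auto simp: edgesH)
  have g_old: "path_image g \<inter> path_image (\<gamma> e) \<subseteq> p ` ({a, b} \<inter> e)" if e: "e \<in> edges ?H" for e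
  proof
    fix z assume z: "z \<in> path_image g \<inter> path_image (\<gamma> e)"
    then have "z \<in> S" using img_S[of "{e}"] e by (auto simp: img_def)
    then have "z = p a \<or> z = p b" using z g_S by blast
    then show "z \<in> p ` ({a, b} \<inter> e)" using z off[OF e] in_verts by auto
  qed
  have emb': "graph_embedding G p \<gamma>'"
    unfolding graph_embedding_def
  proof (intro conjI ballI impI)
    show "inj_on p (verts G)" by (rule inj)
    fix e assume e: "e \<in> edges G"
    have "arc (\<gamma>' e) \<and> {pathstart (\<gamma>' e), pathfinish (\<gamma>' e)} = p ` e"
    proof (cases "e = {a, b}")
      case True
      then show ?thesis using g \<gamma>'_new by simp
    next
      case False
      then have "e \<in> edges ?H" using edges_cases[OF e] by blast
      then show ?thesis using arcs[of e] \<gamma>'_old[of e] by simp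
    qed
    then show "arc (\<gamma>' e)" "{pathstart (\<gamma>' e), pathfinish (\<gamma>' e)} = p ` e" by blast+
    show "p u \<notin> path_image (\<gamma>' e)" if u: "u \<in> verts G" "u \<notin> e" for u
    proof (cases "e = {a, b}")
      case True
      have "p u \<in> S" using u by (simp add: S_def)
      moreover have "p u \<noteq> p a" "p u \<noteq> p b" using inj u in_verts True by (auto dest: inj_onD)
      ultimately show ?thesis using g_S True \<gamma>'_new by auto
    next
      case False
      then show ?thesis using off edges_cases[OF e] u \<gamma>'_old by auto
    qed
    fix e' assume e': "e' \<in> edges G" and neq: "e \<noteq> e'"
    consider "e = {a, b}" "e' \<in> edges ?H" | "e' = {a, b}" "e \<in> edges ?H" | "e \<in> edges ?H" "e' \<in> edges ?H"
      using edges_cases[OF e] edges_cases[OF e'] neq by blast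
    then show "path_image (\<gamma>' e) \<inter> path_image (\<gamma>' e') \<subseteq> p ` (e \<inter> e')"
    proof cases
      case 1
      then show ?thesis using g_old[of e'] \<gamma>'_old \<gamma>'_new by simp
    next
      case 2
      then show ?thesis using g_old[of e] \<gamma>'_old \<gamma>'_new by (simp add: Int_commute)
    next
      case 3
      then show ?thesis using cross neq \<gamma>'_old by simp
    qed
  qed
  have poly': "polygonal (path_image (\<gamma>' e))" if "e \<in> edges G" for e
    using edges_cases[OF that] poly g(4) \<gamma>'_old \<gamma>'_new by auto
  have trivH: "trivial_knot (img (cycle_edges vs))"
    if "length vs \<ge> 3" "distinct vs" "set vs \<subseteq> verts G" "cycle_edges vs \<subseteq> edges ?H" for vs
    using triv[of vs] that by (simp add: graph_cycle_def cycle_image_def img_def vertsH)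
  have meet1: "path_image (\<gamma> e) \<inter> A1 \<subseteq> p ` (e \<inter> {v, a})" if "e \<in> edges ?H" "e \<noteq> {v, a}" for e
    using cross[OF that(1) vaH that(2)] by (simp add: A1_def)
  have meet2: "path_image (\<gamma> e) \<inter> A2 \<subseteq> p ` (e \<inter> {v, b})" if "e \<in> edges ?H" "e \<noteq> {v, b}" for e
    using cross[OF that(1) vbH that(2)] by (simp add: A2_def)
  have "trivial_knot (cycle_image \<gamma>' vs)" if cyc: "graph_cycle G vs" for vs
  proof (cases "{a, b} \<in> cycle_edges vs")
    case False
    then have sub: "cycle_edges vs \<subseteq> edges ?H" using cyc by (auto simp: graph_cycle_def edgesH)
    then have "cycle_image \<gamma>' vs = img (cycle_edges vs)"
      unfolding cycle_image_def img_def using \<gamma>'_old by (intro SUP_cong) auto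
    then show ?thesis using trivH[of vs] cyc sub by (simp add: graph_cycle_def)
  next
    case True
    then obtain us where us: "us \<noteq> []" "distinct (a # us @ [b])" "set (a # us @ [b]) = set vs"
      "cycle_edges vs = insert {a, b} (path_edges (a # us @ [b]))"
      using cycle_through_edge[of vs a b] cyc by (auto simp: graph_cycle_def)
    define E where "E = path_edges (a # us @ [b])"
    have sub: "E \<subseteq> edges ?H"
      using cyc us(4) endpoints_not_in_path_edges[OF us(1,2)]
      by (auto simp: graph_cycle_def edgesH E_def)
    have Z: "cycle_image \<gamma>' vs = path_image g \<union> img E"
    proof -
      have "(\<Union>e\<in>E. path_image (\<gamma>' e)) = img E"
        unfolding img_def using \<gamma>'_old sub by (intro SUP_cong) auto
      then show ?thesis unfolding cycle_image_def us(4) E_def[symmetric] by (simp add: \<gamma>'_new)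
    qed
    have in_G: "set (a # us @ [b]) \<subseteq> verts G" using us(3) cyc by (simp add: graph_cycle_def)
    \<comment> \<open>The path from \<open>a\<close> to \<open>b\<close> that completes the new edge
      to the cycle either misses \<open>v\<close> or meets it next to an end. Otherwise
      \<open>v\<close> would have two further neighbours on the path besides \<open>a\<close> and
      \<open>b\<close>, four in all.\<close>
    consider "v \<notin> set us" | "us = [v]" | us' where "us = v # us'" "us' \<noteq> []"
      | us' where "us = us' @ [v]" "us' \<noteq> []"
    proof (cases "v \<in> set us")
      case True
      then obtain us1 us2 where us12: "us = us1 @ v # us2" by (meson split_list)
      have "us1 = [] \<or> us2 = []"
      proof (rule ccontr)
        assume "\<not> ?thesis"
        then obtain us1' c d us2' where cd: "us1 = us1' @ [c]" "us2 = d # us2'"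
          by (metis list.exhaust rev_exhaust)
        have "{c, v} \<in> E" "{v, d} \<in> E"
          unfolding E_def us12 cd
          using path_edges_append[of "a # us1' @ [c]" "v # d # us2' @ [b]"] by auto
        then have "{{v, a}, {v, b}, {v, c}, {v, d}} \<subseteq> {e \<in> edges G. v \<in> e}"
          using sub va vb by (auto simp: edgesH insert_commute)
        moreover have "finite {e \<in> edges G. v \<in> e}" using finE by simp
        ultimately have "card {{v, a}, {v, b}, {v, c}, {v, d}} \<le> 3"
          using deg card_mono unfolding vdegree_def by metis
        moreover have "distinct [a, b, c, d, v]" using us(2) unfolding us12 cd by auto
        then have "card {{v, a}, {v, b}, {v, c}, {v, d}} = 4"
          by (auto simp: card_insert_if doubleton_eq_iff)
        ultimately show False by simp
      qed
      then show ?thesis using that us12 by (cases us1; cases us2) auto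
    qed (use that in blast)
    then show ?thesis
    proof cases
      case 1
      \<comment> \<open>As \<open>v\<close> is off the path, the path meets the two old triangle
        edges only at \<open>a\<close> and \<open>b\<close>; the slide lands on the cycle that is
        closed up through \<open>v\<close>.\<close>
      have v: "v \<notin> e" if "e \<in> E" for e
        using path_edges_subset[of e "a # us @ [b]"] that 1 neq by (auto simp: E_def)
      have "img E \<inter> (A1 \<union> A2) \<subseteq> {p a, p b}"
      proof
        fix z assume z: "z \<in> img E \<inter> (A1 \<union> A2)"
        then obtain e where e: "e \<in> E" "z \<in> path_image (\<gamma> e)" by (auto simp: img_def)
        have "e \<noteq> {v, a}" "e \<noteq> {v, b}" using v[OF e(1)] by auto
        then have "z \<in> p ` (e \<inter> {v, a}) \<or> z \<in> p ` (e \<inter> {v, b})"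
          using meet1[of e] meet2[of e] e z sub by blast
        then show "z \<in> {p a, p b}" using v[OF e(1)] by auto
      qed
      then have "ambient_isotopic (path_image g \<union> img E) (A1 \<union> A2 \<union> img E)"
        using sub by (intro move1 poly_img img_S)
      moreover have C: "cycle_edges ((a # us @ [b]) @ [v]) = insert {v, a} (insert {v, b} E)"
        by (subst cycle_edges_append) (auto simp: E_def insert_commute)
      have "trivial_knot (img (cycle_edges ((a # us @ [b]) @ [v])))"
        using us(2) 1 neq in_G in_verts sub vaH vbH by (intro trivH) (simp_all only: C, auto)
      moreover have "img (cycle_edges ((a # us @ [b]) @ [v])) = A1 \<union> A2 \<union> img E"
        unfolding C by (auto simp: img_def A1_def A2_def)
      ultimately show ?thesis using Z trivial_knot_ambient_isotopic by metis
    next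
      case 2
      then have "E = {{v, a}, {v, b}}" by (auto simp: E_def insert_commute)
      then have "cycle_image \<gamma>' vs = A1 \<union> A2 \<union> path_image g"
        unfolding Z by (auto simp: img_def A1_def A2_def)
      then show ?thesis using move4 by simp
    next
      case (3 us')
      \<comment> \<open>The cycle runs from \<open>b\<close> along the new edge to \<open>a\<close>
        and on to \<open>v\<close>. \<open>E'\<close> is the remaining path from \<open>v\<close> to
        \<open>b\<close>, and the slide across the disc lands on the cycle that closes it by
        \<open>{v, b}\<close>.\<close>
      define E' where "E' = path_edges (v # us' @ [b])"
      have E: "E = insert {v, a} E'" using 3 by (auto simp: E_def E'_def insert_commute)
      have sub': "E' \<subseteq> edges ?H" using sub E by simp
      have not: "{v, b} \<notin> E'"
        unfolding E'_def using us(2) 3 by (intro endpoints_not_in_path_edges) auto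
      have a: "a \<notin> e" if "e \<in> E'" for e
        using path_edges_subset[of e "v # us' @ [b]"] that us(2) 3 by (auto simp: E'_def)
      have "img E' \<inter> (A1 \<union> A2) \<subseteq> {p v, p b}"
      proof
        fix z assume z: "z \<in> img E' \<inter> (A1 \<union> A2)"
        then obtain e where e: "e \<in> E'" "z \<in> path_image (\<gamma> e)" by (auto simp: img_def)
        have "e \<noteq> {v, a}" "e \<noteq> {v, b}" using a[OF e(1)] e(1) not by auto
        then have "z \<in> p ` (e \<inter> {v, a}) \<or> z \<in> p ` (e \<inter> {v, b})"
          using meet1[of e] meet2[of e] e z sub' by blast
        then show "z \<in> {p v, p b}" using a[OF e(1)] by auto
      qed
      then have "ambient_isotopic (A1 \<union> path_image g \<union> img E') (A2 \<union> img E')"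
        using sub' by (intro move2 poly_img img_S)
      moreover have C: "cycle_edges (v # us' @ [b]) = insert {v, b} E'"
        by (subst cycle_edges_eq) (auto simp: E'_def insert_commute)
      have "trivial_knot (img (cycle_edges (v # us' @ [b])))"
      proof (rule trivH)
        show "3 \<le> length (v # us' @ [b])" using 3(2) by (cases us') auto
        show "distinct (v # us' @ [b])" "set (v # us' @ [b]) \<subseteq> verts G" using us(2) in_G 3 by auto
        show "cycle_edges (v # us' @ [b]) \<subseteq> edges ?H" unfolding C using sub' vbH by simp
      qed
      moreover have "img (cycle_edges (v # us' @ [b])) = A2 \<union> img E'"
        unfolding C by (auto simp: img_def A2_def)
      moreover have "cycle_image \<gamma>' vs = A1 \<union> path_image g \<union> img E'"
        unfolding Z E by (auto simp: img_def A1_def)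
      ultimately show ?thesis using trivial_knot_ambient_isotopic by metis
    next
      case (4 us')
      \<comment> \<open>The mirror image: the remaining path from \<open>a\<close> to
        \<open>v\<close> ends up closed by \<open>{v, a}\<close>.\<close>
      define E' where "E' = path_edges (a # us' @ [v])"
      have E: "E = insert {v, b} E'"
        using path_edges_append[of "a # us' @ [v]" "[b]"] 4 by (auto simp: E_def E'_def)
      have sub': "E' \<subseteq> edges ?H" using sub E by simp
      have not: "{v, a} \<notin> E'"
        using endpoints_not_in_path_edges[of us' a v] us(2) 4 by (auto simp: E'_def insert_commute)
      have b: "b \<notin> e" if "e \<in> E'" for e
        using path_edges_subset[of e "a # us' @ [v]"] that us(2) 4 by (auto simp: E'_def)
      have "img E' \<inter> (A1 \<union> A2) \<subseteq> {p v, p a}"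
      proof
        fix z assume z: "z \<in> img E' \<inter> (A1 \<union> A2)"
        then obtain e where e: "e \<in> E'" "z \<in> path_image (\<gamma> e)" by (auto simp: img_def)
        have "e \<noteq> {v, a}" "e \<noteq> {v, b}" using b[OF e(1)] e(1) not by auto
        then have "z \<in> p ` (e \<inter> {v, a}) \<or> z \<in> p ` (e \<inter> {v, b})"
          using meet1[of e] meet2[of e] e z sub' by blast
        then show "z \<in> {p v, p a}" using b[OF e(1)] by auto
      qed
      then have "ambient_isotopic (A2 \<union> path_image g \<union> img E') (A1 \<union> img E')"
        using sub' by (intro move3 poly_img img_S)
      moreover have C: "cycle_edges (a # us' @ [v]) = insert {v, a} E'"
        by (subst cycle_edges_eq) (auto simp: E'_def)
      have "trivial_knot (img (cycle_edges (a # us' @ [v])))"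
      proof (rule trivH)
        show "3 \<le> length (a # us' @ [v])" using 4(2) by (cases us') auto
        show "distinct (a # us' @ [v])" "set (a # us' @ [v]) \<subseteq> verts G" using us(2) in_G 4 by auto
        show "cycle_edges (a # us' @ [v]) \<subseteq> edges ?H" unfolding C using sub' vaH by simp
      qed
      moreover have "img (cycle_edges (a # us' @ [v])) = A1 \<union> img E'"
        unfolding C by (auto simp: img_def A1_def)
      moreover have "cycle_image \<gamma>' vs = A2 \<union> path_image g \<union> img E'"
        unfolding Z E by (auto simp: img_def A2_def)
      ultimately show ?thesis using trivial_knot_ambient_isotopic by metis
    qed
  qed
  then show ?thesis
    using polygonal_embedding_not_intrinsically_knotted[OF emb' poly'] by blast
qed

theorem corollary8:
  fixes G :: "'a sgraph"
  assumes "MMIK G"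
  shows "\<not> (\<exists>v\<in>verts G. vdegree G v = 3 \<and>
            (\<exists>vs. graph_cycle G vs \<and> length vs = 3 \<and> v \<in> set vs))"
proof
  assume "\<exists>v\<in>verts G. vdegree G v = 3 \<and> (\<exists>vs. graph_cycle G vs \<and> length vs = 3 \<and> v \<in> set vs)"
  then obtain v vs where v: "vdegree G v = 3" "graph_cycle G vs" "length vs = 3" "v \<in> set vs" by blast
  then obtain c d e where vs: "vs = [c, d, e]"
    by (auto simp: numeral_3_eq_3 length_Suc_conv)
  then have E: "{c, d} \<in> edges G" "{d, e} \<in> edges G" "{c, e} \<in> edges G"
    using v(2) by (auto simp: graph_cycle_def cycle_edges_eq insert_commute)
  have "v = c \<or> v = d \<or> v = e" using v(4) vs by auto
  then obtain a b where ab: "{a, b} \<in> edges G" "{v, a} \<in> edges G" "{v, b} \<in> edges G"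
    using E that[of d e] that[of c e] that[of c d] by (auto simp: insert_commute)
  have "proper_minor (delete_edge G {a, b}) G"
    unfolding proper_minor_def using minor_step.intros(1)[OF ab(1)] by (rule tranclp.r_into_trancl)
  then have "\<not> intrinsically_knotted (delete_edge G {a, b})" "simple_graph G" "intrinsically_knotted G"
    using assms by (auto simp: MMIK_def)
  then show False using add_edge_to_triangle[OF _ ab v(1)] by blast
qed

end
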